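(* Let $m\ge 1$ and let $M$ be a compact connected $U^*(2m)$-manifold of real dimension $4m$, regarded as a complex manifold of complex dimension $2m$ with complex structure $I$ and canonical bundle $K_M$, and let $\rho$ be its Ricci form. Unless $\rho$ vanishes identically, all plurigenera of $M$ vanish, i.e. $H^0(M,K_M^{N})=0$ for every integer $N\geq 1$.
   Context: The group $SU^*(2m)=SL(m,\mathbf{H})$ is the group of complex $2m\times 2m$ matrices of determinant $1$ commuting with the antilinear map $(z_1,\dots,z_m,w_1,\dots,w_m)\mapsto(\bar w_1,\dots,\bar w_m,-\bar z_1,\dots,-\bar z_m)$ of $\mathbf{C}^{2m}$. The group $U^*(2m)=SU^*(2m)\cdot U(1)=SL(m,\mathbf{H})\cdot U(1)\subset GL(2m,\mathbf{C})$ is obtained by adjoining the scalars $e^{i\theta}$; here $\mathbf{C}^{2m}\cong\mathbf{H}^m$, with $SL(m,\mathbf H)$ acting on the left and the unit complex numbers acting on the right. A $U^*(2m)$-manifold is a smooth manifold $M$ of real dimension $4m$ with a torsion-free affine connection whose holonomy lies in $U^*(2m)$; for $m=1$, where $U^*(2)=U(2)$, the convention is that it means a Kähler surface of zero scalar curvature (with its Levi-Civita connection). Since $U^*(2m)\subset GL(2m,\mathbf{C})$ and the connection is torsion-free, it preserves an integrable complex structure $I$, making $M$ a complex manifold of complex dimension $2m$. Since $SU^*(2m)\subset SL(2m,\mathbf{C})$ acts trivially on $\Lambda^{2m}T^{1,0}$, the connection induces a $U(1)$-connection on the anticanonical bundle $K_M^*=\Lambda^{2m}T^{1,0}$, preserving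 a Hermitian metric $h$ and compatible with the holomorphic structure. The Ricci form $\rho$ is its (real) curvature form, given locally by $\rho=-i\partial\bar\partial\log h(s,s)$ for a local non-vanishing holomorphic section $s$ of $K_M^*$. *)

theory Defs
  imports "HOL-Analysis.Analysis"
begin

section \<open>Smooth and holomorphic functions\<close>

primrec Ck_on :: "nat \<Rightarrow> 'a::real_normed_vector set \<Rightarrow> ('a \<Rightarrow> 'b::real_normed_vector) \<Rightarrow> bool" where
  "Ck_on 0 S f \<longleftrightarrow> continuous_on S f"
| "Ck_on (Suc k) S f \<longleftrightarrow>
     (\<forall>x\<in>S. f differentiable at x) \<and> (\<forall>v. Ck_on k S (\<lambda>x. frechet_derivative f (at x) v))"

text \<open>Only used on open sets.\<close>

definition smooth_on :: "'a::real_normed_vector set \<Rightarrow> ('a \<Rightarrow> 'b::real_normed_vector) \<Rightarrow> bool" where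
  "smooth_on S f \<longleftrightarrow> (\<forall>k. Ck_on k S f)"

text \<open>Holomorphic functions of several complex variables: real differentiable with complex linear
  differential.  The type \<open>complex ^ 'n\<close> is only a real vector space for the
  library, so multiplication by \<open>\<i>\<close> is written \<open>\<i> *s v\<close>.\<close>

definition holomorphic_fun :: "(complex ^ 'n::finite) set \<Rightarrow> (complex ^ 'n \<Rightarrow> complex) \<Rightarrow> bool" where
  "holomorphic_fun S f \<longleftrightarrow>
     (\<forall>x\<in>S. \<exists>f'. (f has_derivative f') (at x) \<and> (\<forall>v. f' (\<i> *s v) = \<i> * f' v))"

definition holomorphic_map ::
    "(complex ^ 'n::finite) set \<Rightarrow> (complex ^ 'n \<Rightarrow> complex ^ 'k::finite) \<Rightarrow> bool" where
  "holomorphic_map S f \<longleftrightarrow> (\<forall>k. holomorphic_fun S (\<lambda>x. f x $ k))"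

section \<open>Complex manifolds\<close>

text \<open>The manifold is the whole type \<open>'p\<close>; a chart is an open domain together with a map that
  matters on this domain only.\<close>

type_synonym ('p, 'n) chart = "'p set \<times> ('p \<Rightarrow> complex ^ 'n)"

abbreviation chart_dom :: "('p, 'n::finite) chart \<Rightarrow> 'p set" where
  "chart_dom c \<equiv> fst c"

abbreviation chart_img :: "('p, 'n::finite) chart \<Rightarrow> (complex ^ 'n) set" where
  "chart_img c \<equiv> snd c ` fst c"

definition overlap :: "('p, 'n::finite) chart \<Rightarrow> ('p, 'n) chart \<Rightarrow> (complex ^ 'n) set" where
  "overlap c d = snd c ` (fst c \<inter> fst d)"

definition transition :: "('p, 'n::finite) chart \<Rightarrow> ('p, 'n) chart \<Rightarrow> complex ^ 'n \<Rightarrow> complex ^ 'n" where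
  "transition c d = snd d \<circ> inv_into (fst c) (snd c)"

definition dtrans ::
    "('p, 'n::finite) chart \<Rightarrow> ('p, 'n) chart \<Rightarrow> complex ^ 'n \<Rightarrow> complex ^ 'n \<Rightarrow> complex ^ 'n" where
  "dtrans c d x = frechet_derivative (transition c d) (at x)"

definition d2trans ::
    "('p, 'n::finite) chart \<Rightarrow> ('p, 'n) chart \<Rightarrow> complex ^ 'n \<Rightarrow> complex ^ 'n \<Rightarrow> complex ^ 'n
       \<Rightarrow> complex ^ 'n" where
  "d2trans c d x u v = frechet_derivative (\<lambda>y. dtrans c d y v) (at x) u"

definition complex_atlas :: "('p::t2_space, 'n::finite) chart set \<Rightarrow> bool" where
  "complex_atlas A \<longleftrightarrow>
     (\<Union>c\<in>A. chart_dom c) = UNIV \<and>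
     (\<forall>c\<in>A. open (chart_dom c) \<and> open (chart_img c) \<and>
        homeomorphism (chart_dom c) (chart_img c) (snd c) (inv_into (fst c) (snd c))) \<and>
     (\<forall>c\<in>A. \<forall>d\<in>A. holomorphic_map (overlap c d) (transition c d))"

section \<open>Affine connections on the real tangent bundle\<close>

text \<open>In a chart, \<open>T\<^sub>pM\<close> is the real vector space underlying \<open>complex ^ 'n\<close>, the complex structure
  \<open>I\<close> is multiplication by \<open>\<i>\<close>, and the connection is
  \<open>\<nabla>\<^sub>u V = D V(u) + \<Gamma>(u, V)\<close> with Christoffel symbols \<open>\<Gamma> c x u v\<close> that are only real bilinear
  in \<open>u\<close> and \<open>v\<close>.\<close>

type_synonym ('p, 'n) christoffel =
  "('p, 'n) chart \<Rightarrow> complex ^ 'n \<Rightarrow> complex ^ 'n \<Rightarrow> complex ^ 'n \<Rightarrow> complex ^ 'n"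

definition affine_connection :: "('p, 'n::finite) chart set \<Rightarrow> ('p, 'n) christoffel \<Rightarrow> bool" where
  "affine_connection A \<Gamma> \<longleftrightarrow>
     (\<forall>c\<in>A. (\<forall>x\<in>chart_img c. bilinear (\<Gamma> c x)) \<and>
            (\<forall>u v. smooth_on (chart_img c) (\<lambda>x. \<Gamma> c x u v))) \<and>
     (\<forall>c\<in>A. \<forall>d\<in>A. \<forall>x\<in>overlap c d. \<forall>u v.
        \<Gamma> d (transition c d x) (dtrans c d x u) (dtrans c d x v)
          = dtrans c d x (\<Gamma> c x u v) - d2trans c d x u v)"

definition torsion_free :: "('p, 'n::finite) chart set \<Rightarrow> ('p, 'n) christoffel \<Rightarrow> bool" where
  "torsion_free A \<Gamma> \<longleftrightarrow> (\<forall>c\<in>A. \<forall>x\<in>chart_img c. \<forall>u v. \<Gamma> c x u v = \<Gamma> c x v u)"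

text \<open>The condition \<open>\<nabla>I = 0\<close>.\<close>

definition parallel_complex_structure ::
    "('p, 'n::finite) chart set \<Rightarrow> ('p, 'n) christoffel \<Rightarrow> bool" where
  "parallel_complex_structure A \<Gamma> \<longleftrightarrow>
     (\<forall>c\<in>A. \<forall>x\<in>chart_img c. \<forall>u v. \<Gamma> c x u (\<i> *s v) = \<i> *s \<Gamma> c x u v)"

definition curvature :: "('p, 'n::finite) christoffel \<Rightarrow> ('p, 'n) chart \<Rightarrow> complex ^ 'n
    \<Rightarrow> complex ^ 'n \<Rightarrow> complex ^ 'n \<Rightarrow> complex ^ 'n \<Rightarrow> complex ^ 'n" where
  "curvature \<Gamma> c x u v w =
     frechet_derivative (\<lambda>y. \<Gamma> c y v w) (at x) u - frechet_derivative (\<lambda>y. \<Gamma> c y u w) (at x) v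
     + \<Gamma> c x u (\<Gamma> c x v w) - \<Gamma> c x v (\<Gamma> c x u w)"

section \<open>Holonomy\<close>

text \<open>A curve \<open>\<gamma>\<close> on \<open>[a,b]\<close> is smooth if in every chart it has (one-sided at the end points)
  derivatives \<open>D k\<close> of all orders \<open>k\<close>.\<close>

definition smooth_curve :: "('p, 'n::finite) chart set \<Rightarrow> real \<Rightarrow> real \<Rightarrow> (real \<Rightarrow> 'p) \<Rightarrow> bool" where
  "smooth_curve A a b \<gamma> \<longleftrightarrow>
     (\<forall>c\<in>A. \<exists>D :: nat \<Rightarrow> real \<Rightarrow> complex ^ 'n. D 0 = snd c \<circ> \<gamma> \<and>
        (\<forall>k. \<forall>t\<in>{a..b}. \<gamma> t \<in> chart_dom c \<longrightarrow>
           (D k has_vector_derivative D (Suc k) t) (at t within {a..b})))"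

definition consecutive :: "real set \<Rightarrow> real \<Rightarrow> real \<Rightarrow> bool" where
  "consecutive P a b \<longleftrightarrow> a \<in> P \<and> b \<in> P \<and> a < b \<and> P \<inter> {a<..<b} = {}"

definition piecewise_smooth_curve ::
    "('p::topological_space, 'n::finite) chart set \<Rightarrow> real set \<Rightarrow> (real \<Rightarrow> 'p) \<Rightarrow> bool" where
  "piecewise_smooth_curve A P \<gamma> \<longleftrightarrow>
     continuous_on {0..1} \<gamma> \<and> finite P \<and> {0, 1} \<subseteq> P \<and> P \<subseteq> {0..1} \<and>
     (\<forall>a b. consecutive P a b \<longrightarrow> smooth_curve A a b \<gamma>)"

text \<open>Parallel vector fields along \<open>\<gamma>\<close>; \<open>V c t\<close> is the coordinate expression in the chart \<open>c\<close> of
  a tangent vector at \<open>\<gamma> t\<close>.\<close>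

definition parallel_along :: "('p, 'n::finite) chart set \<Rightarrow> ('p, 'n) christoffel \<Rightarrow> real set
    \<Rightarrow> (real \<Rightarrow> 'p) \<Rightarrow> (('p, 'n) chart \<Rightarrow> real \<Rightarrow> complex ^ 'n) \<Rightarrow> bool" where
  "parallel_along A \<Gamma> P \<gamma> V \<longleftrightarrow>
     (\<forall>c\<in>A. \<forall>d\<in>A. \<forall>t\<in>{0..1}. \<gamma> t \<in> chart_dom c \<inter> chart_dom d \<longrightarrow>
        V d t = dtrans c d (snd c (\<gamma> t)) (V c t)) \<and>
     (\<forall>a b. consecutive P a b \<longrightarrow> (\<forall>c\<in>A. \<forall>t\<in>{a..b}. \<gamma> t \<in> chart_dom c \<longrightarrow>
        (V c has_vector_derivative
           - \<Gamma> c (snd c (\<gamma> t)) (vector_derivative (snd c \<circ> \<gamma>) (at t within {a..b})) (V c t))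
          (at t within {a..b})))"

text \<open>The holonomy group at \<open>p\<close>, with \<open>T\<^sub>pM\<close> identified with \<open>complex ^ 'n\<close> by the chart \<open>c\<close>.\<close>

definition holonomy_group :: "('p::topological_space, 'n::finite) chart set \<Rightarrow> ('p, 'n) christoffel
    \<Rightarrow> ('p, 'n) chart \<Rightarrow> 'p \<Rightarrow> (complex ^ 'n \<Rightarrow> complex ^ 'n) set" where
  "holonomy_group A \<Gamma> c p = {L. linear L \<and>
     (\<exists>P \<gamma>. piecewise_smooth_curve A P \<gamma> \<and> \<gamma> 0 = p \<and> \<gamma> 1 = p \<and>
        (\<forall>u. \<exists>V. parallel_along A \<Gamma> P \<gamma> V \<and> V c 0 = u \<and> V c 1 = L u))}"

section \<open>The group \<open>U\<^sup>*(2m)\<close>\<close>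

text \<open>The index type \<open>'m + 'm\<close> carries the coordinates \<open>z\<^sub>j\<close> (index \<open>Inl j\<close>) and
  \<open>w\<^sub>j\<close> (index \<open>Inr j\<close>), where \<open>m = CARD('m)\<close>.\<close>

definition quat_map :: "complex ^ ('m::finite + 'm) \<Rightarrow> complex ^ ('m + 'm)" where
  "quat_map v = (\<chi> k. case k of Inl j \<Rightarrow> cnj (v $ Inr j) | Inr j \<Rightarrow> - cnj (v $ Inl j))"

definition SU_star :: "(complex ^ ('m::finite + 'm) ^ ('m + 'm)) set" where
  "SU_star = {B. det B = 1 \<and> (\<forall>v. B *v quat_map v = quat_map (B *v v))}"

definition U_star :: "(complex ^ ('m::finite + 'm) ^ ('m + 'm)) set" where
  "U_star = {mat (cis \<theta>) ** B |\<theta> B. B \<in> SU_star}"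

text \<open>The frame \<open>F\<close> of \<open>T\<^sub>pM\<close> is complex linear because the complex structure of the manifold
  is the one that corresponds to multiplication by \<open>\<i>\<close> in frames adapted to \<open>U_star\<close>.  By
  connectedness, the choice of the base point does not matter when \<open>\<nabla>I = 0\<close>.\<close>

definition holonomy_in_U_star ::
    "('p::topological_space, 'm::finite + 'm) chart set \<Rightarrow> ('p, 'm + 'm) christoffel \<Rightarrow> bool" where
  "holonomy_in_U_star A \<Gamma> \<longleftrightarrow>
     (\<exists>p. \<exists>c\<in>A. p \<in> chart_dom c \<and>
        (\<exists>F :: complex ^ ('m + 'm) ^ ('m + 'm). invertible F \<and>
           (\<forall>L\<in>holonomy_group A \<Gamma> c p. \<exists>B\<in>U_star. \<forall>u. F *v L u = B *v (F *v u))))"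

section \<open>Kaehler metrics and scalar curvature\<close>

type_synonym ('p, 'n) metric = "('p, 'n) chart \<Rightarrow> complex ^ 'n \<Rightarrow> complex ^ 'n \<Rightarrow> complex ^ 'n \<Rightarrow> real"

definition hermitian_metric :: "('p, 'n::finite) chart set \<Rightarrow> ('p, 'n) metric \<Rightarrow> bool" where
  "hermitian_metric A g \<longleftrightarrow>
     (\<forall>c\<in>A. \<forall>x\<in>chart_img c. bilinear (g c x) \<and> (\<forall>u v. g c x u v = g c x v u) \<and>
        (\<forall>u. u \<noteq> 0 \<longrightarrow> 0 < g c x u u) \<and> (\<forall>u v. g c x (\<i> *s u) (\<i> *s v) = g c x u v)) \<and>
     (\<forall>c\<in>A. \<forall>u v. smooth_on (chart_img c) (\<lambda>x. g c x u v)) \<and>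
     (\<forall>c\<in>A. \<forall>d\<in>A. \<forall>x\<in>overlap c d. \<forall>u v.
        g d (transition c d x) (dtrans c d x u) (dtrans c d x v) = g c x u v)"

definition kaehler_form :: "('p, 'n::finite) metric \<Rightarrow> ('p, 'n) chart \<Rightarrow> complex ^ 'n
    \<Rightarrow> complex ^ 'n \<Rightarrow> complex ^ 'n \<Rightarrow> real" where
  "kaehler_form g c x u v = g c x (\<i> *s u) v"

definition kaehler_metric :: "('p, 'n::finite) chart set \<Rightarrow> ('p, 'n) metric \<Rightarrow> bool" where
  "kaehler_metric A g \<longleftrightarrow> hermitian_metric A g \<and>
     (\<forall>c\<in>A. \<forall>x\<in>chart_img c. \<forall>u v w.
        frechet_derivative (\<lambda>y. kaehler_form g c y v w) (at x) u
        + frechet_derivative (\<lambda>y. kaehler_form g c y w u) (at x) v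
        + frechet_derivative (\<lambda>y. kaehler_form g c y u v) (at x) w = 0)"

definition levi_civita ::
    "('p, 'n::finite) chart set \<Rightarrow> ('p, 'n) christoffel \<Rightarrow> ('p, 'n) metric \<Rightarrow> bool" where
  "levi_civita A \<Gamma> g \<longleftrightarrow> torsion_free A \<Gamma> \<and>
     (\<forall>c\<in>A. \<forall>x\<in>chart_img c. \<forall>u v w.
        frechet_derivative (\<lambda>y. g c y v w) (at x) u = g c x (\<Gamma> c x u v) w + g c x v (\<Gamma> c x u w))"

text \<open>\<open>Ric(v,w)\<close> is the real trace of \<open>u \<mapsto> R(u,v)w\<close>.\<close>

definition ricci_tensor :: "('p, 'n::finite) christoffel \<Rightarrow> ('p, 'n) chart \<Rightarrow> complex ^ 'n
    \<Rightarrow> complex ^ 'n \<Rightarrow> complex ^ 'n \<Rightarrow> real" where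
  "ricci_tensor \<Gamma> c x v w = (\<Sum>b\<in>Basis. curvature \<Gamma> c x b v w \<bullet> b)"

definition orthonormal_basis_for ::
    "(complex ^ 'n::finite \<Rightarrow> complex ^ 'n \<Rightarrow> real) \<Rightarrow> (complex ^ 'n) set \<Rightarrow> bool" where
  "orthonormal_basis_for q B \<longleftrightarrow>
     span B = UNIV \<and> (\<forall>u\<in>B. \<forall>v\<in>B. q u v = (if u = v then 1 else 0))"

definition scalar_curvature :: "('p, 'n::finite) christoffel \<Rightarrow> ('p, 'n) metric \<Rightarrow> ('p, 'n) chart
    \<Rightarrow> complex ^ 'n \<Rightarrow> real" where
  "scalar_curvature \<Gamma> g c x =
     (\<Sum>e\<in>(SOME B. orthonormal_basis_for (g c x) B). ricci_tensor \<Gamma> c x e e)"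

definition scalar_flat_kaehler ::
    "('p, 'n::finite) chart set \<Rightarrow> ('p, 'n) christoffel \<Rightarrow> bool" where
  "scalar_flat_kaehler A \<Gamma> \<longleftrightarrow>
     (\<exists>g. kaehler_metric A g \<and> levi_civita A \<Gamma> g \<and>
          (\<forall>c\<in>A. \<forall>x\<in>chart_img c. scalar_curvature \<Gamma> g c x = 0))"

section \<open>\<open>U\<^sup>*(2m)\<close>-manifolds\<close>

definition U_star_manifold ::
    "('p::t2_space, 'm::finite + 'm) chart set \<Rightarrow> ('p, 'm + 'm) christoffel \<Rightarrow> bool" where
  "U_star_manifold A \<Gamma> \<longleftrightarrow> complex_atlas A \<and> affine_connection A \<Gamma> \<and>
     (if CARD('m) = 1 then scalar_flat_kaehler A \<Gamma>
      else torsion_free A \<Gamma> \<and> parallel_complex_structure A \<Gamma> \<and> holonomy_in_U_star A \<Gamma>)"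

section \<open>Ricci form and pluricanonical sections\<close>

text \<open>On \<open>\<Lambda>\<^sup>nT\<^sup>1\<^sup>,\<^sup>0\<close> the induced connection satisfies \<open>\<nabla>s = \<theta> \<otimes> s\<close> for the coordinate section
  \<open>s = \<partial>\<^sub>1 \<and> \<dots> \<and> \<partial>\<^sub>n\<close>, where \<open>\<theta>(u)\<close> is the complex trace of the complex linear map
  \<open>v \<mapsto> \<Gamma>(u, v)\<close>.  Its curvature is \<open>d\<theta>\<close>, which takes imaginary values since the holonomy on this
  line bundle is in \<open>U(1)\<close>.  For a parallel Hermitian metric \<open>h\<close> and a holomorphic section \<open>s\<close>
  one has \<open>\<theta> = \<partial> log h(s,s)\<close>, so that \<open>\<i> d\<theta> = - \<i> \<partial> dbar log h(s,s)\<close>, where dbar is the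
  Cauchy-Riemann operator.\<close>

definition anticanonical_connection :: "('p, 'n::finite) christoffel \<Rightarrow> ('p, 'n) chart
    \<Rightarrow> complex ^ 'n \<Rightarrow> complex ^ 'n \<Rightarrow> complex" where
  "anticanonical_connection \<Gamma> c x u = trace (matrix (\<Gamma> c x u))"

definition anticanonical_curvature :: "('p, 'n::finite) christoffel \<Rightarrow> ('p, 'n) chart
    \<Rightarrow> complex ^ 'n \<Rightarrow> complex ^ 'n \<Rightarrow> complex ^ 'n \<Rightarrow> complex" where
  "anticanonical_curvature \<Gamma> c x u v =
     frechet_derivative (\<lambda>y. anticanonical_connection \<Gamma> c y v) (at x) u
     - frechet_derivative (\<lambda>y. anticanonical_connection \<Gamma> c y u) (at x) v"

definition ricci_form :: "('p, 'n::finite) christoffel \<Rightarrow> ('p, 'n) chart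
    \<Rightarrow> complex ^ 'n \<Rightarrow> complex ^ 'n \<Rightarrow> complex ^ 'n \<Rightarrow> real" where
  "ricci_form \<Gamma> c x u v = Re (\<i> * anticanonical_curvature \<Gamma> c x u v)"

text \<open>\<open>H\<^sup>0(M, K\<^sup>N)\<close>: in the chart \<open>c\<close> a section is \<open>s c x (dx\<^sub>1 \<and> \<dots> \<and> dx\<^sub>n)\<^sup>N\<close>.  The
  coefficient is set to \<open>0\<close> where it has no meaning, so that the zero section is
  \<open>\<lambda>c x. 0\<close>.\<close>

definition pluricanonical_sections ::
    "('p, 'n::finite) chart set \<Rightarrow> nat \<Rightarrow> (('p, 'n) chart \<Rightarrow> complex ^ 'n \<Rightarrow> complex) set" where
  "pluricanonical_sections A N = {s.
     (\<forall>c\<in>A. holomorphic_fun (chart_img c) (s c)) \<and>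
     (\<forall>c\<in>A. \<forall>d\<in>A. \<forall>x\<in>overlap c d.
        s c x = det (matrix (dtrans c d x)) ^ N * s d (transition c d x)) \<and>
     (\<forall>c x. c \<notin> A \<or> x \<notin> chart_img c \<longrightarrow> s c x = 0)}"

end

theory Submission
  imports Defs "HOL-Complex_Analysis.Complex_Analysis"
begin

text \<open>The theorem is a Bochner argument without a metric on the manifold.  Let \<open>n = 2m\<close>, let \<open>h\<close> be the
  parallel Hermitian metric on the anticanonical bundle, and let \<open>s\<close> be a holomorphic section of
  \<open>K\<^sup>N\<close>.  Where \<open>s\<close> does not vanish, the function \<open>\<psi> = ln \<bar>s\<bar>\<^sup>2\<close> satisfies
  \<open>D\<^sup>2\<psi>(u,u) + D\<^sup>2\<psi>(\<i>u,\<i>u) = 2N \<rho>(u,\<i>u)\<close> in holomorphic coordinates, since \<open>ln \<bar>f\<bar>\<close> is harmonic on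
  complex lines for holomorphic \<open>f\<close> and \<open>\<rho>\<close> is the curvature of \<open>h\<close>.  If every tangent space has a
  frame \<open>e\<^sub>1,\<dots>,e\<^sub>n\<close> with \<open>\<Sum>\<^sub>k \<rho>(e\<^sub>k,\<i>e\<^sub>k) = 0\<close>, then \<open>\<psi>\<close> is annihilated by an elliptic operator of
  second order, which has no term of order zero.  The strong maximum principle at a maximum of the
  norm makes the norm constant, first near the maximum and then on the compact connected manifold.
  Hence the section vanishes everywhere or nowhere, and in the second case \<open>\<rho>(u,\<i>u) = 0\<close> for all \<open>u\<close>,
  so that \<open>\<rho> = 0\<close> because \<open>\<rho>\<close> is of type \<open>(1,1)\<close>.  This part is
  \<open>ricci_flat_if_pluricanonical_section\<close>, which rests on \<open>strong_maximum_principle\<close>.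

  It remains to find the frames.  For \<open>m = 1\<close> a unitary frame will do, as the sum is half of the scalar
  curvature (\<open>scalar_curvature_ricci_form\<close>).  For \<open>m > 1\<close> the holonomy preserves a quaternionic structure
  \<open>J\<close> up to a phase.  The curvature then satisfies \<open>[R(u,v), J] = 2\<i> a(u,v) J\<close>, where \<open>n a\<close> is the
  imaginary part of the complex trace of \<open>R\<close>, that is \<open>-\<rho>\<close>.  Taking real traces in the
  Bianchi identity composed with \<open>I\<close>, \<open>J\<close> and \<open>I J\<close> gives linear relations between \<open>a\<close> and the
  Ricci tensor, and they force \<open>a(u,\<i>u) + a(Ju,\<i>Ju) = 0\<close> for \<open>n > 2\<close>
  (\<open>trace_form_J_anti_invariant\<close>).  A frame that consists of pairs \<open>u, Ju\<close> has the required property.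

  Both cases are treated with the same notion: a family of frames that is preserved by parallel
  transport and in which the modulus of the determinant depends on the point only (locale
  \<open>frame_bundle\<close>).  That modulus is the metric \<open>h\<close>.  For \<open>m > 1\<close> the family is
  generated by parallel transport along polygonal paths, and the hypothesis on the holonomy group
  compares two frames at the same point (\<open>quaternionic_frame_bundle_exists\<close>).  The
  frames and \<open>J\<close> are chosen at each point separately.  Quantities that do not depend on these choices, such as
  \<open>h\<close> and \<open>J\<close> divided by one of its matrix entries, are differentiable because their
  derivatives along segments are known (\<open>has_derivative_from_right_derivatives\<close>).\<close>

section \<open>Holomorphic functions of several variables\<close>

lemma norm_vector_scalar_mult [simp]:
  fixes v :: "complex ^ 'n"
  shows "norm (\<zeta> *s v) = cmod \<zeta> * norm v"
proof -
  have "(\<Sum>i\<in>UNIV. (cmod \<zeta> * norm (v $ i))\<^sup>2) = (cmod \<zeta>)\<^sup>2 * (\<Sum>i\<in>UNIV. (norm (v $ i))\<^sup>2)"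
    by (simp add: power_mult_distrib sum_distrib_left)
  then show ?thesis
    unfolding norm_vec_def L2_set_def by (simp add: norm_mult real_sqrt_mult)
qed

lemma scaleR_conv_vector_scalar_mult:
  fixes v :: "complex ^ 'n"
  shows "r *\<^sub>R v = of_real r *s v"
  by (simp add: vec_eq_iff scaleR_conv_of_real[where 'a = complex])

lemma linear_vector_scalar_mult: "linear (\<lambda>\<zeta>. \<zeta> *s (v :: complex ^ 'n))"
  by (rule linearI) (simp_all add: vec_eq_iff algebra_simps)

lemma linear_vector_scalar_mult_right: "linear (\<lambda>v :: complex ^ 'n. \<zeta> *s v)"
  by (rule linearI) (simp_all add: vec_eq_iff algebra_simps)

lemma bounded_linear_complex_line: "bounded_linear (\<lambda>\<zeta>. \<zeta> *s (v :: complex ^ 'n))"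
  using linear_vector_scalar_mult by (simp add: linear_conv_bounded_linear)

lemma bounded_linear_vector_scalar_mult: "bounded_linear (\<lambda>v :: complex ^ 'n. \<zeta> *s v)"
  using linear_vector_scalar_mult_right by (simp add: linear_conv_bounded_linear)

lemma complex_linear_scalar:
  fixes f :: "complex ^ 'n \<Rightarrow> complex ^ 'k"
  assumes "linear f" "\<And>v. f (\<i> *s v) = \<i> *s f v"
  shows "f (\<zeta> *s v) = \<zeta> *s f v"
proof -
  have z: "\<zeta> *s v = Re \<zeta> *\<^sub>R v + Im \<zeta> *\<^sub>R (\<i> *s v)"
    by (simp add: vec_eq_iff complex_eq_iff)
  have "f (\<zeta> *s v) = Re \<zeta> *\<^sub>R f v + Im \<zeta> *\<^sub>R (\<i> *s f v)"
    unfolding z using assms by (simp add: linear_add linear_scale)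
  also have "\<dots> = \<zeta> *s f v"
    by (simp add: vec_eq_iff complex_eq_iff)
  finally show ?thesis .
qed

lemma complex_linear_functional_scalar:
  fixes f :: "complex ^ 'n \<Rightarrow> complex"
  assumes "linear f" "\<And>v. f (\<i> *s v) = \<i> * f v"
  shows "f (\<zeta> *s v) = \<zeta> * f v"
proof -
  have z: "\<zeta> *s v = Re \<zeta> *\<^sub>R v + Im \<zeta> *\<^sub>R (\<i> *s v)"
    by (simp add: vec_eq_iff complex_eq_iff)
  have "f (\<zeta> *s v) = Re \<zeta> *\<^sub>R f v + Im \<zeta> *\<^sub>R (\<i> * f v)"
    unfolding z using assms by (simp add: linear_add linear_scale)
  also have "\<dots> = \<zeta> * f v"
    by (simp add: complex_eq_iff)
  finally show ?thesis .
qed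

lemma holomorphic_fun_has_derivative:
  assumes "holomorphic_fun S f" "x \<in> S"
  shows "(f has_derivative frechet_derivative f (at x)) (at x)"
    and "frechet_derivative f (at x) (\<zeta> *s v) = \<zeta> * frechet_derivative f (at x) v"
proof -
  obtain f' where f': "(f has_derivative f') (at x)" "\<And>v. f' (\<i> *s v) = \<i> * f' v"
    using assms unfolding holomorphic_fun_def by blast
  have eq: "frechet_derivative f (at x) = f'"
    using f'(1) frechet_derivative_at by metis
  show "(f has_derivative frechet_derivative f (at x)) (at x)"
    using f' eq by simp
  show "frechet_derivative f (at x) (\<zeta> *s v) = \<zeta> * frechet_derivative f (at x) v"
    unfolding eq by (rule complex_linear_functional_scalar[OF has_derivative_linear[OF f'(1)] f'(2)])
qed

lemma holomorphic_funI:
  assumes "\<And>x. x \<in> S \<Longrightarrow> (f has_derivative f' x) (at x)"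
    and "\<And>x v. x \<in> S \<Longrightarrow> f' x (\<i> *s v) = \<i> * f' x v"
  shows "holomorphic_fun S f"
  using assms unfolding holomorphic_fun_def by blast

lemma holomorphic_fun_continuous_on:
  assumes "holomorphic_fun S f" shows "continuous_on S f"
  by (meson assms continuous_at_imp_continuous_on has_derivative_continuous
      holomorphic_fun_has_derivative(1))

lemma has_derivative_complex_line:
  "((\<lambda>\<zeta>. x + \<zeta> *s v) has_derivative (\<lambda>\<zeta>. \<zeta> *s (v :: complex ^ 'n))) (at \<zeta>)"
  using has_derivative_add[OF has_derivative_const[of x]
      bounded_linear_imp_has_derivative[OF bounded_linear_complex_line]] by simp

lemma holomorphic_fun_line_deriv:
  assumes "holomorphic_fun S f" "x + \<zeta> *s v \<in> S"
  shows "((\<lambda>\<zeta>. f (x + \<zeta> *s v)) has_field_derivative frechet_derivative f (at (x + \<zeta> *s v)) v) (at \<zeta>)"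
proof -
  have "((\<lambda>\<zeta>. f (x + \<zeta> *s v)) has_derivative (\<lambda>h. frechet_derivative f (at (x + \<zeta> *s v)) (h *s v))) (at \<zeta>)"
    using has_derivative_compose[OF has_derivative_complex_line holomorphic_fun_has_derivative(1)[OF assms]] .
  moreover have "(\<lambda>h. frechet_derivative f (at (x + \<zeta> *s v)) (h *s v)) = (*) (frechet_derivative f (at (x + \<zeta> *s v)) v)"
    using holomorphic_fun_has_derivative(2)[OF assms] by (auto simp: mult.commute)
  ultimately show ?thesis unfolding has_field_derivative_def by simp
qed

lemma open_complex_line_vimage:
  assumes "open (S :: (complex ^ 'n) set)"
  shows "open {\<zeta>. x + \<zeta> *s v \<in> S}"
proof -
  have "continuous_on UNIV (\<lambda>\<zeta>. x + \<zeta> *s v)"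
    by (intro continuous_intros linear_continuous_on bounded_linear_complex_line)
  then show ?thesis
    using open_vimage[OF assms] by (simp add: vimage_def)
qed

lemma holomorphic_fun_line:
  assumes "holomorphic_fun S f" 
  shows "(\<lambda>\<zeta>. f (x + \<zeta> *s v)) holomorphic_on {\<zeta>. x + \<zeta> *s v \<in> S}"
  unfolding holomorphic_on_def field_differentiable_def
  using holomorphic_fun_line_deriv[OF assms] has_field_derivative_at_within by blast

text \<open>Cauchy's estimate on the complex lines through a point bounds the whole differential.\<close>

lemma holomorphic_fun_Cauchy_estimate:
  assumes f: "holomorphic_fun S f" and S: "cball x r \<subseteq> S" and r: "r > 0"
    and B: "\<And>y. y \<in> cball x r \<Longrightarrow> cmod (f y) \<le> B"
  shows "cmod (frechet_derivative f (at x) v) \<le> B / r * norm v"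
proof (cases "v = 0")
  case True
  have "linear (frechet_derivative f (at x))"
    using holomorphic_fun_has_derivative(1)[OF f, of x] S r has_derivative_linear
    by (simp add: subset_iff)
  with True show ?thesis by (simp add: linear_0)
next
  case False
  define \<rho> where "\<rho> = r / norm v"
  have \<rho>: "\<rho> > 0" using r False by (simp add: \<rho>_def)
  define F where "F = (\<lambda>\<zeta>. f (x + \<zeta> *s v))"
  have mem: "x + \<zeta> *s v \<in> cball x r" if "cmod \<zeta> \<le> \<rho>" for \<zeta>
    using that False by (simp add: \<rho>_def dist_norm field_simps)
  have hol: "F holomorphic_on {\<zeta>. x + \<zeta> *s v \<in> S}"
    unfolding F_def by (rule holomorphic_fun_line[OF f])
  have sub: "cball 0 \<rho> \<subseteq> {\<zeta>. x + \<zeta> *s v \<in> S}"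
    using mem S by auto
  have "cmod ((deriv ^^ 1) F 0) \<le> fact 1 * B / \<rho> ^ 1"
  proof (rule Cauchy_inequality)
    show "F holomorphic_on ball 0 \<rho>"
      using hol sub by (meson ball_subset_cball holomorphic_on_subset subset_trans)
    show "continuous_on (cball 0 \<rho>) F"
      using hol sub by (meson holomorphic_on_imp_continuous_on holomorphic_on_subset)
    show "cmod (F \<zeta>) \<le> B" if "cmod (0 - \<zeta>) = \<rho>" for \<zeta>
      unfolding F_def using that by (intro B mem) simp
  qed (use \<rho> in auto)
  moreover have "deriv F 0 = frechet_derivative f (at x) v"
    using holomorphic_fun_line_deriv[OF f, of x 0 v] S r unfolding F_def
    by (intro DERIV_imp_deriv) (simp add: subset_iff)
  ultimately show ?thesis using False by (simp add: \<rho>_def)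
qed

text \<open>The directional derivative is a locally uniform limit of difference quotients; by Cauchy's
  estimate their differentials converge uniformly as well.  The transition functions of a complex
  atlas are differentiable by definition; this lemma provides their second derivatives.\<close>

lemma holomorphic_fun_directional_derivative:
  fixes f :: "complex ^ 'n::finite \<Rightarrow> complex"
  assumes f: "holomorphic_fun S f" and S: "open S"
  shows "holomorphic_fun S (\<lambda>y. frechet_derivative f (at y) v)"
  unfolding holomorphic_fun_def
proof
  fix x0 assume x0: "x0 \<in> S"
  obtain R0 where R0: "R0 > 0" "cball x0 R0 \<subseteq> S"
    using S x0 open_contains_cball by blast
  have "continuous_on (cball x0 R0) f"
    using holomorphic_fun_continuous_on[OF f] R0 continuous_on_subset by blast
  then have "bounded (f ` cball x0 R0)"
    using compact_continuous_image compact_cball compact_imp_bounded by blast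
  then obtain B where B: "B > 0" "\<And>y. y \<in> cball x0 R0 \<Longrightarrow> cmod (f y) \<le> B"
    unfolding bounded_pos by blast
  \<comment> \<open>\<open>f\<close> is used on the ball of radius \<open>4 R\<close>, the difference quotients on that of radius \<open>2 R\<close>, and
    their differentials on that of radius \<open>R\<close>\<close>
  define R where "R = R0 / 4"
  have R: "R > 0" using R0 by (simp add: R_def)
  define \<rho> where "\<rho> = R / (norm v + 1)"
  have \<rho>: "\<rho> > 0" using R by (simp add: \<rho>_def add_nonneg_pos)
  have \<rho>v: "\<rho> * norm v \<le> R"
  proof -
    have "norm v / (norm v + 1) \<le> 1" by (simp add: divide_le_eq_1 add_nonneg_pos)
    then have "R * (norm v / (norm v + 1)) \<le> R * 1" using R by (intro mult_left_mono) auto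
    then show ?thesis by (simp add: \<rho>_def)
  qed
  have mem: "y + \<zeta> *s v \<in> cball x0 R0" if "y \<in> cball x0 (2*R)" "cmod \<zeta> \<le> 2 * \<rho>" for y \<zeta>
  proof -
    have "dist x0 (y + \<zeta> *s v) \<le> dist x0 y + cmod \<zeta> * norm v"
      using norm_triangle_ineq[of "x0 - y" "- (\<zeta> *s v)"] by (simp add: dist_norm algebra_simps)
    also have "\<dots> \<le> 2 * R + 2 * \<rho> * norm v"
      using that by (intro add_mono mult_right_mono) auto
    also have "\<dots> \<le> R0" using \<rho>v by (simp add: R_def)
    finally show ?thesis by simp
  qed
  define C where "C = 2 * B / \<rho>^2"
  define t where "t = (\<lambda>n. \<rho> / real (Suc n))"
  have t: "0 < t n" "t n \<le> \<rho>" for n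
    using \<rho> by (auto simp: t_def field_simps)
  have t0: "t \<longlonglongrightarrow> 0"
    unfolding t_def using LIMSEQ_Suc[OF lim_const_over_n[of \<rho>]] by simp
  define f1 where "f1 = (\<lambda>n y. (f (y + of_real (t n) *s v) - f y) / of_real (t n))"
  define g where "g = (\<lambda>y. frechet_derivative f (at y) v)"
  have sub: "cball x0 (2*R) \<subseteq> S" using mem[of _ 0] R0 \<rho> by auto
  \<comment> \<open>Taylor's formula on a complex line, with Cauchy's bound for the second derivative\<close>
  have quot: "cmod (f1 n y - g y) \<le> C * t n" if y: "y \<in> cball x0 (2*R)" for n y
  proof -
    define F where "F = (\<lambda>\<zeta>. f (y + \<zeta> *s v))"
    have hol: "F holomorphic_on {\<zeta>. y + \<zeta> *s v \<in> S}"
      unfolding F_def by (rule holomorphic_fun_line[OF f])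
    have cb: "cball 0 (2*\<rho>) \<subseteq> {\<zeta>. y + \<zeta> *s v \<in> S}"
      using mem[OF y] R0 by auto
    have hol': "F holomorphic_on cball 0 (2*\<rho>)"
      using hol cb holomorphic_on_subset by blast
    have "cmod ((deriv^^0) F (of_real (t n)) - (\<Sum>i\<le>1. (deriv^^i) F 0 * (of_real (t n) - 0) ^ i / fact i))
        \<le> C * cmod (of_real (t n) - 0) ^ Suc 1 / fact 1"
    proof (rule complex_Taylor[of "cball 0 \<rho>"])
      show "((deriv^^i) F has_field_derivative (deriv^^Suc i) F \<zeta>) (at \<zeta> within cball 0 \<rho>)"
        if "\<zeta> \<in> cball 0 \<rho>" for i \<zeta>
      proof -
        have "((deriv^^i) F) holomorphic_on ball 0 (2*\<rho>)"
          by (rule holomorphic_higher_deriv[OF holomorphic_on_subset[OF hol']]) auto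
        moreover have "\<zeta> \<in> ball 0 (2*\<rho>)" using that \<rho> by simp
        ultimately show ?thesis
          by (simp add: holomorphic_derivI[of _ "ball 0 (2*\<rho>)"])
      qed
      show "cmod ((deriv^^Suc 1) F \<zeta>) \<le> C" if z: "\<zeta> \<in> cball 0 \<rho>" for \<zeta>
      proof -
        have cb': "cball \<zeta> \<rho> \<subseteq> cball 0 (2*\<rho>)"
        proof
          fix w assume "w \<in> cball \<zeta> \<rho>"
          then show "w \<in> cball 0 (2*\<rho>)"
            using z norm_triangle_ineq[of \<zeta> "w - \<zeta>"] by (simp add: dist_norm norm_minus_commute)
        qed
        have "cmod ((deriv ^^ 2) F \<zeta>) \<le> fact 2 * B / \<rho> ^ 2"
        proof (rule Cauchy_inequality)
          show "F holomorphic_on ball \<zeta> \<rho>"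
            using hol' cb' by (meson ball_subset_cball holomorphic_on_subset subset_trans)
          show "continuous_on (cball \<zeta> \<rho>) F"
            using hol' cb' by (meson holomorphic_on_imp_continuous_on holomorphic_on_subset)
          show "cmod (F w) \<le> B" if "cmod (\<zeta> - w) = \<rho>" for w
          proof -
            have "w \<in> cball 0 (2*\<rho>)" using that cb' by (auto simp: dist_norm)
            then show ?thesis unfolding F_def using y by (intro B mem) auto
          qed
        qed (use \<rho> in auto)
        then show ?thesis by (simp add: C_def numeral_2_eq_2)
      qed
    qed (use t \<rho> less_imp_le[OF t(1)] in auto)
    moreover have "deriv F 0 = g y"
      using holomorphic_fun_line_deriv[OF f, of y 0 v] y sub unfolding F_def g_def
      by (intro DERIV_imp_deriv) auto
    ultimately have "cmod (F (of_real (t n)) - (F 0 + g y * of_real (t n))) \<le> C * (t n)^2"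
      using t(1)[of n] by (simp add: power2_eq_square)
    moreover have "f1 n y - g y = (F (of_real (t n)) - (F 0 + g y * of_real (t n))) / of_real (t n)"
      using t(1)[of n] by (simp add: f1_def F_def field_simps)
    ultimately show ?thesis
      using t(1)[of n] by (simp add: norm_divide divide_le_eq power2_eq_square mult.assoc)
  qed
  have f1hol: "holomorphic_fun (cball x0 (2*R)) (f1 n)" for n
  proof (rule holomorphic_funI)
    fix y assume y: "y \<in> cball x0 (2*R)"
    let ?D = "\<lambda>h. (frechet_derivative f (at (y + of_real (t n) *s v)) h - frechet_derivative f (at y) h) / of_real (t n)"
    have m: "y + of_real (t n) *s v \<in> S"
      using mem[OF y, of "of_real (t n)"] t[of n] R0 \<rho> by auto
    have "y \<in> S" using y sub by auto
    note d1 = holomorphic_fun_has_derivative(1)[OF f m] and d2 = holomorphic_fun_has_derivative(1)[OF f \<open>y \<in> S\<close>]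
    have "((\<lambda>y. y + of_real (t n) *s v) has_derivative (\<lambda>h. h)) (at y)"
      by (auto intro!: derivative_eq_intros)
    from has_derivative_compose[OF this d1]
    have d1': "((\<lambda>y. f (y + of_real (t n) *s v)) has_derivative frechet_derivative f (at (y + of_real (t n) *s v))) (at y)" .
    show "(f1 n has_derivative ?D) (at y)"
      unfolding f1_def 
      using has_derivative_mult_right[OF has_derivative_diff[OF d1' d2], of "inverse (of_real (t n))"]
      by (simp add: divide_inverse mult.commute)
    show "?D (\<i> *s h) = \<i> * ?D h" for h
      using holomorphic_fun_has_derivative(2)[OF f m] holomorphic_fun_has_derivative(2)[OF f \<open>y \<in> S\<close>]
      by (simp add: field_simps)
  qed
  define D where "D = (\<lambda>n y. frechet_derivative (f1 n) (at y))"
  have cauchy: "cmod (D n y h - D m y h) \<le> C * (t n + t m) / R * norm h"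
    if y: "y \<in> cball x0 R" for n m y h
  proof -
    have sub': "cball y R \<subseteq> cball x0 (2*R)"
    proof
      fix w assume "w \<in> cball y R"
      then show "w \<in> cball x0 (2*R)" using y dist_triangle[of x0 w y] by (simp add: dist_commute)
    qed
    have yin: "y \<in> cball x0 (2*R)" using y R by simp
    let ?g = "\<lambda>y. f1 n y - f1 m y"
    have gd: "(?g has_derivative (\<lambda>h. D n z h - D m z h)) (at z)" if "z \<in> cball x0 (2*R)" for z
      unfolding D_def using that by (intro has_derivative_diff holomorphic_fun_has_derivative(1)[OF f1hol])
    have hol: "holomorphic_fun (cball x0 (2*R)) ?g"
      by (rule holomorphic_funI[OF gd]) (auto simp: D_def holomorphic_fun_has_derivative(2)[OF f1hol] algebra_simps)
    have "cmod (frechet_derivative ?g (at y) h) \<le> (C * (t n + t m)) / R * norm h"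
    proof (rule holomorphic_fun_Cauchy_estimate[OF hol sub' R])
      fix z assume "z \<in> cball y R"
      then have z: "z \<in> cball x0 (2*R)" using sub' by auto
      have "cmod (f1 n z - f1 m z) \<le> cmod (f1 n z - g z) + cmod (f1 m z - g z)"
        using norm_triangle_ineq4[of "f1 n z - g z" "f1 m z - g z"] by simp
      also have "\<dots> \<le> C * t n + C * t m" by (intro add_mono quot z)
      finally show "cmod (f1 n z - f1 m z) \<le> C * (t n + t m)" by (simp add: algebra_simps)
    qed
    moreover have "frechet_derivative ?g (at y) = (\<lambda>h. D n y h - D m y h)"
      using frechet_derivative_at[OF gd[OF yin]] by simp
    ultimately show ?thesis by simp
  qed
  have C0: "C > 0" using B \<rho> by (simp add: C_def)
  have conv: "\<exists>l. (\<lambda>n. D n y h) \<longlonglongrightarrow> l" if y: "y \<in> cball x0 R" for y h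
  proof -
    have "(\<lambda>n. C * (2 * t n) / R * norm h) \<longlonglongrightarrow> C * (2 * 0) / R * norm h"
      by (intro tendsto_intros t0) (use R in auto)
    then have lim: "(\<lambda>n. C * (2 * t n) / R * norm h) \<longlonglongrightarrow> 0" by simp
    have dec: "t m \<le> t n" if "n \<le> m" for n m
      using that \<rho> by (auto simp: t_def intro!: divide_left_mono)
    have "Cauchy (\<lambda>n. D n y h)"
    proof (rule metric_CauchyI)
      fix e :: real assume "e > 0"
      from order_tendstoD(2)[OF lim this] obtain N where N: "C * (2 * t N) / R * norm h < e"
        unfolding eventually_sequentially by blast
      show "\<exists>M. \<forall>m\<ge>M. \<forall>n\<ge>M. dist (D m y h) (D n y h) < e"
      proof (intro exI allI impI)
        fix m n assume mn: "m \<ge> N" "n \<ge> N"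
        have "dist (D m y h) (D n y h) \<le> C * (t m + t n) / R * norm h"
          using cauchy[OF y] by (simp add: dist_norm)
        also have "\<dots> \<le> C * (2 * t N) / R * norm h"
          using dec[OF mn(1)] dec[OF mn(2)] C0 R
          by (intro mult_right_mono divide_right_mono mult_left_mono) auto
        finally show "dist (D m y h) (D n y h) < e" using N by simp
      qed
    qed
    then show ?thesis using convergent_def Cauchy_convergent_iff by blast
  qed
  define g' where "g' = (\<lambda>y h. lim (\<lambda>n. D n y h))"
  have g'lim: "(\<lambda>n. D n y h) \<longlonglongrightarrow> g' y h" if "y \<in> cball x0 R" for y h
    using conv[OF that] unfolding g'_def by (simp add: convergent_LIMSEQ_iff[symmetric] convergent_def)
  have bound: "cmod (D n y h - g' y h) \<le> C * t n / R * norm h" if y: "y \<in> cball x0 R" for n y h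
  proof -
    have "(\<lambda>m. cmod (D n y h - D m y h)) \<longlonglongrightarrow> cmod (D n y h - g' y h)"
      by (intro tendsto_intros g'lim y)
    moreover have "(\<lambda>m. C * (t n + t m) / R * norm h) \<longlonglongrightarrow> C * (t n + 0) / R * norm h"
      by (intro tendsto_intros t0) (use R in auto)
    ultimately have "cmod (D n y h - g' y h) \<le> C * (t n + 0) / R * norm h"
      by (rule LIMSEQ_le) (use cauchy[OF y] in auto)
    then show ?thesis by simp
  qed
  have "\<exists>G. \<forall>x\<in>ball x0 R. (\<lambda>n. f1 n x) \<longlonglongrightarrow> G x \<and> (G has_derivative g' x) (at x within ball x0 R)"
  proof (rule has_derivative_sequence)
    show "convex (ball x0 R)" by simp
    show "(f1 n has_derivative D n x) (at x within ball x0 R)" if "x \<in> ball x0 R" for n x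
    proof (rule has_derivative_at_withinI)
      show "(f1 n has_derivative D n x) (at x)"
        unfolding D_def using that R by (intro holomorphic_fun_has_derivative(1)[OF f1hol]) auto
    qed
    show "\<forall>\<^sub>F n in sequentially. \<forall>x\<in>ball x0 R. \<forall>h. cmod (D n x h - g' x h) \<le> e * norm h" if "e > 0" for e
    proof -
      have "(\<lambda>n. C * t n / R) \<longlonglongrightarrow> C * 0 / R"
        by (intro tendsto_intros t0) (use R in auto)
      then have "\<forall>\<^sub>F n in sequentially. C * t n / R < e"
        using that order_tendstoD(2) by fastforce
      then show ?thesis
      proof eventually_elim
        case (elim n)
        show ?case
        proof (intro ballI allI)
          fix x h assume "x \<in> ball x0 R"
          then have "cmod (D n x h - g' x h) \<le> C * t n / R * norm h" by (intro bound) auto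
          also have "\<dots> \<le> e * norm h" using elim by (intro mult_right_mono) auto
          finally show "cmod (D n x h - g' x h) \<le> e * norm h" .
        qed
      qed
    qed
    show "x0 \<in> ball x0 R" using R by simp
    show "(\<lambda>n. f1 n x0) \<longlonglongrightarrow> g x0"
    proof (rule LIM_zero_cancel, rule Lim_null_comparison)
      show "\<forall>\<^sub>F n in sequentially. norm (f1 n x0 - g x0) \<le> C * t n"
        using R by (intro always_eventually allI quot) auto
      show "(\<lambda>n. C * t n) \<longlonglongrightarrow> 0" using tendsto_mult_left[OF t0, of C] by simp
    qed
  qed
  then obtain G where G: "\<And>x. x \<in> ball x0 R \<Longrightarrow> (\<lambda>n. f1 n x) \<longlonglongrightarrow> G x"
      "\<And>x. x \<in> ball x0 R \<Longrightarrow> (G has_derivative g' x) (at x within ball x0 R)" by blast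
  have Gg: "G x = g x" if "x \<in> ball x0 R" for x
  proof -
    have "(\<lambda>n. f1 n x) \<longlonglongrightarrow> g x"
    proof (rule LIM_zero_cancel, rule Lim_null_comparison)
      show "\<forall>\<^sub>F n in sequentially. norm (f1 n x - g x) \<le> C * t n"
        using R that by (intro always_eventually allI quot) auto
      show "(\<lambda>n. C * t n) \<longlonglongrightarrow> 0" using tendsto_mult_left[OF t0, of C] by simp
    qed
    with G(1)[OF that] show ?thesis using LIMSEQ_unique by blast
  qed
  have "(g has_derivative g' x0) (at x0 within ball x0 R)"
    using has_derivative_transform[of x0 "ball x0 R" g G "g' x0"] R G(2)[of x0] Gg by auto
  then have "(g has_derivative g' x0) (at x0)"
    using R at_within_open[of x0 "ball x0 R"] by simp
  moreover have "g' x0 (\<i> *s h) = \<i> * g' x0 h" for h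
  proof -
    have "D n x0 (\<i> *s h) = \<i> * D n x0 h" for n
      unfolding D_def using R by (intro holomorphic_fun_has_derivative(2)[OF f1hol]) auto
    then have "(\<lambda>n. D n x0 (\<i> *s h)) \<longlonglongrightarrow> \<i> * g' x0 h"
      using tendsto_mult_left[OF g'lim[of x0 h], of \<i>] R by simp
    then show ?thesis using g'lim[of x0 "\<i> *s h"] R LIMSEQ_unique by force
  qed
  ultimately show "\<exists>f'. ((\<lambda>y. frechet_derivative f (at y) v) has_derivative f') (at x0) \<and>
      (\<forall>v. f' (\<i> *s v) = \<i> * f' v)"
    unfolding g_def[symmetric] by (intro exI[of _ "g' x0"] conjI allI)
qed

section \<open>Calculus in several real variables\<close>

text \<open>The mean value inequality for \<open>s \<mapsto> f(x + su + tv) - f(x + su)\<close> involves the derivative of \<open>f\<close> in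
  the direction \<open>u\<close> only, which is assumed to be differentiable at \<open>x\<close>.\<close>

lemma second_difference_estimate:
  fixes f :: "'a::real_normed_vector \<Rightarrow> 'b::real_normed_vector"
  assumes S: "open S" "x \<in> S"
    and f: "\<And>y. y \<in> S \<Longrightarrow> (f has_derivative f' y) (at y)"
    and g: "((\<lambda>y. f' y u) has_derivative g) (at x)" and e: "e > 0"
  shows "\<exists>\<delta>>0. \<forall>t. 0 < t \<and> t < \<delta> \<longrightarrow>
     norm (f (x + t *\<^sub>R u + t *\<^sub>R v) - f (x + t *\<^sub>R u) - f (x + t *\<^sub>R v) + f x - (t * t) *\<^sub>R g v) \<le> e * (t * t)"
proof -
  define k where "k = 1 + 2 * norm u + norm v"
  have k: "k > 0" by (simp add: k_def add_pos_nonneg)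
  define e' where "e' = e / k"
  have e': "e' > 0" using e k by (simp add: e'_def)
  have lin: "linear g" using g has_derivative_linear by blast
  from g[unfolded has_derivative_at_alt] e' obtain d1 where d1: "d1 > 0"
    "\<And>y. norm (y - x) < d1 \<Longrightarrow> norm (f' y u - f' x u - g (y - x)) \<le> e' * norm (y - x)"
    by blast
  obtain d2 where d2: "d2 > 0" "ball x d2 \<subseteq> S"
    using S open_contains_ball by blast
  define \<delta> where "\<delta> = min d1 d2 / k"
  have \<delta>: "\<delta> > 0" using d1 d2 k by (simp add: \<delta>_def)
  show ?thesis
  proof (intro exI conjI allI impI)
    show "\<delta> > 0" by fact
    fix t :: real assume t: "0 < t \<and> t < \<delta>"
    have tk: "t * k < min d1 d2" using t k by (simp add: \<delta>_def pos_less_divide_eq)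
    have near: "norm (s *\<^sub>R u + r *\<^sub>R v) < min d1 d2" "norm (s *\<^sub>R u + r *\<^sub>R v) \<le> t * (norm u + norm v)"
      if s: "0 \<le> s" "s \<le> t" and r: "0 \<le> r" "r \<le> t" for s r
    proof -
      have "norm (s *\<^sub>R u + r *\<^sub>R v) \<le> s * norm u + r * norm v"
        using norm_triangle_ineq[of "s *\<^sub>R u" "r *\<^sub>R v"] s r by simp
      also have "\<dots> \<le> t * norm u + t * norm v"
        using s r by (intro add_mono mult_right_mono) auto
      finally show le: "norm (s *\<^sub>R u + r *\<^sub>R v) \<le> t * (norm u + norm v)" by (simp add: algebra_simps)
      also have "\<dots> \<le> t * k" using t by (intro mult_left_mono) (auto simp: k_def)
      finally show "norm (s *\<^sub>R u + r *\<^sub>R v) < min d1 d2" using tk by simp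
    qed
    have inS: "x + s *\<^sub>R u + r *\<^sub>R v \<in> S" if "0 \<le> s" "s \<le> t" "0 \<le> r" "r \<le> t" for s r
    proof -
      have "dist x (x + s *\<^sub>R u + r *\<^sub>R v) < d2"
        using near(1)[OF that] norm_minus_cancel[of "s *\<^sub>R u + r *\<^sub>R v"] by (simp add: dist_norm)
      then show ?thesis using d2 by auto
    qed
    define \<phi> where "\<phi> = (\<lambda>s. f (x + s *\<^sub>R u + t *\<^sub>R v) - f (x + s *\<^sub>R u) - (s * t) *\<^sub>R g v)"
    define D where "D = (\<lambda>s. f' (x + s *\<^sub>R u + t *\<^sub>R v) u - f' (x + s *\<^sub>R u) u - t *\<^sub>R g v)"
    have "norm (\<phi> t - \<phi> 0) \<le> (e * t) * norm (t - 0)"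
    proof (rule differentiable_bound[where S="{0..t}" and f'="\<lambda>s h. h *\<^sub>R D s"])
      fix s assume s: "s \<in> {0..t}"
      have a1: "x + s *\<^sub>R u + t *\<^sub>R v \<in> S" using inS[of s t] s t by auto
      have a2: "x + s *\<^sub>R u \<in> S" using inS[of s 0] s t by auto
      have l1: "((\<lambda>s. x + s *\<^sub>R u + t *\<^sub>R v) has_derivative (\<lambda>h. h *\<^sub>R u)) (at s)"
        by (auto intro!: derivative_eq_intros)
      have l2: "((\<lambda>s. x + s *\<^sub>R u) has_derivative (\<lambda>h. h *\<^sub>R u)) (at s)"
        by (auto intro!: derivative_eq_intros)
      have l3: "((\<lambda>s. (s * t) *\<^sub>R g v) has_derivative (\<lambda>h. (h * t) *\<^sub>R g v)) (at s)"
        by (auto intro!: derivative_eq_intros)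
      have "(\<phi> has_derivative (\<lambda>h. f' (x + s *\<^sub>R u + t *\<^sub>R v) (h *\<^sub>R u) - f' (x + s *\<^sub>R u) (h *\<^sub>R u) - (h * t) *\<^sub>R g v)) (at s)"
        unfolding \<phi>_def
        using has_derivative_diff[OF has_derivative_diff[OF has_derivative_compose[OF l1 f[OF a1]] has_derivative_compose[OF l2 f[OF a2]]] l3] .
      moreover have "linear (f' (x + s *\<^sub>R u + t *\<^sub>R v))" "linear (f' (x + s *\<^sub>R u))"
        using has_derivative_linear[OF f[OF a1]] has_derivative_linear[OF f[OF a2]] by auto
      ultimately have "(\<phi> has_derivative (\<lambda>h. h *\<^sub>R D s)) (at s)"
        by (simp add: D_def linear_scale scaleR_diff_right)
      then show "(\<phi> has_derivative (\<lambda>h. h *\<^sub>R D s)) (at s within {0..t})"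
        by (rule has_derivative_at_withinI)
      show "onorm (\<lambda>h. h *\<^sub>R D s) \<le> e * t"
      proof (rule onorm_le)
        fix h :: real
        have b1: "norm (f' (x + s *\<^sub>R u + t *\<^sub>R v) u - f' x u - g (s *\<^sub>R u + t *\<^sub>R v)) \<le> e' * (t * (norm u + norm v))"
        proof -
          have "norm (f' (x + s *\<^sub>R u + t *\<^sub>R v) u - f' x u - g (s *\<^sub>R u + t *\<^sub>R v)) \<le> e' * norm (s *\<^sub>R u + t *\<^sub>R v)"
            using d1(2)[of "x + s *\<^sub>R u + t *\<^sub>R v"] near(1)[of s t] s t by (simp add: add.assoc)
          also have "\<dots> \<le> e' * (t * (norm u + norm v))"
            using near(2)[of s t] s t e' by (intro mult_left_mono) auto
          finally show ?thesis .
        qed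
        have b2: "norm (f' (x + s *\<^sub>R u) u - f' x u - g (s *\<^sub>R u)) \<le> e' * (t * norm u)"
        proof -
          have "norm (f' (x + s *\<^sub>R u) u - f' x u - g (s *\<^sub>R u)) \<le> e' * norm (s *\<^sub>R u)"
            using d1(2)[of "x + s *\<^sub>R u"] near(1)[of s 0] s t by simp
          also have "\<dots> \<le> e' * (t * norm u)"
            using s t e' by (intro mult_left_mono) (auto intro: mult_right_mono)
          finally show ?thesis .
        qed
        have D_eq: "D s = (f' (x + s *\<^sub>R u + t *\<^sub>R v) u - f' x u - g (s *\<^sub>R u + t *\<^sub>R v)) - (f' (x + s *\<^sub>R u) u - f' x u - g (s *\<^sub>R u))"
          using lin by (simp add: D_def linear_add linear_scale)
        have "norm (D s) \<le> e' * (t * (norm u + norm v)) + e' * (t * norm u)"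
          unfolding D_eq by (rule order_trans[OF norm_triangle_ineq4 add_mono[OF b1 b2]])
        also have "\<dots> \<le> e' * (t * k)" using e' t by (simp add: k_def algebra_simps)
        also have "\<dots> = e * t" using k by (simp add: e'_def)
        finally have "norm (D s) \<le> e * t" .
        then show "norm (h *\<^sub>R D s) \<le> (e * t) * norm h" using mult_left_mono[of "norm (D s)" "e * t"] by (simp add: mult.commute)
      qed
    qed (use t in auto)
    then show "norm (f (x + t *\<^sub>R u + t *\<^sub>R v) - f (x + t *\<^sub>R u) - f (x + t *\<^sub>R v) + f x - (t * t) *\<^sub>R g v) \<le> e * (t * t)"
      using t by (simp add: \<phi>_def algebra_simps)
  qed
qed

text \<open>The second difference of \<open>f\<close> is symmetric in \<open>u\<close> and \<open>v\<close>, and the preceding estimate applies to it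
  in both orders.\<close>

lemma symmetric_second_derivative:
  fixes f :: "'a::real_normed_vector \<Rightarrow> 'b::real_normed_vector"
  assumes S: "open S" "x \<in> S"
    and f: "\<And>y. y \<in> S \<Longrightarrow> (f has_derivative f' y) (at y)"
    and gu: "((\<lambda>y. f' y u) has_derivative gu) (at x)"
    and gv: "((\<lambda>y. f' y v) has_derivative gv) (at x)"
  shows "gu v = gv u"
proof (rule ccontr)
  assume "gu v \<noteq> gv u"
  define e where "e = norm (gu v - gv u) / 3"
  have e: "e > 0" using \<open>gu v \<noteq> gv u\<close> by (simp add: e_def)
  obtain d1 where d1: "d1 > 0" "\<And>t. 0 < t \<and> t < d1 \<Longrightarrow>
     norm (f (x + t *\<^sub>R u + t *\<^sub>R v) - f (x + t *\<^sub>R u) - f (x + t *\<^sub>R v) + f x - (t * t) *\<^sub>R gu v) \<le> e * (t * t)"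
    using second_difference_estimate[OF S f gu e, of v] by blast
  obtain d2 where d2: "d2 > 0" "\<And>t. 0 < t \<and> t < d2 \<Longrightarrow>
     norm (f (x + t *\<^sub>R v + t *\<^sub>R u) - f (x + t *\<^sub>R v) - f (x + t *\<^sub>R u) + f x - (t * t) *\<^sub>R gv u) \<le> e * (t * t)"
    using second_difference_estimate[OF S f gv e, of u] by blast
  define t where "t = min d1 d2 / 2"
  have t: "0 < t" "t < d1" "t < d2" using d1 d2 by (auto simp: t_def)
  define A where "A = f (x + t *\<^sub>R u + t *\<^sub>R v) - f (x + t *\<^sub>R u) - f (x + t *\<^sub>R v) + f x"
  have 1: "norm (A - (t * t) *\<^sub>R gu v) \<le> e * (t * t)"
    unfolding A_def using d1(2)[of t] t by blast
  have "norm (A - (t * t) *\<^sub>R gv u) \<le> e * (t * t)"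
    unfolding A_def using d2(2)[of t] t by (simp add: algebra_simps)
  with 1 have "norm ((A - (t * t) *\<^sub>R gv u) - (A - (t * t) *\<^sub>R gu v)) \<le> e * (t * t) + e * (t * t)"
    by (intro order_trans[OF norm_triangle_ineq4 add_mono])
  moreover have "(A - (t * t) *\<^sub>R gv u) - (A - (t * t) *\<^sub>R gu v) = (t * t) *\<^sub>R (gu v - gv u)"
    by (simp add: algebra_simps)
  ultimately have "norm ((t * t) *\<^sub>R (gu v - gv u)) \<le> e * (t * t) + e * (t * t)"
    by metis
  then have "(t * t) * norm (gu v - gv u) \<le> (t * t) * (2 * e)"
    unfolding norm_scaleR by (simp add: mult.commute mult.left_commute)
  then have "norm (gu v - gv u) \<le> 2 * e" using t by (simp add: mult_le_cancel_left)
  then show False using e by (simp add: e_def)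
qed

lemma has_derivative_within_Un:
  assumes "(f has_derivative f') (at x within S)" "(f has_derivative f') (at x within T)"
  shows "(f has_derivative f') (at x within S \<union> T)"
  using assms unfolding has_derivative_within by (simp add: Lim_Un)

text \<open>One-sided derivatives in all directions suffice for differentiability, if they are linear in
  the direction and continuous: the derivative from the left is the one from the right in the
  opposite direction.\<close>

lemma has_derivative_from_right_derivatives:
  fixes f :: "'a::euclidean_space \<Rightarrow> 'b::real_normed_vector"
  assumes S: "open S"
    and der: "\<And>x u. x \<in> S \<Longrightarrow> ((\<lambda>t. f (x + t *\<^sub>R u)) has_vector_derivative \<Phi> x u) (at 0 within {0..})"
    and lin: "\<And>x. x \<in> S \<Longrightarrow> linear (\<Phi> x)"
    and cont: "\<And>u. continuous_on S (\<lambda>x. \<Phi> x u)"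
    and x: "x \<in> S"
  shows "(f has_derivative \<Phi> x) (at x)"
proof -
  have two: "((\<lambda>t. f (y + t *\<^sub>R u)) has_vector_derivative \<Phi> y u) (at 0)" if y: "y \<in> S" for y u
  proof -
    have "((\<lambda>t. f (y + t *\<^sub>R (- u))) has_vector_derivative \<Phi> y (- u)) (at 0 within uminus ` {..0})"
      using der[OF y, of "- u"] by (simp add: image_uminus_atMost)
    then have "(((\<lambda>t. f (y + t *\<^sub>R (- u))) \<circ> uminus) has_vector_derivative (-1) *\<^sub>R \<Phi> y (- u)) (at 0 within {..0})"
      by (intro vector_diff_chain_within) (auto intro!: derivative_eq_intros)
    then have "((\<lambda>t. f (y + t *\<^sub>R u)) has_vector_derivative \<Phi> y u) (at 0 within {..0})"
      using lin[OF y] by (simp add: o_def linear_neg)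
    then have "((\<lambda>t. f (y + t *\<^sub>R u)) has_vector_derivative \<Phi> y u) (at 0 within {0..} \<union> {..0})"
      using der[OF y, of u] unfolding has_vector_derivative_def by (intro has_derivative_within_Un)
    moreover have "{0..} \<union> {..0} = (UNIV :: real set)" by auto
    ultimately show ?thesis by simp
  qed
  have line: "((\<lambda>t. f (y + t *\<^sub>R u)) has_vector_derivative \<Phi> (y + s *\<^sub>R u) u) (at s)"
    if "y + s *\<^sub>R u \<in> S" for y u s
  proof -
    have "((\<lambda>t. f ((y + s *\<^sub>R u) + t *\<^sub>R u)) has_vector_derivative \<Phi> (y + s *\<^sub>R u) u) (at (s + - s))"
      using two[OF that, of u] by simp
    then have "(((\<lambda>t. f ((y + s *\<^sub>R u) + t *\<^sub>R u)) \<circ> (\<lambda>t. t + - s)) has_vector_derivative (1 *\<^sub>R \<Phi> (y + s *\<^sub>R u) u)) (at s)"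
      by (intro vector_diff_chain_at) (auto intro!: derivative_eq_intros)
    then show ?thesis by (simp add: o_def algebra_simps)
  qed
  show ?thesis
    unfolding has_derivative_at_alt
  proof (intro conjI allI impI)
    show "bounded_linear (\<Phi> x)"
      using lin[OF x] linear_conv_bounded_linear by blast
    fix e :: real assume e: "e > 0"
    define c where "c = real DIM('a)"
    have c: "c > 0" by (simp add: c_def)
    have ec: "e / c > 0" using e c by simp
    have "\<exists>d>0. \<forall>y\<in>S. dist y x < d \<longrightarrow> dist (\<Phi> y b) (\<Phi> x b) < e / c" for b
      using cont[of b, unfolded continuous_on_iff, rule_format, OF x ec] .
    then obtain d where d: "\<And>b. d b > 0" "\<And>b y. y \<in> S \<Longrightarrow> dist y x < d b \<Longrightarrow> dist (\<Phi> y b) (\<Phi> x b) < e / c"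
      by metis
    obtain d0 where d0: "d0 > 0" "ball x d0 \<subseteq> S" using S x open_contains_ball by blast
    define \<delta> where "\<delta> = Min (insert d0 (d ` Basis))"
    have \<delta>: "\<delta> > 0" unfolding \<delta>_def using d0 d(1) by (subst Min_gr_iff) auto
    have \<delta>le: "\<delta> \<le> d0" "\<And>b. b \<in> Basis \<Longrightarrow> \<delta> \<le> d b"
      unfolding \<delta>_def by (rule Min_le; simp)+
    show "\<exists>\<delta>>0. \<forall>y. norm (y - x) < \<delta> \<longrightarrow> norm (f y - f x - \<Phi> x (y - x)) \<le> e * norm (y - x)"
    proof (intro exI conjI allI impI)
      show "\<delta> > 0" by fact
      fix y assume y: "norm (y - x) < \<delta>"
      define u where "u = y - x"
      have z: "x + t *\<^sub>R u \<in> S \<and> dist (x + t *\<^sub>R u) x < \<delta>" if "t \<in> {0..1}" for t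
      proof -
        have "dist (x + t *\<^sub>R u) x \<le> norm u"
          using that by (simp add: dist_norm mult_left_le_one_le)
        also have "\<dots> < \<delta>" using y by (simp add: u_def)
        finally have "dist (x + t *\<^sub>R u) x < \<delta>" .
        moreover from this have "x + t *\<^sub>R u \<in> ball x d0" using \<delta>le by (simp add: dist_commute)
        ultimately show ?thesis using d0 by blast
      qed
      define h where "h = (\<lambda>t. f (x + t *\<^sub>R u) - t *\<^sub>R \<Phi> x u)"
      have "norm (h 1 - h 0) \<le> (e * norm u) * norm (1 - 0 :: real)"
      proof (rule differentiable_bound[where S="{0..1}" and f'="\<lambda>t r. r *\<^sub>R (\<Phi> (x + t *\<^sub>R u) u - \<Phi> x u)"])
        fix t :: real assume t: "t \<in> {0..1}"
        have "(h has_vector_derivative (\<Phi> (x + t *\<^sub>R u) u - 1 *\<^sub>R \<Phi> x u)) (at t)"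
          unfolding h_def using z[OF t] by (intro has_vector_derivative_diff line) (auto intro!: derivative_eq_intros)
        then show "(h has_derivative (\<lambda>r. r *\<^sub>R (\<Phi> (x + t *\<^sub>R u) u - \<Phi> x u))) (at t within {0..1})"
          using has_derivative_at_withinI unfolding has_vector_derivative_def by fastforce
        have "norm (\<Phi> (x + t *\<^sub>R u) u - \<Phi> x u) \<le> e * norm u"
        proof -
          let ?z = "x + t *\<^sub>R u"
          have exp: "\<Phi> w u = (\<Sum>b\<in>Basis. (u \<bullet> b) *\<^sub>R \<Phi> w b)" if "w \<in> S" for w
          proof -
            have "\<Phi> w (\<Sum>b\<in>Basis. (u \<bullet> b) *\<^sub>R b) = (\<Sum>b\<in>Basis. (u \<bullet> b) *\<^sub>R \<Phi> w b)"
              using lin[OF that] by (simp add: linear_sum linear_scale)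
            then show ?thesis by (simp add: euclidean_representation)
          qed
          have "\<Phi> ?z u - \<Phi> x u = (\<Sum>b\<in>Basis. (u \<bullet> b) *\<^sub>R (\<Phi> ?z b - \<Phi> x b))"
            using exp[of ?z] exp[of x] z[OF t] x by (simp add: sum_subtractf scaleR_diff_right)
          also have "norm \<dots> \<le> (\<Sum>b\<in>(Basis :: 'a set). norm u * (e / c))"
          proof (rule sum_norm_le)
            fix b :: 'a assume b: "b \<in> Basis"
            have "norm (\<Phi> ?z b - \<Phi> x b) \<le> e / c"
              using d(2)[of ?z b] z[OF t] \<delta>le(2)[OF b] by (simp add: dist_norm)
            moreover have "\<bar>u \<bullet> b\<bar> \<le> norm u" using b by (rule Basis_le_norm)
            ultimately show "norm ((u \<bullet> b) *\<^sub>R (\<Phi> ?z b - \<Phi> x b)) \<le> norm u * (e / c)"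
              using mult_mono[of "\<bar>u \<bullet> b\<bar>" "norm u" "norm (\<Phi> ?z b - \<Phi> x b)" "e / c"] by simp
          qed
          also have "\<dots> = e * norm u" using c by (simp add: c_def)
          finally show ?thesis .
        qed
        then show "onorm (\<lambda>r. r *\<^sub>R (\<Phi> (x + t *\<^sub>R u) u - \<Phi> x u)) \<le> e * norm u"
          by (intro onorm_le) (use mult_left_mono[of "norm (\<Phi> (x + t *\<^sub>R u) u - \<Phi> x u)" "e * norm u"] in \<open>simp add: mult.commute\<close>)
      qed auto
      then show "norm (f y - f x - \<Phi> x (y - x)) \<le> e * norm (y - x)"
        by (simp add: h_def u_def algebra_simps)
    qed
  qed
qed

section \<open>The strong maximum principle\<close>

text \<open>The second derivative at \<open>0\<close> of a function on a line.  The operator in the maximum principle is a sum of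
  such derivatives along vectors that depend on the point in an arbitrary way.\<close>

definition has_second_deriv_0 :: "(real \<Rightarrow> real) \<Rightarrow> real \<Rightarrow> bool" where
  "has_second_deriv_0 f d \<longleftrightarrow>
     (\<exists>p. (\<forall>\<^sub>F t in nhds 0. (f has_real_derivative p t) (at t)) \<and> (p has_real_derivative d) (at 0))"

lemma has_second_deriv_0_add:
  assumes "has_second_deriv_0 f a" "has_second_deriv_0 g b"
  shows "has_second_deriv_0 (\<lambda>t. f t + g t) (a + b)"
proof -
  obtain p q where *: "\<forall>\<^sub>F t in nhds 0. (f has_real_derivative p t) (at t)" "(p has_real_derivative a) (at 0)"
    "\<forall>\<^sub>F t in nhds 0. (g has_real_derivative q t) (at t)" "(q has_real_derivative b) (at 0)"
    using assms unfolding has_second_deriv_0_def by blast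
  have "\<forall>\<^sub>F t in nhds 0. ((\<lambda>t. f t + g t) has_real_derivative (p t + q t)) (at t)"
    using *(1,3) by eventually_elim (rule DERIV_add)
  moreover have "((\<lambda>t. p t + q t) has_real_derivative (a + b)) (at 0)"
    using *(2,4) by (rule DERIV_add)
  ultimately show ?thesis unfolding has_second_deriv_0_def by (intro exI[of _ "\<lambda>t. p t + q t"]) auto
qed

lemma has_second_deriv_0_cmult:
  assumes "has_second_deriv_0 f a"
  shows "has_second_deriv_0 (\<lambda>t. c * f t) (c * a)"
proof -
  obtain p where *: "\<forall>\<^sub>F t in nhds 0. (f has_real_derivative p t) (at t)" "(p has_real_derivative a) (at 0)"
    using assms unfolding has_second_deriv_0_def by blast
  have "\<forall>\<^sub>F t in nhds 0. ((\<lambda>t. c * f t) has_real_derivative (c * p t)) (at t)"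
    using *(1) by eventually_elim (rule DERIV_cmult)
  moreover have "((\<lambda>t. c * p t) has_real_derivative (c * a)) (at 0)"
    using *(2) by (rule DERIV_cmult)
  ultimately show ?thesis unfolding has_second_deriv_0_def by (intro exI[of _ "\<lambda>t. c * p t"]) auto
qed

lemma has_second_deriv_0_cong:
  assumes "has_second_deriv_0 f a" "\<forall>\<^sub>F t in nhds 0. g t = f t"
  shows "has_second_deriv_0 g a"
proof -
  obtain p where *: "\<forall>\<^sub>F t in nhds 0. (f has_real_derivative p t) (at t)" "(p has_real_derivative a) (at 0)"
    using assms unfolding has_second_deriv_0_def by blast
  have "\<forall>\<^sub>F t in nhds 0. \<forall>\<^sub>F s in nhds t. g s = f s"
    using assms(2) by (simp add: eventually_eventually)
  then have "\<forall>\<^sub>F t in nhds 0. (g has_real_derivative p t) (at t)"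
    using *(1) by eventually_elim (subst DERIV_cong_ev, auto)
  then show ?thesis using *(2) unfolding has_second_deriv_0_def by blast
qed

lemma has_second_deriv_0_local_max:
  assumes d: "has_second_deriv_0 f d" and max: "\<forall>\<^sub>F t in nhds 0. f t \<le> f 0"
  shows "d \<le> 0"
proof (rule ccontr)
  assume "\<not> d \<le> 0"
  obtain p where p: "\<forall>\<^sub>F t in nhds 0. (f has_real_derivative p t) (at t)" "(p has_real_derivative d) (at 0)"
    using d unfolding has_second_deriv_0_def by blast
  have "\<forall>\<^sub>F t in nhds 0. (f has_real_derivative p t) (at t) \<and> f t \<le> f 0"
    using p(1) max by eventually_elim simp
  then obtain r where r: "r > 0" "\<And>t. \<bar>t\<bar> < r \<Longrightarrow> (f has_real_derivative p t) (at t) \<and> f t \<le> f 0"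
    unfolding eventually_nhds_metric by (auto simp: dist_real_def)
  have p0: "p 0 = 0"
    using r by (intro DERIV_local_max[of f "p 0" 0 r]) auto
  obtain s where s: "s > 0" "\<And>h. 0 < h \<Longrightarrow> h < s \<Longrightarrow> p 0 < p (0 + h)"
    using DERIV_pos_inc_right[OF p(2)] \<open>\<not> d \<le> 0\<close> by force
  define t where "t = min r s / 2"
  have t: "0 < t" "t < r" "t < s" using r(1) s(1) by (auto simp: t_def)
  have "\<exists>z>0. z < t \<and> f t - f 0 = (t - 0) * p z"
    using t r by (intro MVT2) auto
  then obtain z where z: "0 < z" "z < t" "f t - f 0 = t * p z" by auto
  have "p z > 0" using s(2)[of z] z t p0 by simp
  then have "f t > f 0" using z t by (smt (verit) mult_pos_pos)
  then show False using r(2)[of t] t by simp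
qed

text \<open>The comparison function for the maximum principle.\<close>

lemma has_second_deriv_0_gaussian:
  fixes c x e :: "'a::euclidean_space"
  shows "has_second_deriv_0 (\<lambda>t. exp (- \<alpha> * (norm (x + t *\<^sub>R e - c))\<^sup>2))
    (exp (- \<alpha> * (norm (x - c))\<^sup>2) * (4 * \<alpha>\<^sup>2 * ((x - c) \<bullet> e)\<^sup>2 - 2 * \<alpha> * (norm e)\<^sup>2))"
proof -
  let ?E = "\<lambda>t. exp (- \<alpha> * ((norm (x - c))\<^sup>2 + 2 * t * ((x - c) \<bullet> e) + t\<^sup>2 * (norm e)\<^sup>2))"
  have E: "exp (- \<alpha> * (norm (x + t *\<^sub>R e - c))\<^sup>2) = ?E t" for t
  proof -
    have "(norm (x + t *\<^sub>R e - c))\<^sup>2 = (norm (x - c))\<^sup>2 + 2 * t * ((x - c) \<bullet> e) + t\<^sup>2 * (norm e)\<^sup>2"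
      unfolding power2_norm_eq_inner
      by (simp add: inner_add_left inner_add_right inner_diff_left inner_diff_right inner_commute
          power2_eq_square algebra_simps)
    then show ?thesis by simp
  qed
  let ?p = "\<lambda>t. ?E t * (- \<alpha> * (2 * ((x - c) \<bullet> e) + 2 * t * (norm e)\<^sup>2))"
  have "(?E has_real_derivative ?p t) (at t)" for t
    by (auto intro!: derivative_eq_intros simp: power2_eq_square algebra_simps)
  moreover have "(?p has_real_derivative ?E 0 * (4 * \<alpha>\<^sup>2 * ((x - c) \<bullet> e)\<^sup>2 - 2 * \<alpha> * (norm e)\<^sup>2)) (at 0)"
    by (auto intro!: derivative_eq_intros simp: power2_eq_square algebra_simps)
  ultimately show ?thesis
    unfolding has_second_deriv_0_def E by (intro exI[of _ ?p]) auto
qed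

text \<open>Hopf's argument.  If \<open>\<psi>\<close> does not attain its maximum \<open>M\<close> everywhere, there is a ball on which
  \<open>\<psi> < M\<close>, except for one boundary point \<open>z\<close> with \<open>\<psi> z = M\<close>.  A small multiple of
  \<open>exp (- \<alpha> \<bar>x - c\<bar>\<^sup>2) - exp (- \<alpha> r\<^sup>2)\<close>, with \<open>c\<close> and \<open>r\<close> centre and radius of that ball, turns \<open>\<psi>\<close>
  into a function with an interior maximum near \<open>z\<close>, which contradicts the strict positivity of the
  operator on it.  The bounds on the fields \<open>e k\<close> express uniform ellipticity.  They are pointwise bounds,
  since the fields will be obtained by choosing a frame at each point.\<close>

lemma strong_maximum_principle:
  fixes \<psi> :: "'a::euclidean_space \<Rightarrow> real" and e :: "'i \<Rightarrow> 'a \<Rightarrow> 'a"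
  assumes K: "finite K" and R: "R > 0"
    and cont: "continuous_on (ball x0 R) \<psi>"
    and le: "\<And>x. x \<in> ball x0 R \<Longrightarrow> \<psi> x \<le> M" and x0: "\<psi> x0 = M"
    and sub: "\<And>x. x \<in> ball x0 R \<Longrightarrow>
        \<exists>d. (\<forall>k\<in>K. has_second_deriv_0 (\<lambda>t. \<psi> (x + t *\<^sub>R e k x)) (d k)) \<and> 0 \<le> (\<Sum>k\<in>K. d k)"
    and upper: "\<And>x. x \<in> ball x0 R \<Longrightarrow> (\<Sum>k\<in>K. (norm (e k x))\<^sup>2) \<le> \<Lambda>"
    and lower: "\<And>x \<xi>. x \<in> ball x0 R \<Longrightarrow> l * (norm \<xi>)\<^sup>2 \<le> (\<Sum>k\<in>K. (\<xi> \<bullet> e k x)\<^sup>2)"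
    and l: "l > 0" and y: "y \<in> ball x0 (R / 2)"
  shows "\<psi> y = M"
proof (rule ccontr)
  assume ne: "\<psi> y \<noteq> M"
  have d0: "dist x0 y < R / 2" using y by simp
  define Z where "Z = {x \<in> cball y (dist x0 y). \<psi> x = M}"
  have cb: "cball y (dist x0 y) \<subseteq> ball x0 R"
  proof
    fix w assume "w \<in> cball y (dist x0 y)"
    then show "w \<in> ball x0 R" using d0 dist_triangle[of x0 w y] by simp
  qed
  have "closedin (top_of_set (cball y (dist x0 y))) Z"
    unfolding Z_def using continuous_on_subset[OF cont cb] by (rule continuous_closedin_preimage_constant)
  then have "compact Z" using closedin_compact[OF compact_cball] by blast
  moreover have x0Z: "x0 \<in> Z" using x0 by (simp add: Z_def dist_commute)
  ultimately obtain z where z: "z \<in> Z" "\<And>w. w \<in> Z \<Longrightarrow> dist y z \<le> dist y w"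
    using distance_attains_inf[of Z y] compact_imp_closed by (metis empty_iff)
  have zM: "\<psi> z = M" and zne: "z \<noteq> y" using z ne by (auto simp: Z_def)
  have zd: "dist y z \<le> dist x0 y" using z x0Z by (auto simp: dist_commute)
  \<comment> \<open>half of the ball around \<open>y\<close> touches the set of maxima in the single point \<open>z\<close>\<close>
  define c where "c = midpoint y z"
  define r where "r = dist y z / 2"
  have r: "r > 0" using zne by (simp add: r_def)
  have cz: "dist c z = r" by (simp add: c_def r_def dist_midpoint)
  have cy: "dist y c = r" by (simp add: c_def r_def dist_midpoint)
  have touch: "\<psi> w < M" if w: "w \<in> cball c r" "w \<noteq> z" for w
  proof (rule ccontr)
    assume "\<not> \<psi> w < M"
    have yw: "dist y w \<le> dist y z" using dist_triangle[of y w c] w cy by (simp add: r_def)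
    then have wcb: "w \<in> cball y (dist x0 y)" using zd by simp
    then have "w \<in> Z" using le[of w] cb \<open>\<not> \<psi> w < M\<close> by (force simp: Z_def)
    then have "dist y w = dist y z" using z(2) yw by force
    moreover have "dist y c + dist c w \<le> dist y w"
      using w cy calculation by (simp add: r_def)
    ultimately have eqs: "dist y w = dist y c + dist c w" "dist c w = r"
      using dist_triangle[of y w c] w cy by (auto simp: r_def)
    have eq1: "norm ((c - y) + (w - c)) = norm (c - y) + norm (w - c)" 
      using eqs(1) by (simp add: dist_norm norm_minus_commute)
    have "norm (c - y) *\<^sub>R (w - c) = norm (w - c) *\<^sub>R (c - y)"
      using eq1 norm_triangle_eq[of "c - y" "w - c"] by simp
    moreover have "norm (c - y) = r" "norm (w - c) = r"
      using cy eqs(2) by (simp_all add: dist_norm norm_minus_commute)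
    ultimately have "w - c = c - y" using r by simp
    then have "w = 2 *\<^sub>R c - y" by (simp add: algebra_simps scaleR_2)
    also have "\<dots> = z" by (simp add: c_def midpoint_def)
    finally show False using w by simp
  qed
  have zin: "z \<in> ball x0 R" using z cb by (auto simp: Z_def)
  then obtain \<delta>0 where \<delta>0: "\<delta>0 > 0" "ball z \<delta>0 \<subseteq> ball x0 R" using open_contains_ball open_ball by blast
  define \<delta> where "\<delta> = min \<delta>0 r / 2"
  have \<delta>: "\<delta> > 0" "\<delta> < \<delta>0" "\<delta> \<le> r / 2" using \<delta>0(1) r by (auto simp: \<delta>_def)
  have cbz: "cball z \<delta> \<subseteq> ball x0 R" using \<delta> \<delta>0 by force
  \<comment> \<open>near \<open>z\<close> the distance to \<open>c\<close> is at least \<open>r / 2\<close>, so that the quadratic term in \<open>\<alpha>\<close> dominates\<close>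
  define \<alpha> where "\<alpha> = (\<bar>\<Lambda>\<bar> + 1) * 2 / (l * r\<^sup>2)"
  have \<alpha>: "\<alpha> > 0" using l r by (simp add: \<alpha>_def)
  have strict: "0 < (\<Sum>k\<in>K. 4 * \<alpha>\<^sup>2 * ((x - c) \<bullet> e k x)\<^sup>2 - 2 * \<alpha> * (norm (e k x))\<^sup>2)"
    if x: "x \<in> cball z \<delta>" for x
  proof -
    have "r \<le> dist c x + dist x z" using dist_triangle[of c z x] cz by simp
    then have "r / 2 \<le> norm (x - c)" using x \<delta>(3) by (simp add: dist_norm norm_minus_commute)
    then have n: "(r / 2)\<^sup>2 \<le> (norm (x - c))\<^sup>2" using r by (intro power_mono) auto
    have xin: "x \<in> ball x0 R" using x cbz by blast
    have "2 * \<Lambda> < 4 * \<alpha> * (l * (r / 2)\<^sup>2)"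
      using l r by (simp add: \<alpha>_def power2_eq_square field_simps abs_if)
    also have "\<dots> \<le> 4 * \<alpha> * (l * (norm (x - c))\<^sup>2)" using \<alpha> l n by (intro mult_left_mono) auto
    also have "\<dots> \<le> 4 * \<alpha> * (\<Sum>k\<in>K. ((x - c) \<bullet> e k x)\<^sup>2)"
      using \<alpha> lower[OF xin, of "x - c"] by (intro mult_left_mono) auto
    finally have "2 * (\<Sum>k\<in>K. (norm (e k x))\<^sup>2) < 4 * \<alpha> * (\<Sum>k\<in>K. ((x - c) \<bullet> e k x)\<^sup>2)"
      using upper[OF xin] by simp
    then have "\<alpha> * (2 * (\<Sum>k\<in>K. (norm (e k x))\<^sup>2)) < \<alpha> * (4 * \<alpha> * (\<Sum>k\<in>K. ((x - c) \<bullet> e k x)\<^sup>2))"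
      using \<alpha> by simp
    then show ?thesis by (simp add: sum_subtractf sum_distrib_left power2_eq_square mult_ac)
  qed
  define v where "v = (\<lambda>x. exp (- \<alpha> * (norm (x - c))\<^sup>2))"
  have vz: "v z = exp (- \<alpha> * r\<^sup>2)" using cz by (simp add: v_def dist_norm norm_minus_commute)
  define T where "T = sphere z \<delta> \<inter> cball c r"
  have "\<exists>\<eta>>0. \<forall>x\<in>T. \<psi> x \<le> M - \<eta>"
  proof (cases "T = {}")
    case False
    have "compact T" unfolding T_def by (intro compact_Int_closed) auto
    moreover have "T \<subseteq> ball x0 R" using cbz by (auto simp: T_def)
    then have "continuous_on T \<psi>" using cont continuous_on_subset by blast
    ultimately obtain t where t: "t \<in> T" "\<And>x. x \<in> T \<Longrightarrow> \<psi> x \<le> \<psi> t"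
      using continuous_attains_sup[of T \<psi>] False by blast
    have "t \<noteq> z" using t(1) \<delta>(1) by (auto simp: T_def)
    then have "\<psi> t < M" using t(1) touch by (auto simp: T_def)
    then show ?thesis using t(2) by (intro exI[of _ "M - \<psi> t"]) auto
  qed (auto intro: exI[of _ 1])
  then obtain \<eta> where \<eta>: "\<eta> > 0" "\<And>x. x \<in> T \<Longrightarrow> \<psi> x \<le> M - \<eta>" by blast
  have v1: "v x \<le> 1" for x using \<alpha> by (simp add: v_def)
  define \<epsilon> where "\<epsilon> = \<eta> / 2"
  have \<epsilon>: "\<epsilon> > 0" using \<eta> by (simp add: \<epsilon>_def)
  define w where "w = (\<lambda>x. \<psi> x + \<epsilon> * v x)"
  \<comment> \<open>inside the touching ball \<open>\<psi>\<close> is smaller by \<open>\<eta>\<close>, outside of it \<open>v\<close> is smaller than at \<open>z\<close>\<close>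
  have bd: "w x < w z" if x: "x \<in> sphere z \<delta>" for x
  proof (cases "x \<in> cball c r")
    case True
    then have "\<psi> x \<le> M - \<eta>" using x \<eta> by (auto simp: T_def)
    moreover have "\<epsilon> * v x \<le> \<epsilon> * 1" using \<epsilon> v1 by (intro mult_left_mono) auto
    moreover have "\<epsilon> * v z > 0" using \<epsilon> by (simp add: v_def)
    moreover have "\<epsilon> < \<eta>" using \<eta>(1) by (simp add: \<epsilon>_def)
    ultimately show ?thesis using zM \<eta>(1) unfolding w_def by linarith
  next
    case False
    then have "r < norm (x - c)" by (simp add: dist_norm norm_minus_commute)
    then have "r\<^sup>2 < (norm (x - c))\<^sup>2" using r by (intro power_strict_mono) auto
    then have "v x < v z" unfolding vz using \<alpha> by (simp add: v_def)
    moreover have "\<psi> x \<le> M" using le cbz x by force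
    ultimately show ?thesis using zM \<epsilon> by (simp add: w_def add_le_less_mono)
  qed
  have "continuous_on (cball z \<delta>) w"
    unfolding w_def v_def using continuous_on_subset[OF cont cbz] by (intro continuous_intros)
  then obtain p where p: "p \<in> cball z \<delta>" "\<And>x. x \<in> cball z \<delta> \<Longrightarrow> w x \<le> w p"
    using continuous_attains_sup[of "cball z \<delta>" w] \<delta>(1) by force
  have "w z \<le> w p" using p \<delta> by simp
  then have "p \<in> ball z \<delta>" using p(1) bd[of p] by (force simp: dist_commute)
  have pin: "p \<in> ball x0 R" using p(1) cbz by blast
  from sub[OF this] obtain d where d: "\<And>k. k \<in> K \<Longrightarrow> has_second_deriv_0 (\<lambda>t. \<psi> (p + t *\<^sub>R e k p)) (d k)"
    "0 \<le> (\<Sum>k\<in>K. d k)" by blast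
  define q where "q = (\<lambda>k. v p * (4 * \<alpha>\<^sup>2 * ((p - c) \<bullet> e k p)\<^sup>2 - 2 * \<alpha> * (norm (e k p))\<^sup>2))"
  have "d k + \<epsilon> * q k \<le> 0" if k: "k \<in> K" for k
  proof (rule has_second_deriv_0_local_max)
    show "has_second_deriv_0 (\<lambda>t. w (p + t *\<^sub>R e k p)) (d k + \<epsilon> * q k)"
      unfolding w_def q_def v_def
      by (intro has_second_deriv_0_add d(1)[OF k] has_second_deriv_0_cmult has_second_deriv_0_gaussian)
    have "((\<lambda>t. p + t *\<^sub>R e k p) \<longlongrightarrow> p + 0 *\<^sub>R e k p) (nhds 0)"
      by (intro tendsto_intros filterlim_ident)
    then have "\<forall>\<^sub>F t in nhds 0. p + t *\<^sub>R e k p \<in> ball z \<delta>"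
      using \<open>p \<in> ball z \<delta>\<close> topological_tendstoD by fastforce
    then show "\<forall>\<^sub>F t in nhds 0. w (p + t *\<^sub>R e k p) \<le> w (p + 0 *\<^sub>R e k p)"
      by eventually_elim (use p(2) in auto)
  qed
  then have "(\<Sum>k\<in>K. d k + \<epsilon> * q k) \<le> 0" by (intro sum_nonpos)
  then have "\<epsilon> * (\<Sum>k\<in>K. q k) \<le> 0" using d(2) by (simp add: sum.distrib sum_distrib_left)
  moreover have "(\<Sum>k\<in>K. q k) > 0"
    using strict[OF p(1)] by (simp add: q_def sum_distrib_left[symmetric] v_def)
  ultimately show False using \<epsilon> by (simp add: mult_le_0_iff)
qed

section \<open>Matrices\<close>

lemma matrix_scaleR_left: "(r *\<^sub>R A) ** B = r *\<^sub>R (A ** (B :: complex ^ 'k ^ 'n))"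
  by (simp add: vec_eq_iff matrix_matrix_mult_def scaleR_sum_right)

lemma matrix_scaleR_right: "A ** (r *\<^sub>R B) = r *\<^sub>R (A ** (B :: complex ^ 'k ^ 'n))"
  by (simp add: vec_eq_iff matrix_matrix_mult_def scaleR_sum_right)

lemma bounded_bilinear_matrix_matrix_mult:
  "bounded_bilinear ((**) :: complex ^ 'n ^ 'm \<Rightarrow> complex ^ 'k ^ 'n \<Rightarrow> complex ^ 'k ^ 'm)"
  unfolding bilinear_conv_bounded_bilinear[symmetric] bilinear_def
  by (auto intro!: linearI simp: matrix_add_ldistrib matrix_scaleR_left matrix_scaleR_right)
    (simp_all add: vec_eq_iff matrix_matrix_mult_def sum.distrib algebra_simps)

lemma bounded_bilinear_matrix_vector_mult:
  "bounded_bilinear ((*v) :: complex ^ 'n ^ 'm \<Rightarrow> complex ^ 'n \<Rightarrow> complex ^ 'm)"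
  unfolding bilinear_conv_bounded_bilinear[symmetric] bilinear_def
  by (auto intro!: linearI simp: vec_eq_iff matrix_vector_mult_def sum.distrib scaleR_sum_right algebra_simps)

lemma matrix_vector_mult_complex_scalar [simp]:
  "(A :: complex ^ 'n ^ 'm) *v (\<zeta> *s v) = \<zeta> *s (A *v v)"
  by (simp add: vec_eq_iff matrix_vector_mult_def sum_distrib_left algebra_simps)

lemma complex_linear_eq_matrix:
  fixes f :: "complex ^ 'n \<Rightarrow> complex ^ 'm"
  assumes "linear f" "\<And>v. f (\<i> *s v) = \<i> *s f v"
  shows "f v = matrix f *v v"
proof -
  have "Vector_Spaces.linear (*s) (*s) f"
    by unfold_locales (use assms complex_linear_scalar[OF assms] in \<open>auto simp: linear_add algebra_simps\<close>)
  then show ?thesis by (simp add: matrix_works)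
qed

lemma linear_complex_matrix_vector_mult: "linear ((*v) (A :: complex ^ 'n ^ 'm))"
  by (rule linearI) (auto simp: vec_eq_iff matrix_vector_mult_def sum.distrib scaleR_sum_right algebra_simps)

definition cnj_matrix :: "complex ^ 'n ^ 'm \<Rightarrow> complex ^ 'n ^ 'm" where
  "cnj_matrix A = (\<chi> i j. cnj (A $ i $ j))"

lemma cnj_matrix_mult: "cnj_matrix (A ** B) = cnj_matrix A ** cnj_matrix B"
  by (simp add: cnj_matrix_def vec_eq_iff matrix_matrix_mult_def)

lemma cnj_matrix_mat_1 [simp]: "cnj_matrix (mat 1) = mat 1"
  by (simp add: cnj_matrix_def vec_eq_iff mat_def)

lemma cnj_matrix_cnj_matrix [simp]: "cnj_matrix (cnj_matrix A) = A"
  by (simp add: cnj_matrix_def vec_eq_iff)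

lemma bounded_linear_cnj_matrix: "bounded_linear cnj_matrix"
  unfolding linear_conv_bounded_linear[symmetric]
  by (rule linearI) (simp_all add: cnj_matrix_def vec_eq_iff)

lemma trace_mult_commute: "trace (A ** B) = trace (B ** (A :: complex ^ 'n ^ 'n))"
  by (rule trace_mul_sym)

text \<open>In the Leibniz formula, a permutation other than the identity moves at least two points, so
  its product vanishes to second order at the identity matrix.\<close>

lemma has_vector_derivative_det_at_identity:
  fixes G :: "real \<Rightarrow> complex ^ 'n ^ 'n"
  assumes G: "(G has_vector_derivative G') (at t within S)" and id: "G t = mat 1"
  shows "((\<lambda>s. det (G s)) has_vector_derivative trace G') (at t within S)"
proof -
  have ent: "((\<lambda>s. G s $ i $ j) has_derivative (\<lambda>h. h *\<^sub>R (G' $ i $ j))) (at t within S)" for i j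
  proof -
    have "bounded_linear (\<lambda>A :: complex ^ 'n ^ 'n. A $ i $ j)"
      using bounded_linear_compose[OF bounded_linear_vec_nth bounded_linear_vec_nth, of i j] by simp
    from bounded_linear.has_derivative[OF this G[unfolded has_vector_derivative_def]]
    show ?thesis by simp
  qed
  let ?P = "{p. p permutes (UNIV :: 'n set)}"
  define D where "D = (\<lambda>p h. of_int (sign p) * (\<Sum>i\<in>UNIV. (h *\<^sub>R (G' $ i $ p i)) * (\<Prod>j\<in>UNIV - {i}. G t $ j $ p j)))"
  have der: "((\<lambda>s. det (G s)) has_derivative (\<lambda>h. \<Sum>p\<in>?P. D p h)) (at t within S)"
    unfolding det_def D_def
    by (intro has_derivative_sum has_derivative_mult_right has_derivative_prod ent)
  have D0: "D p h = 0" if p: "p \<in> ?P" "p \<noteq> id" for p h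
  proof -
    obtain a where a: "p a \<noteq> a" using p by (metis eq_id_iff)
    have inj: "p x = p y \<longleftrightarrow> x = y" for x y using p(1) inj_eq[OF permutes_inj[of p UNIV]] by simp
    have "(\<Prod>j\<in>UNIV - {i}. G t $ j $ p j) = 0" for i
    proof -
      have "p (p a) \<noteq> p a" using a inj by simp
      with a obtain j where "j \<noteq> i" "p j \<noteq> j" by metis
      then have z: "G t $ j $ p j = 0" unfolding id by (simp add: mat_def)
      have "j \<in> UNIV - {i}" using \<open>j \<noteq> i\<close> by simp
      with z show ?thesis by (intro prod_zero bexI[of _ j]) simp_all
    qed
    then show ?thesis unfolding D_def by (simp only: mult_zero_right sum.neutral_const)
  qed
  have D1: "D id h = h *\<^sub>R trace G'" for h
    by (simp add: D_def id mat_def trace_def scaleR_sum_right)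
  have "(\<Sum>p\<in>?P. D p h) = h *\<^sub>R trace G'" for h
  proof -
    have "(\<Sum>p\<in>?P. D p h) = (\<Sum>p\<in>{id}. D p h)"
      by (rule sum.mono_neutral_right) (auto simp: D0 permutes_id finite_permutations)
    then show ?thesis using D1 by simp
  qed
  then show ?thesis using der unfolding has_vector_derivative_def by simp
qed

section \<open>Linear ordinary differential equations\<close>

lemma continuous_on_linear_family:
  fixes L :: "'t::topological_space \<Rightarrow> 'a::euclidean_space \<Rightarrow> 'b::real_normed_vector"
  assumes "\<And>t. t \<in> S \<Longrightarrow> linear (L t)" "\<And>v. continuous_on S (\<lambda>t. L t v)" "continuous_on S f"
  shows "continuous_on S (\<lambda>t. L t (f t))"
proof -
  have "L t (f t) = (\<Sum>b\<in>Basis. (f t \<bullet> b) *\<^sub>R L t b)" if "t \<in> S" for t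
  proof -
    have "L t (\<Sum>b\<in>Basis. (f t \<bullet> b) *\<^sub>R b) = (\<Sum>b\<in>Basis. (f t \<bullet> b) *\<^sub>R L t b)"
      using assms(1)[OF that] by (simp add: linear_sum linear_scale)
    then show ?thesis by (simp add: euclidean_representation)
  qed
  moreover have "continuous_on S (\<lambda>t. \<Sum>b\<in>Basis. (f t \<bullet> b) *\<^sub>R L t b)"
    by (intro continuous_intros assms)
  ultimately show ?thesis by (simp cong: continuous_on_cong)
qed

text \<open>Picard's theorem for a linear equation with small coefficients, where the integral operator is
  already a contraction on the whole unit interval.  Functions on the line are made constant
  outside of it.\<close>

lemma linear_ode_exists:
  fixes L :: "real \<Rightarrow> 'a::euclidean_space \<Rightarrow> 'a"
  assumes lin: "\<And>t. t \<in> {0..1} \<Longrightarrow> linear (L t)"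
    and cont: "\<And>v. continuous_on {0..1} (\<lambda>t. L t v)"
    and bound: "\<And>t v. t \<in> {0..1} \<Longrightarrow> norm (L t v) \<le> \<kappa> * norm v"
    and \<kappa>: "0 \<le> \<kappa>" "\<kappa> \<le> 1 / 2"
  shows "\<exists>X. X 0 = v0 \<and> (\<forall>t\<in>{0..1}. (X has_vector_derivative L t (X t)) (at t within {0..1}) \<and>
            norm (X t - v0) \<le> 2 * \<kappa> * norm v0)"
proof -
  define c where "c = (\<lambda>t :: real. max 0 (min 1 t))"
  have c: "c t \<in> {0..1}" for t by (auto simp: c_def)
  have ccont: "continuous_on UNIV c" unfolding c_def by (intro continuous_intros)
  have Lcont: "continuous_on {0..1} (\<lambda>s. L s (f s))" if "continuous_on {0..1} f" for f
    by (rule continuous_on_linear_family[OF lin cont that])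
  have Lint: "(\<lambda>s. L s (f s)) integrable_on {0..u}" if "continuous_on {0..1} f" "u \<in> {0..1}" for f u
    by (rule integrable_continuous_interval, rule continuous_on_subset[OF Lcont[OF that(1)]]) (use that in auto)
  have fcont: "continuous_on {0..1} (apply_bcontfun f)" for f :: "real \<Rightarrow>\<^sub>C 'a"
    using apply_bcontfun[of f] by (auto simp: bcontfun_def intro: continuous_on_subset)
  define I where "I = (\<lambda>f :: real \<Rightarrow> 'a. \<lambda>t. v0 + integral {0..c t} (\<lambda>s. L s (f s)))"
  have Ibc: "I f \<in> bcontfun" if f: "continuous_on {0..1} f" for f
  proof -
    have i: "continuous_on {0..1} (\<lambda>u. v0 + integral {0..u} (\<lambda>s. L s (f s)))"
      by (intro continuous_intros indefinite_integral_continuous_1 Lint f) auto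
    have "continuous_on UNIV ((\<lambda>u. v0 + integral {0..u} (\<lambda>s. L s (f s))) \<circ> c)"
      by (rule continuous_on_compose[OF ccont continuous_on_subset[OF i]]) (use c in auto)
    then have cI: "continuous_on UNIV (I f)" by (simp add: I_def o_def)
    have "bounded ((\<lambda>u. v0 + integral {0..u} (\<lambda>s. L s (f s))) ` {0..1})"
      using compact_continuous_image[OF i] compact_imp_bounded by blast
    then have "bounded (range (I f))"
      by (rule bounded_subset) (use c in \<open>auto simp: I_def\<close>)
    then show ?thesis using cI by (simp add: bcontfun_def)
  qed
  define T where "T = (\<lambda>f. Bcontfun (I (apply_bcontfun f)))"
  have T: "apply_bcontfun (T f) = I (apply_bcontfun f)" for f
    unfolding T_def by (rule Bcontfun_inverse[OF Ibc[OF fcont]])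
  have intb: "norm (integral {0..c t} (\<lambda>s. L s (f s))) \<le> \<kappa> * B"
    if f: "continuous_on {0..1} f" and B: "\<And>s. norm (f s) \<le> B" for f B t
  proof -
    have B0: "0 \<le> B" using B norm_ge_zero order_trans by blast
    have "norm (integral {0..c t} (\<lambda>s. L s (f s))) \<le> (\<kappa> * B) * (c t - 0)"
    proof (rule integral_bound)
      show "continuous_on {0..c t} (\<lambda>s. L s (f s))"
        by (rule continuous_on_subset[OF Lcont[OF f]]) (use c[of t] in auto)
      show "norm (L s (f s)) \<le> \<kappa> * B" if "s \<in> {0..c t}" for s
      proof -
        have "norm (L s (f s)) \<le> \<kappa> * norm (f s)" using that c[of t] by (intro bound) auto
        also have "\<dots> \<le> \<kappa> * B" using \<kappa> B by (intro mult_left_mono) auto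
        finally show ?thesis .
      qed
    qed (use c[of t] in auto)
    also have "\<dots> \<le> (\<kappa> * B) * 1" using c[of t] \<kappa> B0 by (intro mult_left_mono) auto
    finally show ?thesis by simp
  qed
  have contr: "dist (T f) (T g) \<le> 1/2 * dist f g" for f g
  proof (rule dist_bound)
    fix t
    have eq: "apply_bcontfun (T f) t - apply_bcontfun (T g) t = integral {0..c t} (\<lambda>s. L s (apply_bcontfun f s - apply_bcontfun g s))"
    proof -
      have "integral {0..c t} (\<lambda>s. L s (apply_bcontfun f s - apply_bcontfun g s))
          = integral {0..c t} (\<lambda>s. L s (apply_bcontfun f s) - L s (apply_bcontfun g s))"
        using c[of t] lin by (intro integral_cong) (auto simp: linear_diff)
      also have "\<dots> = integral {0..c t} (\<lambda>s. L s (apply_bcontfun f s)) - integral {0..c t} (\<lambda>s. L s (apply_bcontfun g s))"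
        by (intro integral_diff Lint fcont c)
      finally show ?thesis by (simp add: T I_def)
    qed
    have "norm (integral {0..c t} (\<lambda>s. L s (apply_bcontfun f s - apply_bcontfun g s))) \<le> \<kappa> * dist f g"
      by (intro intb continuous_intros fcont) (auto simp: dist_norm[symmetric] dist_bounded)
    also have "\<dots> \<le> 1/2 * dist f g" using \<kappa> by (intro mult_right_mono) auto
    finally show "dist (apply_bcontfun (T f) t) (apply_bcontfun (T g) t) \<le> 1/2 * dist f g"
      using eq by (simp add: dist_norm)
  qed
  have "\<exists>!f. T f = f"
    by (rule banach_fix_type[of "1/2"]) (use contr in auto)
  then obtain f where Tf: "T f = f" by auto
  define X where "X = apply_bcontfun f"
  have XI: "X = I X" using T[of f] unfolding Tf X_def by simp
  have Xc: "continuous_on {0..1} X" unfolding X_def by (rule fcont)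
  have Xle: "norm (X s) \<le> norm f" for s unfolding X_def by (rule norm_bounded)
  have diff: "norm (X t - v0) \<le> \<kappa> * norm f" for t
    using intb[OF Xc Xle, of t] by (subst XI) (simp add: I_def)
  have "norm f \<le> norm v0 + 1/2 * norm f"
  proof (rule norm_bound)
    fix t
    have "norm (X t) \<le> norm v0 + norm (X t - v0)" using norm_triangle_sub[of "X t" v0] by simp
    also have "\<dots> \<le> norm v0 + \<kappa> * norm f" using diff by simp
    also have "\<dots> \<le> norm v0 + 1/2 * norm f" using \<kappa> mult_right_mono[of \<kappa> "1/2" "norm f"] by simp
    finally show "norm (apply_bcontfun f t) \<le> norm v0 + 1/2 * norm f" by (simp add: X_def)
  qed
  then have nf: "norm f \<le> 2 * norm v0" by simp
  have "norm (X t - v0) \<le> 2 * \<kappa> * norm v0" for t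
    using diff[of t] mult_left_mono[OF nf \<kappa>(1)] by simp
  moreover have "X 0 = v0" by (subst XI) (simp add: I_def c_def)
  moreover have "(X has_vector_derivative L t (X t)) (at t within {0..1})" if t: "t \<in> {0..1}" for t
  proof -
    have "((\<lambda>u. v0 + integral {0..u} (\<lambda>s. L s (X s))) has_vector_derivative (0 + L t (X t))) (at t within {0..1})"
      by (intro has_vector_derivative_add integral_has_vector_derivative Lcont Xc t) (auto intro!: derivative_eq_intros)
    then have "((\<lambda>u. v0 + integral {0..u} (\<lambda>s. L s (X s))) has_vector_derivative L t (X t)) (at t within {0..1})"
      by simp
    then show ?thesis
    proof (rule has_vector_derivative_transform[OF t, rotated])
      show "X u = v0 + integral {0..u} (\<lambda>s. L s (X s))" if "u \<in> {0..1}" for u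
        using that by (subst XI) (simp add: I_def c_def)
    qed
  qed
  ultimately show ?thesis by blast
qed

text \<open>A fundamental matrix together with its inverse, which solves the dual equation.\<close>

definition fundamental_pair :: "(real \<Rightarrow> complex ^ 'n ^ 'n) \<Rightarrow> (real \<Rightarrow> complex ^ 'n ^ 'n)
    \<Rightarrow> (real \<Rightarrow> complex ^ 'n ^ 'n) \<Rightarrow> bool" where
  "fundamental_pair A X Y \<longleftrightarrow> X 0 = mat 1 \<and> Y 0 = mat 1 \<and>
     (\<forall>t\<in>{0..1}. (X has_vector_derivative - (A t ** X t)) (at t within {0..1}) \<and>
                 (Y has_vector_derivative Y t ** A t) (at t within {0..1}) \<and>
                 X t ** Y t = mat 1 \<and> Y t ** X t = mat 1)"

lemma matrix_minus_left: "(- A) ** B = - (A ** (B :: complex ^ 'k ^ 'n))"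
  by (simp add: vec_eq_iff matrix_matrix_mult_def sum_negf)

lemma matrix_minus_right: "A ** (- B) = - (A ** (B :: complex ^ 'k ^ 'n))"
  by (simp add: vec_eq_iff matrix_matrix_mult_def sum_negf)

lemma fundamental_pair_exists:
  obtains \<epsilon> C :: real where "\<epsilon> > 0" "C > 0"
    "\<And>(A :: real \<Rightarrow> complex ^ 'n ^ 'n) b. continuous_on {0..1} A \<Longrightarrow> (\<And>t. t \<in> {0..1} \<Longrightarrow> norm (A t) \<le> b) \<Longrightarrow>
       b \<le> \<epsilon> \<Longrightarrow> \<exists>X Y. fundamental_pair A X Y \<and>
         (\<forall>t\<in>{0..1}. norm (X t - mat 1) \<le> C * b \<and> norm (Y t - mat 1) \<le> C * b)"
proof -
  let ?m = "(**) :: complex ^ 'n ^ 'n \<Rightarrow> complex ^ 'n ^ 'n \<Rightarrow> complex ^ 'n ^ 'n"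
  interpret bounded_bilinear ?m by (rule bounded_bilinear_matrix_matrix_mult)
  obtain K where K: "K > 0" "\<And>A B. norm (?m A B) \<le> norm A * norm B * K"
    using pos_bounded by blast
  define \<epsilon> where "\<epsilon> = 1 / (2 * K)"
  define C where "C = 2 * K * (norm (mat 1 :: complex ^ 'n ^ 'n) + 1)"
  have C: "C > 0" using K by (simp add: C_def add_nonneg_pos)
  show ?thesis
  proof (rule that[of \<epsilon> C])
    show "\<epsilon> > 0" using K by (simp add: \<epsilon>_def)
    show "C > 0" by fact
    fix A :: "real \<Rightarrow> complex ^ 'n ^ 'n" and b
    assume A: "continuous_on {0..1} A" and b: "\<And>t. t \<in> {0..1} \<Longrightarrow> norm (A t) \<le> b" and be: "b \<le> \<epsilon>"
    have b0: "0 \<le> b" using order_trans[OF norm_ge_zero b[of 0]] by simp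
    define \<kappa> where "\<kappa> = b * K"
    have \<kappa>: "0 \<le> \<kappa>" "\<kappa> \<le> 1/2" using b0 be K by (auto simp: \<kappa>_def \<epsilon>_def field_simps)
    have Cb: "2 * \<kappa> * norm (mat 1 :: complex ^ 'n ^ 'n) \<le> C * b"
      using b0 K by (simp add: C_def \<kappa>_def algebra_simps)
    have "\<exists>X. X 0 = mat 1 \<and> (\<forall>t\<in>{0..1}. (X has_vector_derivative - ?m (A t) (X t)) (at t within {0..1}) \<and>
            norm (X t - mat 1) \<le> 2 * \<kappa> * norm (mat 1 :: complex ^ 'n ^ 'n))"
    proof (rule linear_ode_exists[OF _ _ _ \<kappa>])
      show "linear (\<lambda>X. - ?m (A t) X)" for t
        by (rule linearI) (simp_all add: add_right scaleR_right)
      show "continuous_on {0..1} (\<lambda>t. - ?m (A t) X)" for X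
        by (intro continuous_intros continuous_on A)
      show "norm (- ?m (A t) X) \<le> \<kappa> * norm X" if "t \<in> {0..1}" for t X
      proof -
        have "norm (?m (A t) X) \<le> norm (A t) * norm X * K" by (rule K)
        also have "\<dots> \<le> b * norm X * K" using b[OF that] K by (intro mult_right_mono) auto
        finally show ?thesis by (simp add: \<kappa>_def mult_ac)
      qed
    qed
    then obtain X where X: "X 0 = mat 1" "\<And>t. t \<in> {0..1} \<Longrightarrow> (X has_vector_derivative - ?m (A t) (X t)) (at t within {0..1})"
      "\<And>t. t \<in> {0..1} \<Longrightarrow> norm (X t - mat 1) \<le> 2 * \<kappa> * norm (mat 1 :: complex ^ 'n ^ 'n)" by blast
    have "\<exists>Y. Y 0 = mat 1 \<and> (\<forall>t\<in>{0..1}. (Y has_vector_derivative ?m (Y t) (A t)) (at t within {0..1}) \<and>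
            norm (Y t - mat 1) \<le> 2 * \<kappa> * norm (mat 1 :: complex ^ 'n ^ 'n))"
    proof (rule linear_ode_exists[OF _ _ _ \<kappa>])
      show "linear (\<lambda>Y. ?m Y (A t))" for t
        by (rule linearI) (simp_all add: add_left scaleR_left)
      show "continuous_on {0..1} (\<lambda>t. ?m Y (A t))" for Y
        by (intro continuous_intros continuous_on A)
      show "norm (?m Y (A t)) \<le> \<kappa> * norm Y" if "t \<in> {0..1}" for t Y
      proof -
        have "norm (?m Y (A t)) \<le> norm Y * norm (A t) * K" by (rule K)
        also have "\<dots> \<le> norm Y * b * K" using b[OF that] K by (intro mult_right_mono mult_left_mono) auto
        finally show ?thesis by (simp add: \<kappa>_def mult_ac)
      qed
    qed
    then obtain Y where Y: "Y 0 = mat 1" "\<And>t. t \<in> {0..1} \<Longrightarrow> (Y has_vector_derivative ?m (Y t) (A t)) (at t within {0..1})"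
      "\<And>t. t \<in> {0..1} \<Longrightarrow> norm (Y t - mat 1) \<le> 2 * \<kappa> * norm (mat 1 :: complex ^ 'n ^ 'n)" by blast
    have YX: "?m (Y t) (X t) = mat 1" if t: "t \<in> {0..1}" for t
    proof -
      have d: "((\<lambda>s. ?m (Y s) (X s)) has_vector_derivative 0) (at s within {0..1})" if "s \<in> {0..1}" for s
        using has_vector_derivative[OF Y(2)[OF that] X(2)[OF that]]
        by (simp add: matrix_minus_right matrix_mul_assoc)
      obtain k where k: "\<And>s. s \<in> {0..1} \<Longrightarrow> ?m (Y s) (X s) = k"
        using has_vector_derivative_zero_constant[of "{0..1}" "\<lambda>s. ?m (Y s) (X s)"] d by auto
      show ?thesis using k[OF t] k[of 0] X(1) Y(1) by (simp add: matrix_mul_lid)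
    qed
    then have XY: "?m (X t) (Y t) = mat 1" if "t \<in> {0..1}" for t
      using that matrix_left_right_inverse by blast
    show "\<exists>X Y. fundamental_pair A X Y \<and>
         (\<forall>t\<in>{0..1}. norm (X t - mat 1) \<le> C * b \<and> norm (Y t - mat 1) \<le> C * b)"
      unfolding fundamental_pair_def
      by (rule exI[of _ X], rule exI[of _ Y])
        (use X(1,2) Y(1,2) XY YX order_trans[OF X(3) Cb] order_trans[OF Y(3) Cb] in auto)
  qed
qed

section \<open>Charts and transition functions\<close>

lemma has_derivative_vec_components:
  fixes f :: "'a::real_normed_vector \<Rightarrow> complex ^ 'n"
  assumes "\<And>k. ((\<lambda>x. f x $ k) has_derivative (\<lambda>h. F h $ k)) (at x within S)"
  shows "(f has_derivative F) (at x within S)"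
proof (subst has_derivative_componentwise_within, rule ballI)
  fix b :: "complex ^ 'n" assume "b \<in> Basis"
  then obtain k a where b: "b = axis k a" by (auto simp: Basis_vec_def)
  have "((\<lambda>x. f x $ k \<bullet> a) has_derivative (\<lambda>h. F h $ k \<bullet> a)) (at x within S)"
    using assms by (rule has_derivative_inner_left)
  then show "((\<lambda>x. f x \<bullet> b) has_derivative (\<lambda>h. F h \<bullet> b)) (at x within S)"
    by (simp add: b inner_axis)
qed

text \<open>The product rule for a family of linear maps.  In the sum \<open>L s (f t) + L s (f s - f t)\<close> the second
  summand is a product with a factor that vanishes at \<open>s = t\<close>, so that \<open>L\<close> has to be
  differentiated at the single vector \<open>f t\<close>.\<close>

lemma has_vector_derivative_linear_family:
  fixes f :: "real \<Rightarrow> 'a::euclidean_space" and L :: "real \<Rightarrow> 'a \<Rightarrow> 'b::real_normed_vector"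
  assumes t: "t \<in> S" and lin: "\<And>s. s \<in> S \<Longrightarrow> linear (L s)"
    and der: "\<And>v. \<exists>l. ((\<lambda>s. L s v) has_vector_derivative l) (at t within S)"
    and l: "((\<lambda>s. L s (f t)) has_vector_derivative l) (at t within S)"
    and f: "(f has_vector_derivative f') (at t within S)"
  shows "((\<lambda>s. L s (f s)) has_vector_derivative l + L t f') (at t within S)"
proof -
  obtain l' where l': "\<And>v. ((\<lambda>s. L s v) has_vector_derivative l' v) (at t within S)"
    using der by metis
  have exp: "L s w = (\<Sum>b\<in>Basis. (w \<bullet> b) *\<^sub>R L s b)" if "s \<in> S" for s w
  proof -
    have "L s (\<Sum>b\<in>Basis. (w \<bullet> b) *\<^sub>R b) = (\<Sum>b\<in>Basis. (w \<bullet> b) *\<^sub>R L s b)"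
      using lin[OF that] by (simp add: linear_sum linear_scale)
    then show ?thesis by (simp add: euclidean_representation)
  qed
  have ip: "((\<lambda>s. (f s - f t) \<bullet> b) has_vector_derivative (f' \<bullet> b)) (at t within S)" for b
  proof -
    have "((\<lambda>s. f s - f t) has_vector_derivative (f' - 0)) (at t within S)"
      by (intro has_vector_derivative_diff f has_vector_derivative_const)
    from bounded_linear.has_vector_derivative[OF bounded_linear_inner_left[of b] this]
    show ?thesis by simp
  qed
  have "((\<lambda>s. ((f s - f t) \<bullet> b) *\<^sub>R L s b) has_vector_derivative (((f t - f t) \<bullet> b) *\<^sub>R l' b + (f' \<bullet> b) *\<^sub>R L t b)) (at t within S)" for b
    by (rule bounded_bilinear.has_vector_derivative[OF bounded_bilinear_scaleR ip l'])
  then have "((\<lambda>s. \<Sum>b\<in>Basis. ((f s - f t) \<bullet> b) *\<^sub>R L s b) has_vector_derivative (\<Sum>b\<in>Basis. (f' \<bullet> b) *\<^sub>R L t b)) (at t within S)"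
    by (intro has_vector_derivative_sum) simp
  then have "((\<lambda>s. L s (f t) + (\<Sum>b\<in>Basis. ((f s - f t) \<bullet> b) *\<^sub>R L s b)) has_vector_derivative l + L t f') (at t within S)"
    using has_vector_derivative_add[OF l] exp[OF t, of f'] by simp
  then show ?thesis
  proof (rule has_vector_derivative_transform[OF t, rotated])
    show "L s (f s) = L s (f t) + (\<Sum>b\<in>Basis. ((f s - f t) \<bullet> b) *\<^sub>R L s b)" if "s \<in> S" for s
      using exp[OF that, of "f s - f t"] linear_diff[OF lin[OF that], of "f s" "f t"]
      by (metis add.commute diff_add_cancel)
  qed
qed

definition point :: "('p, 'n::finite) chart \<Rightarrow> complex ^ 'n \<Rightarrow> 'p" where
  "point c x = inv_into (fst c) (snd c) x"

definition jacobian :: "('p, 'n::finite) chart \<Rightarrow> ('p, 'n) chart \<Rightarrow> complex ^ 'n \<Rightarrow> complex ^ 'n ^ 'n" where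
  "jacobian c d x = matrix (dtrans c d x)"

locale complex_manifold =
  fixes A :: "('p::t2_space, 'n::finite) chart set"
  assumes atlas: "complex_atlas A"
begin

lemma open_dom: "c \<in> A \<Longrightarrow> open (chart_dom c)"
  and open_img: "c \<in> A \<Longrightarrow> open (chart_img c)"
  and homeo: "c \<in> A \<Longrightarrow> homeomorphism (chart_dom c) (chart_img c) (snd c) (point c)"
  and charts_cover: "\<exists>c\<in>A. q \<in> chart_dom c"
  using atlas unfolding complex_atlas_def point_def[abs_def] by auto

lemma point_snd [simp]: "c \<in> A \<Longrightarrow> q \<in> chart_dom c \<Longrightarrow> point c (snd c q) = q"
  and snd_point [simp]: "c \<in> A \<Longrightarrow> x \<in> chart_img c \<Longrightarrow> snd c (point c x) = x"
  and point_in [simp]: "c \<in> A \<Longrightarrow> x \<in> chart_img c \<Longrightarrow> point c x \<in> chart_dom c"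
  using homeo[of c] unfolding homeomorphism_def by auto

lemma transition_eq: "transition c d x = snd d (point c x)"
  by (simp add: transition_def point_def)

lemma overlap_iff: "c \<in> A \<Longrightarrow> x \<in> overlap c d \<longleftrightarrow> x \<in> chart_img c \<and> point c x \<in> chart_dom d"
  unfolding overlap_def by auto

lemma overlap_self: "c \<in> A \<Longrightarrow> overlap c c = chart_img c"
  by (simp add: overlap_def)

lemma open_overlap: "c \<in> A \<Longrightarrow> d \<in> A \<Longrightarrow> open (overlap c d)"
proof -
  assume cd: "c \<in> A" "d \<in> A"
  have "continuous_on (chart_img c) (point c)" using homeo[OF cd(1)] by (simp add: homeomorphism_def)
  then have "open (chart_img c \<inter> point c -` chart_dom d)"
    using open_img[OF cd(1)] open_dom[OF cd(2)] continuous_openin_preimage_gen openin_open_eq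
    by (metis continuous_on_open_vimage inf_commute)
  moreover have "overlap c d = chart_img c \<inter> point c -` chart_dom d"
    using overlap_iff[OF cd(1), of _ d] by blast
  ultimately show ?thesis by simp
qed

lemma transition_in: "c \<in> A \<Longrightarrow> d \<in> A \<Longrightarrow> x \<in> overlap c d \<Longrightarrow> transition c d x \<in> overlap d c"
  and point_transition: "c \<in> A \<Longrightarrow> d \<in> A \<Longrightarrow> x \<in> overlap c d \<Longrightarrow> point d (transition c d x) = point c x"
  by (auto simp: transition_eq overlap_iff)

lemma overlap_subset: "c \<in> A \<Longrightarrow> x \<in> overlap c d \<Longrightarrow> x \<in> chart_img c"
  by (simp add: overlap_iff)

lemma transition_self: "c \<in> A \<Longrightarrow> x \<in> chart_img c \<Longrightarrow> transition c c x = x"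
  by (simp add: transition_eq)

lemma transition_transition:
  "c \<in> A \<Longrightarrow> d \<in> A \<Longrightarrow> x \<in> overlap c d \<Longrightarrow> transition d e (transition c d x) = transition c e x"
  by (simp add: transition_eq overlap_iff)

lemma transition_overlap:
  "c \<in> A \<Longrightarrow> d \<in> A \<Longrightarrow> x \<in> overlap c d \<Longrightarrow> x \<in> overlap c e \<Longrightarrow> transition c d x \<in> overlap d e"
  by (auto simp: overlap_iff transition_eq)

lemma holomorphic_transition: "c \<in> A \<Longrightarrow> d \<in> A \<Longrightarrow> holomorphic_fun (overlap c d) (\<lambda>x. transition c d x $ k)"
  using atlas unfolding complex_atlas_def holomorphic_map_def by blast

lemma
  assumes c: "c \<in> A" "d \<in> A" "x \<in> overlap c d"
  shows transition_has_derivative: "(transition c d has_derivative dtrans c d x) (at x)"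
    and dtrans_complex: "dtrans c d x (\<zeta> *s v) = \<zeta> *s dtrans c d x v"
    and dtrans_component: "dtrans c d x v $ k = frechet_derivative (\<lambda>y. transition c d y $ k) (at x) v"
proof -
  let ?F = "\<lambda>v. \<chi> k. frechet_derivative (\<lambda>y. transition c d y $ k) (at x) v"
  have F: "(transition c d has_derivative ?F) (at x)"
    by (rule has_derivative_vec_components)
      (simp add: holomorphic_fun_has_derivative(1)[OF holomorphic_transition[OF c(1,2)] c(3)])
  then have eq: "dtrans c d x = ?F" unfolding dtrans_def using frechet_derivative_at by metis
  show "(transition c d has_derivative dtrans c d x) (at x)" using F eq by simp
  show "dtrans c d x (\<zeta> *s v) = \<zeta> *s dtrans c d x v"
    unfolding eq using holomorphic_fun_has_derivative(2)[OF holomorphic_transition[OF c(1,2)] c(3)]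
    by (simp add: vec_eq_iff)
  show "dtrans c d x v $ k = frechet_derivative (\<lambda>y. transition c d y $ k) (at x) v"
    by (simp add: eq)
qed

lemma linear_dtrans: "c \<in> A \<Longrightarrow> d \<in> A \<Longrightarrow> x \<in> overlap c d \<Longrightarrow> linear (dtrans c d x)"
  using transition_has_derivative has_derivative_linear by blast

lemma dtrans_jacobian:
  "c \<in> A \<Longrightarrow> d \<in> A \<Longrightarrow> x \<in> overlap c d \<Longrightarrow> dtrans c d x v = jacobian c d x *v v"
  unfolding jacobian_def by (intro complex_linear_eq_matrix linear_dtrans dtrans_complex)

text \<open>The components of the differential are directional derivatives of holomorphic functions.  Hence
  they are differentiable, and the transformation law of the Christoffel symbols involves genuine
  second derivatives.\<close>

lemma d2trans_has_derivative:
  assumes c: "c \<in> A" "d \<in> A" "x \<in> overlap c d"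
  shows "((\<lambda>y. dtrans c d y v) has_derivative (\<lambda>u. d2trans c d x u v)) (at x)"
proof -
  let ?f = "\<lambda>k y. frechet_derivative (\<lambda>y. transition c d y $ k) (at y) v"
  have hol: "holomorphic_fun (overlap c d) (?f k)" for k
    by (intro holomorphic_fun_directional_derivative holomorphic_transition open_overlap c)
  have "((\<lambda>y. \<chi> k. ?f k y) has_derivative (\<lambda>u. \<chi> k. frechet_derivative (?f k) (at x) u)) (at x)"
    by (rule has_derivative_vec_components) (simp add: holomorphic_fun_has_derivative(1)[OF hol c(3)])
  then have "((\<lambda>y. dtrans c d y v) has_derivative (\<lambda>u. \<chi> k. frechet_derivative (?f k) (at x) u)) (at x)"
    by (rule has_derivative_transform_within_open[OF _ open_overlap[OF c(1,2)] c(3)])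
      (simp add: vec_eq_iff dtrans_component[OF c(1,2)])
  from this[unfolded frechet_derivative_at[OF this]] show ?thesis
    by (simp add: d2trans_def)
qed

lemma jacobian_chain:
  assumes c: "c \<in> A" "d \<in> A" "e \<in> A" and x: "x \<in> overlap c d" "x \<in> overlap c e"
  shows "jacobian d e (transition c d x) ** jacobian c d x = jacobian c e x"
proof -
  have "((\<lambda>y. transition d e (transition c d y)) has_derivative
      (\<lambda>v. dtrans d e (transition c d x) (dtrans c d x v))) (at x)"
    by (rule has_derivative_compose[OF transition_has_derivative transition_has_derivative])
      (use c x transition_overlap in auto)
  then have "(transition c e has_derivative (\<lambda>v. dtrans d e (transition c d x) (dtrans c d x v))) (at x)"
    by (rule has_derivative_transform_within_open[OF _ open_overlap[OF c(1,2)] x(1)])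
      (simp add: transition_transition[OF c(1,2)])
  then have "dtrans c e x = (\<lambda>v. dtrans d e (transition c d x) (dtrans c d x v))"
    unfolding dtrans_def using frechet_derivative_at by metis
  then have "jacobian c e x *v v = (jacobian d e (transition c d x) ** jacobian c d x) *v v" for v
    using dtrans_jacobian[OF c(1,3) x(2), of v]
      dtrans_jacobian[OF c(2,3) transition_overlap[OF c(1,2) x], of "dtrans c d x v"]
      dtrans_jacobian[OF c(1,2) x(1), of v]
    by (simp add: matrix_vector_mul_assoc)
  then show ?thesis by (simp add: matrix_eq)
qed

lemma jacobian_self:
  assumes "c \<in> A" "x \<in> chart_img c" shows "jacobian c c x = mat 1"
proof -
  have "((\<lambda>y. y) has_derivative (\<lambda>v. v)) (at x)" by (rule has_derivative_ident)
  then have "(transition c c has_derivative (\<lambda>v. v)) (at x)"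
    by (rule has_derivative_transform_within_open[OF _ open_img[OF assms(1)] assms(2)])
      (simp add: transition_self[OF assms(1)])
  then have "dtrans c c x = (\<lambda>v. v)" unfolding dtrans_def using frechet_derivative_at by metis
  then show ?thesis by (simp add: jacobian_def matrix_id_mat_1[unfolded id_def])
qed

lemma jacobian_inverse:
  assumes c: "c \<in> A" "d \<in> A" and x: "x \<in> overlap c d"
  shows "jacobian d c (transition c d x) ** jacobian c d x = mat 1"
    and "jacobian c d x ** jacobian d c (transition c d x) = mat 1"
proof -
  show *: "jacobian d c (transition c d x) ** jacobian c d x = mat 1"
    using jacobian_chain[OF c(1,2,1) x] c x overlap_subset[OF c(1) x]
    by (simp add: overlap_self jacobian_self)
  then show "jacobian c d x ** jacobian d c (transition c d x) = mat 1"
    using matrix_left_right_inverse by blast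
qed

end

text \<open>A holomorphic function on a complex line, restricted to the real line.\<close>

lemma higher_deriv_of_real_has_vector_derivative:
  assumes f: "f holomorphic_on U" and U: "open U" "of_real t \<in> U"
  shows "((\<lambda>s. (deriv ^^ k) f (of_real s)) has_vector_derivative (deriv ^^ Suc k) f (of_real t)) (at t within T)"
proof -
  have "((deriv ^^ k) f has_field_derivative (deriv ^^ Suc k) f (of_real t)) (at (of_real t))"
    using holomorphic_derivI[OF holomorphic_higher_deriv[OF f U(1)] U] by simp
  then show ?thesis by (rule has_vector_derivative_real_field)
qed

section \<open>Torsion-free complex connections\<close>

lemma trace_mat_mult: "trace (mat \<zeta> ** (M :: complex ^ 'n ^ 'n)) = \<zeta> * trace M"
  by (simp add: trace_def matrix_matrix_mult_def mat_def if_distrib if_distribR sum.delta sum_distrib_left cong: if_cong)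

lemma mat_mult_vec: "mat \<zeta> *v (v :: complex ^ 'n) = \<zeta> *s v"
  by (simp add: vec_eq_iff matrix_vector_mult_def mat_def if_distrib if_distribR sum.delta cong: if_cong)

lemma mat_mult_component: "(mat \<zeta> ** (M :: complex ^ 'k ^ 'n)) $ i $ j = \<zeta> * M $ i $ j"
  by (simp add: matrix_matrix_mult_def mat_def if_distrib if_distribR sum.delta cong: if_cong)

lemma linear_trace: "linear (trace :: complex ^ 'n ^ 'n \<Rightarrow> complex)"
  by (rule linearI) (simp_all add: trace_def sum.distrib scaleR_sum_right)

lemma bounded_linear_trace: "bounded_linear (trace :: complex ^ 'n ^ 'n \<Rightarrow> complex)"
  using linear_trace linear_conv_bounded_linear by blast

lemma has_vector_derivative_ln_cmod:
  assumes f: "(f has_vector_derivative f') (at t within S)" and t: "t \<in> S" "f t = 1"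
    and nz: "\<And>s. s \<in> S \<Longrightarrow> f s \<noteq> 0"
  shows "((\<lambda>s. ln (cmod (f s))) has_vector_derivative Re f') (at t within S)"
proof -
  have "(Ln has_field_derivative inverse (f t)) (at (f t) within f ` S)"
    by (rule has_field_derivative_at_within[OF has_field_derivative_Ln]) (simp add: t)
  from field_vector_diff_chain_within[OF f this]
  have "((\<lambda>s. Ln (f s)) has_vector_derivative f') (at t within S)" using t by (simp add: o_def)
  from bounded_linear.has_vector_derivative[OF bounded_linear_Re this]
  have "((\<lambda>s. Re (Ln (f s))) has_vector_derivative Re f') (at t within S)" .
  then show ?thesis
    by (rule has_vector_derivative_transform[OF t(1), rotated]) (simp add: Re_Ln nz)
qed

lemma right_derivative_rescale:
  fixes f :: "'a::real_normed_vector \<Rightarrow> 'b::real_normed_vector"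
  assumes f: "((\<lambda>t. f (x + t *\<^sub>R (s *\<^sub>R u))) has_vector_derivative s *\<^sub>R D) (at 0 within {0..1})"
    and s: "s > 0"
  shows "((\<lambda>t. f (x + t *\<^sub>R u)) has_vector_derivative D) (at 0 within {0..})"
proof -
  have m: "((\<lambda>t. t / s) has_vector_derivative (1 / s)) (at 0 within {0..s})"
    unfolding has_real_derivative_iff_has_vector_derivative[symmetric]
    using s by (auto intro!: derivative_eq_intros)
  have im: "(\<lambda>t. t / s) ` {0..s} \<subseteq> {0..1}" using s by auto
  have "((\<lambda>t. f (x + t *\<^sub>R (s *\<^sub>R u))) has_vector_derivative s *\<^sub>R D) (at (0 / s) within (\<lambda>t. t / s) ` {0..s})"
    using has_vector_derivative_within_subset[OF f im] by simp
  note chain = vector_diff_chain_within[OF m this]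
  have "(\<lambda>t. f (x + t *\<^sub>R (s *\<^sub>R u))) \<circ> (\<lambda>t. t / s) = (\<lambda>t. f (x + t *\<^sub>R u))" "(1 / s) *\<^sub>R s *\<^sub>R D = D"
    using s by (simp_all add: fun_eq_iff)
  with chain have "((\<lambda>t. f (x + t *\<^sub>R u)) has_vector_derivative D) (at 0 within {0..s})"
    by simp
  moreover have "at 0 within {0..s} = at 0 within {0..}"
    by (rule at_within_nhd[of _ "{..<s}"]) (use s in auto)
  ultimately show ?thesis by simp
qed

locale complex_connection = complex_manifold A
  for A :: "('p::t2_space, 'n::finite) chart set" +
  fixes \<Gamma> :: "('p, 'n) christoffel"
  assumes connection: "affine_connection A \<Gamma>"
    and torsion: "torsion_free A \<Gamma>"
    and parallel_I: "parallel_complex_structure A \<Gamma>"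
begin

definition chris :: "('p, 'n) chart \<Rightarrow> complex ^ 'n \<Rightarrow> complex ^ 'n \<Rightarrow> complex ^ 'n ^ 'n" where
  "chris c x u = matrix (\<Gamma> c x u)"

definition dchris :: "('p, 'n) chart \<Rightarrow> complex ^ 'n \<Rightarrow> complex ^ 'n \<Rightarrow> complex ^ 'n \<Rightarrow> complex ^ 'n ^ 'n" where
  "dchris c x w u = frechet_derivative (\<lambda>y. chris c y u) (at x) w"

definition curv :: "('p, 'n) chart \<Rightarrow> complex ^ 'n \<Rightarrow> complex ^ 'n \<Rightarrow> complex ^ 'n \<Rightarrow> complex ^ 'n ^ 'n" where
  "curv c x u v = dchris c x u v - dchris c x v u + chris c x u ** chris c x v - chris c x v ** chris c x u"

lemma bilinear_\<Gamma>: "c \<in> A \<Longrightarrow> x \<in> chart_img c \<Longrightarrow> bilinear (\<Gamma> c x)"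
  and smooth_\<Gamma>: "c \<in> A \<Longrightarrow> smooth_on (chart_img c) (\<lambda>x. \<Gamma> c x u v)"
  using connection unfolding affine_connection_def by auto

lemma \<Gamma>_transition:
  "c \<in> A \<Longrightarrow> d \<in> A \<Longrightarrow> x \<in> overlap c d \<Longrightarrow>
     \<Gamma> d (transition c d x) (dtrans c d x u) (dtrans c d x v) = dtrans c d x (\<Gamma> c x u v) - d2trans c d x u v"
  using connection unfolding affine_connection_def by auto

lemma \<Gamma>_sym: "c \<in> A \<Longrightarrow> x \<in> chart_img c \<Longrightarrow> \<Gamma> c x u v = \<Gamma> c x v u"
  using torsion unfolding torsion_free_def by auto

lemma \<Gamma>_i_right: "c \<in> A \<Longrightarrow> x \<in> chart_img c \<Longrightarrow> \<Gamma> c x u (\<i> *s v) = \<i> *s \<Gamma> c x u v"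
  using parallel_I unfolding parallel_complex_structure_def by auto

lemma \<Gamma>_i_left: "c \<in> A \<Longrightarrow> x \<in> chart_img c \<Longrightarrow> \<Gamma> c x (\<i> *s u) v = \<i> *s \<Gamma> c x u v"
  using \<Gamma>_i_right \<Gamma>_sym by metis

lemma \<Gamma>_chris: "c \<in> A \<Longrightarrow> x \<in> chart_img c \<Longrightarrow> \<Gamma> c x u v = chris c x u *v v"
  unfolding chris_def
  by (intro complex_linear_eq_matrix \<Gamma>_i_right) (auto dest!: bilinear_\<Gamma> simp: bilinear_def)

lemma chris_component: "chris c x u $ i $ j = \<Gamma> c x u (axis j 1) $ i"
  by (simp add: chris_def matrix_def)

lemma linear_chris: "c \<in> A \<Longrightarrow> x \<in> chart_img c \<Longrightarrow> linear (chris c x)"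
  by (rule linearI) (auto simp: vec_eq_iff chris_component dest!: bilinear_\<Gamma> intro: bilinear_ladd bilinear_lmul
      simp: bilinear_ladd bilinear_lmul)

lemma chris_i: "c \<in> A \<Longrightarrow> x \<in> chart_img c \<Longrightarrow> chris c x (\<i> *s u) = mat \<i> ** chris c x u"
  by (simp add: vec_eq_iff chris_component mat_mult_component \<Gamma>_i_left)

lemma differentiable_\<Gamma>: 
  assumes "c \<in> A" "x \<in> chart_img c" shows "(\<lambda>y. \<Gamma> c y u v) differentiable (at x)"
proof -
  have "Ck_on (Suc 0) (chart_img c) (\<lambda>y. \<Gamma> c y u v)"
    using smooth_\<Gamma>[OF assms(1)] unfolding smooth_on_def by blast
  then show ?thesis using assms(2) by (simp only: Ck_on.simps)
qed

lemma chris_has_derivative: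
  assumes "c \<in> A" "x \<in> chart_img c"
  shows "((\<lambda>y. chris c y u) has_derivative (\<lambda>w. dchris c x w u)) (at x)"
proof -
  obtain D where D: "\<And>v. ((\<lambda>y. \<Gamma> c y u v) has_derivative D v) (at x)"
    using differentiable_\<Gamma>[OF assms] unfolding differentiable_def by metis
  have "((\<lambda>y. chris c y u) has_derivative (\<lambda>w. \<chi> i j. D (axis j 1) w $ i)) (at x)"
  proof (subst has_derivative_componentwise_within, rule ballI)
    fix b :: "complex ^ 'n ^ 'n" assume "b \<in> Basis"
    then obtain i j a where b: "b = axis i (axis j a)" by (auto simp: Basis_vec_def)
    have "((\<lambda>y. \<Gamma> c y u (axis j 1) $ i \<bullet> a) has_derivative (\<lambda>w. D (axis j 1) w $ i \<bullet> a)) (at x)"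
      by (intro has_derivative_inner_left bounded_linear.has_derivative[OF bounded_linear_vec_nth] D)
    then show "((\<lambda>y. chris c y u \<bullet> b) has_derivative (\<lambda>w. (\<chi> i j. D (axis j 1) w $ i) \<bullet> b)) (at x)"
      by (simp add: b inner_axis chris_component)
  qed
  from this[unfolded frechet_derivative_at[OF this]] show ?thesis by (simp add: dchris_def)
qed

lemma continuous_on_chris: "c \<in> A \<Longrightarrow> continuous_on (chart_img c) (\<lambda>y. chris c y u)"
  by (intro continuous_at_imp_continuous_on ballI has_derivative_continuous[OF chris_has_derivative])

lemma linear_dchris_left: "c \<in> A \<Longrightarrow> x \<in> chart_img c \<Longrightarrow> linear (\<lambda>w. dchris c x w u)"
  using chris_has_derivative has_derivative_linear by blast

lemma dchris_eqI:
  assumes c: "c \<in> A" "x \<in> chart_img c" and D: "(f has_derivative D) (at x)"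
    and eq: "\<And>y. y \<in> chart_img c \<Longrightarrow> chris c y u = f y"
  shows "dchris c x w u = D w"
proof -
  have "((\<lambda>y. chris c y u) has_derivative D) (at x)"
    by (rule has_derivative_transform_within_open[OF D open_img[OF c(1)] c(2)]) (simp add: eq)
  then show ?thesis unfolding dchris_def using frechet_derivative_at by metis
qed

lemma linear_dchris_right: 
  assumes c: "c \<in> A" "x \<in> chart_img c" shows "linear (dchris c x w)"
proof (rule linearI)
  show "dchris c x w (u + v) = dchris c x w u + dchris c x w v" for u v
    by (rule dchris_eqI[OF c has_derivative_add[OF chris_has_derivative[OF c] chris_has_derivative[OF c]]])
      (rule linear_add[OF linear_chris[OF c(1)]])
  show "dchris c x w (r *\<^sub>R u) = r *\<^sub>R dchris c x w u" for r u
    by (rule dchris_eqI[OF c has_derivative_scaleR_right[OF chris_has_derivative[OF c]]])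
      (rule linear_scale[OF linear_chris[OF c(1)]])
qed

lemma dchris_i:
  assumes c: "c \<in> A" "x \<in> chart_img c" shows "dchris c x w (\<i> *s u) = mat \<i> ** dchris c x w u"
  by (rule dchris_eqI[OF c bounded_linear.has_derivative[OF
        bounded_bilinear.bounded_linear_right[OF bounded_bilinear_matrix_matrix_mult] chris_has_derivative[OF c]]])
    (rule chris_i[OF c(1)])

lemma curvature_curv:
  assumes c: "c \<in> A" "x \<in> chart_img c"
  shows "curvature \<Gamma> c x u v w = curv c x u v *v w"
proof -
  have d: "frechet_derivative (\<lambda>y. \<Gamma> c y v w) (at x) u = dchris c x u v *v w" for u v w
  proof -
    have "((\<lambda>y. chris c y v *v w) has_derivative (\<lambda>u. dchris c x u v *v w)) (at x)"
      by (rule bounded_linear.has_derivative[OF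
        bounded_bilinear.bounded_linear_left[OF bounded_bilinear_matrix_vector_mult] chris_has_derivative[OF c]])
    then have "((\<lambda>y. \<Gamma> c y v w) has_derivative (\<lambda>u. dchris c x u v *v w)) (at x)"
      by (rule has_derivative_transform_within_open[OF _ open_img[OF c(1)] c(2)]) (simp add: \<Gamma>_chris[OF c(1)])
    then show ?thesis using frechet_derivative_at by metis
  qed
  show ?thesis
    by (simp add: curvature_def d curv_def \<Gamma>_chris[OF c] matrix_vector_mul_assoc
        matrix_vector_mult_add_rdistrib matrix_vector_mult_diff_rdistrib)
qed

text \<open>For the connection form \<open>\<theta>\<close> of the anticanonical bundle this is \<open>(D\<^sub>w \<theta>)(u)\<close>.\<close>

definition dtheta :: "('p, 'n) chart \<Rightarrow> complex ^ 'n \<Rightarrow> complex ^ 'n \<Rightarrow> complex ^ 'n \<Rightarrow> complex" where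
  "dtheta c x w u = trace (dchris c x w u)"

lemma anticanonical_has_derivative:
  assumes c: "c \<in> A" "x \<in> chart_img c"
  shows "((\<lambda>y. anticanonical_connection \<Gamma> c y u) has_derivative (\<lambda>w. dtheta c x w u)) (at x)"
  using bounded_linear.has_derivative[OF bounded_linear_trace chris_has_derivative[OF c]]
  by (simp add: anticanonical_connection_def chris_def[symmetric] dtheta_def)

lemma ricci_form_dtheta:
  assumes c: "c \<in> A" "x \<in> chart_img c"
  shows "ricci_form \<Gamma> c x u v = - Im (dtheta c x u v - dtheta c x v u)"
  using frechet_derivative_at[OF anticanonical_has_derivative[OF c, of u]]
    frechet_derivative_at[OF anticanonical_has_derivative[OF c, of v]]
  unfolding ricci_form_def anticanonical_curvature_def by (metis (no_types) Re_i_times)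

lemma trace_curv: "trace (curv c x u v) = dtheta c x u v - dtheta c x v u"
  using trace_mult_commute[of "chris c x u" "chris c x v"]
  by (simp add: curv_def dtheta_def linear_add[OF linear_trace] linear_diff[OF linear_trace])

lemma linear_dtheta_left: "c \<in> A \<Longrightarrow> x \<in> chart_img c \<Longrightarrow> linear (\<lambda>w. dtheta c x w u)"
  unfolding dtheta_def using linear_compose[OF linear_dchris_left linear_trace] by (simp add: o_def)

lemma linear_dtheta_right: "c \<in> A \<Longrightarrow> x \<in> chart_img c \<Longrightarrow> linear (dtheta c x w)"
  unfolding dtheta_def[abs_def] using linear_compose[OF linear_dchris_right linear_trace] by (simp add: o_def)

lemma dtheta_i: "c \<in> A \<Longrightarrow> x \<in> chart_img c \<Longrightarrow> dtheta c x w (\<i> *s u) = \<i> * dtheta c x w u"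
  by (simp add: dtheta_def dchris_i trace_mat_mult)

section \<open>Parallel transport along short segments\<close>

text \<open>\<open>X t\<close> transports vectors from \<open>y\<close> to \<open>y + t (z - y)\<close>, and \<open>Y t\<close> transports them back.\<close>

definition segment_transport :: "('p, 'n) chart \<Rightarrow> complex ^ 'n \<Rightarrow> complex ^ 'n
    \<Rightarrow> (real \<Rightarrow> complex ^ 'n ^ 'n) \<Rightarrow> (real \<Rightarrow> complex ^ 'n ^ 'n) \<Rightarrow> bool" where
  "segment_transport c y z X Y \<longleftrightarrow> fundamental_pair (\<lambda>t. chris c (y + t *\<^sub>R (z - y)) (z - y)) X Y"

text \<open>The Christoffel symbols are bounded on a compact ball.  The coefficient of the transport equation
  is proportional to the length of the segment and thus as small as Picard's theorem requires.\<close>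

lemma segment_transport_exists:
  assumes c: "c \<in> A" and x: "x \<in> chart_img c"
  obtains r C where "r > 0" "C > 0" "ball x r \<subseteq> chart_img c"
    "\<And>y z. y \<in> ball x r \<Longrightarrow> z \<in> ball x r \<Longrightarrow> \<exists>X Y. segment_transport c y z X Y \<and>
       (\<forall>t\<in>{0..1}. norm (X t - mat 1) \<le> C * norm (z - y) \<and> norm (Y t - mat 1) \<le> C * norm (z - y))"
proof -
  obtain r0 where r0: "r0 > 0" "cball x r0 \<subseteq> chart_img c"
    using open_img[OF c] x open_contains_cball by blast
  obtain \<epsilon> C where \<epsilon>: "\<epsilon> > 0" "C > 0" and pair:
    "\<And>(A :: real \<Rightarrow> complex ^ 'n ^ 'n) b. continuous_on {0..1} A \<Longrightarrow> (\<And>t. t \<in> {0..1} \<Longrightarrow> norm (A t) \<le> b) \<Longrightarrow>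
       b \<le> \<epsilon> \<Longrightarrow> \<exists>X Y. fundamental_pair A X Y \<and>
         (\<forall>t\<in>{0..1}. norm (X t - mat 1) \<le> C * b \<and> norm (Y t - mat 1) \<le> C * b)"
    by (rule fundamental_pair_exists) blast
  have "\<exists>B>0. \<forall>y\<in>cball x r0. norm (chris c y b) \<le> B" for b
  proof -
    have "compact ((\<lambda>y. chris c y b) ` cball x r0)"
      by (intro compact_continuous_image continuous_on_subset[OF continuous_on_chris[OF c] r0(2)] compact_cball)
    then show ?thesis using compact_imp_bounded bounded_pos by (metis imageI)
  qed
  then obtain B where B: "\<And>b. B b > 0" "\<And>b y. y \<in> cball x r0 \<Longrightarrow> norm (chris c y b) \<le> B b" by metis
  define K where "K = (\<Sum>b\<in>(Basis :: (complex ^ 'n) set). B b) + 1"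
  have K: "K > 0" unfolding K_def using B(1) by (simp add: add_nonneg_pos sum_nonneg less_imp_le)
  have Kb: "norm (chris c y u) \<le> K * norm u" if y: "y \<in> cball x r0" for y u
  proof -
    have "chris c y (\<Sum>b\<in>Basis. (u \<bullet> b) *\<^sub>R b) = (\<Sum>b\<in>Basis. (u \<bullet> b) *\<^sub>R chris c y b)"
      using linear_chris[OF c, of y] y r0(2) by (simp add: linear_sum linear_scale subset_iff)
    then have "norm (chris c y u) = norm (\<Sum>b\<in>Basis. (u \<bullet> b) *\<^sub>R chris c y b)"
      by (simp add: euclidean_representation)
    also have "\<dots> \<le> (\<Sum>b\<in>Basis. norm u * B b)"
    proof (rule sum_norm_le)
      fix b :: "complex ^ 'n" assume b: "b \<in> Basis"
      show "norm ((u \<bullet> b) *\<^sub>R chris c y b) \<le> norm u * B b"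
        using Basis_le_norm[OF b, of u] B(2)[OF y, of b] by (simp add: mult_mono)
    qed
    also have "\<dots> = norm u * (K - 1)" by (simp add: K_def sum_distrib_left)
    also have "\<dots> \<le> K * norm u" by (simp add: algebra_simps)
    finally show ?thesis .
  qed
  define r where "r = min r0 (\<epsilon> / (2 * K))"
  have r: "r > 0" "r \<le> r0" "2 * K * r \<le> \<epsilon>"
    using r0 \<epsilon> K by (auto simp: r_def min_def field_simps)
  show ?thesis
  proof (rule that[of r "C * K"])
    show "r > 0" "C * K > 0" using r \<epsilon> K by auto
    show "ball x r \<subseteq> chart_img c" using r r0(2) by auto
    fix y z assume yz: "y \<in> ball x r" "z \<in> ball x r"
    have seg: "y + t *\<^sub>R (z - y) \<in> cball x r0" if "t \<in> {0..1}" for t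
    proof -
      have "(1 - t) *\<^sub>R y + t *\<^sub>R z \<in> ball x r"
        using yz that convex_ball[of x r] by (intro convexD) auto
      then show ?thesis using r by (simp add: algebra_simps)
    qed
    have "norm (z - y) \<le> norm (z - x) + norm (y - x)" using norm_triangle_ineq4[of "z - x" "y - x"] by simp
    also have "\<dots> \<le> 2 * r" using yz by (simp add: dist_norm norm_minus_commute)
    finally have "K * norm (z - y) \<le> \<epsilon>" using r(3) mult_left_mono[OF _ less_imp_le[OF K], of "norm (z - y)" "2 * r"] by simp
    moreover have "norm (chris c (y + t *\<^sub>R (z - y)) (z - y)) \<le> K * norm (z - y)" if "t \<in> {0..1}" for t
      using Kb seg that by blast
    moreover have "continuous_on {0..1} (\<lambda>t. chris c (y + t *\<^sub>R (z - y)) (z - y))"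
    proof (rule continuous_on_compose2[OF continuous_on_chris[OF c]])
      show "continuous_on {0..1} (\<lambda>t. y + t *\<^sub>R (z - y))" by (intro continuous_intros)
    qed (use seg r0 in auto)
    ultimately show "\<exists>X Y. segment_transport c y z X Y \<and>
       (\<forall>t\<in>{0..1}. norm (X t - mat 1) \<le> (C * K) * norm (z - y) \<and> norm (Y t - mat 1) \<le> (C * K) * norm (z - y))"
      unfolding segment_transport_def using pair[of "\<lambda>t. chris c (y + t *\<^sub>R (z - y)) (z - y)" "K * norm (z - y)"]
      by (simp add: mult.assoc)
  qed
qed

lemma segment_transport_initial:
  assumes X: "segment_transport c y z X Y" and t: "t \<in> {0..1}"
    and seg: "closed_segment y z \<subseteq> chart_img c" and c: "c \<in> A"
  shows "segment_transport c y (y + t *\<^sub>R (z - y)) (\<lambda>s. X (t * s)) (\<lambda>s. Y (t * s))"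
  unfolding segment_transport_def fundamental_pair_def
proof (intro conjI ballI)
  note F = X[unfolded segment_transport_def fundamental_pair_def]
  show "X (t * 0) = mat 1" "Y (t * 0) = mat 1" using F by auto
  fix s :: real assume s: "s \<in> {0..1}"
  have mult_mem: "t * a \<in> {0..1}" if "a \<in> {0..1}" for a
    using that t mult_le_one[of t a] by simp
  have ts: "t * s \<in> {0..1}" by (rule mult_mem[OF s])
  have im: "(\<lambda>s. t * s) ` {0..1} \<subseteq> {0..1}" by (rule image_subsetI) (rule mult_mem)
  have m: "((\<lambda>s. t * s) has_vector_derivative t) (at s within {0..1})"
    unfolding has_real_derivative_iff_has_vector_derivative[symmetric] by (auto intro!: derivative_eq_intros)
  have "y + (t * s) *\<^sub>R (z - y) \<in> closed_segment y z"
    unfolding in_segment using ts by (intro exI[of _ "t * s"]) (simp add: algebra_simps)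
  then have inn: "y + (s * t) *\<^sub>R (z - y) \<in> chart_img c" using seg by (auto simp: mult.commute)
  have ch: "chris c (y + s *\<^sub>R (y + t *\<^sub>R (z - y) - y)) (y + t *\<^sub>R (z - y) - y) = t *\<^sub>R chris c (y + (t * s) *\<^sub>R (z - y)) (z - y)"
    using linear_scale[OF linear_chris[OF c inn]] by (simp add: mult.commute)
  have "(X has_vector_derivative - (chris c (y + (t * s) *\<^sub>R (z - y)) (z - y) ** X (t * s))) (at (t * s) within (\<lambda>s. t * s) ` {0..1})"
    by (rule has_vector_derivative_within_subset[OF _ im]) (use F ts in blast)
  from vector_diff_chain_within[OF m this]
  show "((\<lambda>s. X (t * s)) has_vector_derivative - (chris c (y + s *\<^sub>R (y + t *\<^sub>R (z - y) - y)) (y + t *\<^sub>R (z - y) - y) ** X (t * s))) (at s within {0..1})"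
    unfolding ch by (simp add: o_def matrix_scaleR_left)
  have "(Y has_vector_derivative Y (t * s) ** chris c (y + (t * s) *\<^sub>R (z - y)) (z - y)) (at (t * s) within (\<lambda>s. t * s) ` {0..1})"
    by (rule has_vector_derivative_within_subset[OF _ im]) (use F ts in blast)
  from vector_diff_chain_within[OF m this]
  show "((\<lambda>s. Y (t * s)) has_vector_derivative Y (t * s) ** chris c (y + s *\<^sub>R (y + t *\<^sub>R (z - y) - y)) (y + t *\<^sub>R (z - y) - y)) (at s within {0..1})"
    unfolding ch by (simp add: o_def matrix_scaleR_right)
  show "X (t * s) ** Y (t * s) = mat 1" "Y (t * s) ** X (t * s) = mat 1" using F ts by auto
qed

lemma segment_transport_reverse:
  assumes X: "segment_transport c y z X Y" and seg: "closed_segment y z \<subseteq> chart_img c" and c: "c \<in> A"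
  shows "segment_transport c z y (\<lambda>s. X (1 - s) ** Y 1) (\<lambda>s. X 1 ** Y (1 - s))"
  unfolding segment_transport_def fundamental_pair_def
proof (intro conjI ballI)
  note F = X[unfolded segment_transport_def fundamental_pair_def]
  show "X (1 - 0) ** Y 1 = mat 1" "X 1 ** Y (1 - 0) = mat 1" using F by auto
  fix s :: real assume s: "s \<in> {0..1}"
  have ts: "1 - s \<in> {0..1}" using s by auto
  have im: "(\<lambda>s. 1 - s) ` {0..1} \<subseteq> {0..1::real}" by auto
  have m: "((\<lambda>s. 1 - s) has_vector_derivative - 1) (at s within {0..1})"
    unfolding has_real_derivative_iff_has_vector_derivative[symmetric] by (auto intro!: derivative_eq_intros)
  have "y + (1 - s) *\<^sub>R (z - y) \<in> closed_segment y z"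
    unfolding in_segment using ts by (intro exI[of _ "1 - s"]) (simp add: algebra_simps)
  then have inn: "y + (1 - s) *\<^sub>R (z - y) \<in> chart_img c" using seg by auto
  have zs: "z + s *\<^sub>R (y - z) = y + (1 - s) *\<^sub>R (z - y)" by (simp add: algebra_simps)
  have ch: "chris c (z + s *\<^sub>R (y - z)) (y - z) = - chris c (y + (1 - s) *\<^sub>R (z - y)) (z - y)"
    unfolding zs using linear_neg[OF linear_chris[OF c inn], of "z - y"] by simp
  have "(X has_vector_derivative - (chris c (y + (1 - s) *\<^sub>R (z - y)) (z - y) ** X (1 - s))) (at (1 - s) within (\<lambda>s. 1 - s) ` {0..1})"
    by (rule has_vector_derivative_within_subset[OF _ im]) (use F ts in blast)
  from vector_diff_chain_within[OF m this]
  have "((\<lambda>s. X (1 - s)) has_vector_derivative chris c (y + (1 - s) *\<^sub>R (z - y)) (z - y) ** X (1 - s)) (at s within {0..1})"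
    by (simp add: o_def)
  from bounded_linear.has_vector_derivative[OF bounded_bilinear.bounded_linear_left[OF bounded_bilinear_matrix_matrix_mult] this]
  show "((\<lambda>s. X (1 - s) ** Y 1) has_vector_derivative - (chris c (z + s *\<^sub>R (y - z)) (y - z) ** (X (1 - s) ** Y 1))) (at s within {0..1})"
    unfolding ch by (simp add: matrix_minus_left matrix_mul_assoc)
  have "(Y has_vector_derivative Y (1 - s) ** chris c (y + (1 - s) *\<^sub>R (z - y)) (z - y)) (at (1 - s) within (\<lambda>s. 1 - s) ` {0..1})"
    by (rule has_vector_derivative_within_subset[OF _ im]) (use F ts in blast)
  from vector_diff_chain_within[OF m this]
  have "((\<lambda>s. Y (1 - s)) has_vector_derivative - (Y (1 - s) ** chris c (y + (1 - s) *\<^sub>R (z - y)) (z - y))) (at s within {0..1})"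
    by (simp add: o_def)
  from bounded_linear.has_vector_derivative[OF bounded_bilinear.bounded_linear_right[OF bounded_bilinear_matrix_matrix_mult] this]
  show "((\<lambda>s. X 1 ** Y (1 - s)) has_vector_derivative X 1 ** Y (1 - s) ** chris c (z + s *\<^sub>R (y - z)) (y - z)) (at s within {0..1})"
    unfolding ch by (simp add: matrix_minus_right matrix_mul_assoc)
  have *: "X (1 - s) ** Y (1 - s) = mat 1" "Y (1 - s) ** X (1 - s) = mat 1" "Y 1 ** X 1 = mat 1" "X 1 ** Y 1 = mat 1"
    using F ts by auto
  have "X (1 - s) ** Y 1 ** (X 1 ** Y (1 - s)) = X (1 - s) ** (Y 1 ** X 1) ** Y (1 - s)"
    by (simp add: matrix_mul_assoc)
  then show "X (1 - s) ** Y 1 ** (X 1 ** Y (1 - s)) = mat 1" by (simp add: * matrix_mul_rid)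
  have "X 1 ** Y (1 - s) ** (X (1 - s) ** Y 1) = X 1 ** (Y (1 - s) ** X (1 - s)) ** Y 1"
    by (simp add: matrix_mul_assoc)
  then show "X 1 ** Y (1 - s) ** (X (1 - s) ** Y 1) = mat 1" by (simp add: * matrix_mul_rid)
qed

end

section \<open>Parallel frame bundles and the anticanonical metric\<close>

text \<open>A family of frames that is preserved by parallel transport and in which any two frames of one
  tangent space have determinants of equal modulus.  It replaces a reduction of the structure group.
  The coordinate section of the anticanonical bundle then has a well-defined norm
  \<open>h = \<bar>det H\<bar>\<^sup>-\<^sup>2\<close> for any frame \<open>H\<close> of the family, and \<open>lam\<close> below is \<open>ln h\<close>.\<close>

locale frame_bundle = complex_connection A \<Gamma>
  for A :: "('p::t2_space, 'n::finite) chart set" and \<Gamma> +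
  fixes F :: "('p, 'n) chart \<Rightarrow> complex ^ 'n \<Rightarrow> (complex ^ 'n ^ 'n) set"
  assumes F_invertible: "\<And>c x H. c \<in> A \<Longrightarrow> x \<in> chart_img c \<Longrightarrow> H \<in> F c x \<Longrightarrow> invertible H"
    and F_nonempty: "\<And>c x. c \<in> A \<Longrightarrow> x \<in> chart_img c \<Longrightarrow> F c x \<noteq> {}"
    and F_chart: "\<And>c d x H. c \<in> A \<Longrightarrow> d \<in> A \<Longrightarrow> x \<in> overlap c d \<Longrightarrow> H \<in> F c x \<Longrightarrow>
        jacobian c d x ** H \<in> F d (transition c d x)"
    and F_det: "\<And>c x H H'. c \<in> A \<Longrightarrow> x \<in> chart_img c \<Longrightarrow> H \<in> F c x \<Longrightarrow> H' \<in> F c x \<Longrightarrow>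
        cmod (det H) = cmod (det H')"
    and F_transport: "\<And>c y z X Y H. c \<in> A \<Longrightarrow> segment_transport c y z X Y \<Longrightarrow>
        closed_segment y z \<subseteq> chart_img c \<Longrightarrow> H \<in> F c y \<Longrightarrow> X 1 ** H \<in> F c z"
begin

definition lam :: "('p, 'n) chart \<Rightarrow> complex ^ 'n \<Rightarrow> real" where
  "lam c x = - 2 * ln (cmod (det (SOME H. H \<in> F c x)))"

lemma lam_eq: "c \<in> A \<Longrightarrow> x \<in> chart_img c \<Longrightarrow> H \<in> F c x \<Longrightarrow> lam c x = - 2 * ln (cmod (det H))"
  unfolding lam_def using F_det[of c x _ H] someI[of "\<lambda>H. H \<in> F c x" H] by metis

lemma F_det_nonzero: "c \<in> A \<Longrightarrow> x \<in> chart_img c \<Longrightarrow> H \<in> F c x \<Longrightarrow> det H \<noteq> 0"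
  using F_invertible invertible_det_nz by blast

lemma det_jacobian_nonzero: "c \<in> A \<Longrightarrow> d \<in> A \<Longrightarrow> x \<in> overlap c d \<Longrightarrow> det (jacobian c d x) \<noteq> 0"
  using jacobian_inverse invertible_det_nz unfolding invertible_def by blast

lemma lam_transition:
  assumes c: "c \<in> A" "d \<in> A" and x: "x \<in> overlap c d"
  shows "lam d (transition c d x) = lam c x - 2 * ln (cmod (det (jacobian c d x)))"
proof -
  have xi: "x \<in> chart_img c" using overlap_subset[OF c(1) x] .
  have yi: "transition c d x \<in> chart_img d" using overlap_subset[OF c(2) transition_in[OF c x]] .
  obtain H where H: "H \<in> F c x" using F_nonempty[OF c(1) xi] by blast
  have "lam d (transition c d x) = - 2 * ln (cmod (det (jacobian c d x ** H)))"
    by (rule lam_eq[OF c(2) yi F_chart[OF c x H]])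
  also have "\<dots> = - 2 * (ln (cmod (det (jacobian c d x))) + ln (cmod (det H)))"
    using det_jacobian_nonzero[OF c x] F_det_nonzero[OF c(1) xi H]
    by (simp add: det_mul norm_mult ln_mult)
  also have "\<dots> = lam c x - 2 * ln (cmod (det (jacobian c d x)))"
    by (simp add: lam_eq[OF c(1) xi H])
  finally show ?thesis .
qed

lemma frames_along_segment:
  assumes c: "c \<in> A" and r: "ball x r \<subseteq> chart_img c" and y: "y \<in> ball x r" "z \<in> ball x r"
    and X: "segment_transport c y z X Y" and H: "H \<in> F c y" and t: "t \<in> {0..1}"
  shows "y + t *\<^sub>R (z - y) \<in> chart_img c" "X t ** H \<in> F c (y + t *\<^sub>R (z - y))"
proof -
  have seg: "closed_segment y z \<subseteq> chart_img c"
    using y r closed_segment_subset[OF y convex_ball] by blast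
  have "y + t *\<^sub>R (z - y) \<in> closed_segment y z"
    unfolding in_segment using t by (intro exI[of _ t]) (simp add: algebra_simps)
  then have sub: "closed_segment y (y + t *\<^sub>R (z - y)) \<subseteq> chart_img c"
    using seg subset_closed_segment[of y "y + t *\<^sub>R (z - y)" y z] by auto
  then show "y + t *\<^sub>R (z - y) \<in> chart_img c" by auto
  show "X t ** H \<in> F c (y + t *\<^sub>R (z - y))"
    using F_transport[OF c segment_transport_initial[OF X t seg c] sub H] by simp
qed

lemma frames_near:
  assumes c: "c \<in> A" and x: "x \<in> chart_img c" and H: "H \<in> F c x"
  obtains s X Y where "s > 0" "segment_transport c x (x + s *\<^sub>R u) X Y"
    "\<And>t. t \<in> {0..1} \<Longrightarrow> x + t *\<^sub>R (s *\<^sub>R u) \<in> chart_img c"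
    "\<And>t. t \<in> {0..1} \<Longrightarrow> X t ** H \<in> F c (x + t *\<^sub>R (s *\<^sub>R u))"
proof -
  obtain r C where r: "r > 0" "ball x r \<subseteq> chart_img c" and ex:
    "\<And>y z. y \<in> ball x r \<Longrightarrow> z \<in> ball x r \<Longrightarrow> \<exists>X Y. segment_transport c y z X Y \<and>
       (\<forall>t\<in>{0..1}. norm (X t - mat 1) \<le> C * norm (z - y) \<and> norm (Y t - mat 1) \<le> C * norm (z - y))"
    by (rule segment_transport_exists[OF c x]) blast
  define s where "s = r / (norm u + 1)"
  have nu: "norm u + 1 > 0" by (simp add: add_nonneg_pos)
  have s: "s > 0" using r nu by (simp add: s_def)
  have "s * norm u < s * (norm u + 1)" using s by simp
  also have "\<dots> = r" using nu by (simp add: s_def)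
  finally have z: "x + s *\<^sub>R u \<in> ball x r" using s by (simp add: dist_norm)
  have xb: "x \<in> ball x r" using r by simp
  obtain X Y where X: "segment_transport c x (x + s *\<^sub>R u) X Y" using ex[OF xb z] by blast
  show ?thesis
    using frames_along_segment[OF c r(2) xb z X H] by (intro that[OF s X]) simp_all
qed

text \<open>The determinant of a parallel frame changes with the logarithmic derivative \<open>- \<theta>\<close>.  As every point may
  serve as the starting point of a segment, it suffices to differentiate the determinant of the
  transport at the identity.\<close>

lemma lam_has_derivative:
  assumes c: "c \<in> A" and x: "x \<in> chart_img c"
  shows "(lam c has_derivative (\<lambda>u. 2 * Re (trace (chris c x u)))) (at x)"
proof (rule has_derivative_from_right_derivatives[OF open_img[OF c] _ _ _ x])
  fix x u assume x: "x \<in> chart_img c"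
  obtain H where H: "H \<in> F c x" using F_nonempty[OF c x] by blast
  from frames_near[OF c x H, of u] obtain s X Y where s: "s > 0" and X: "segment_transport c x (x + s *\<^sub>R u) X Y"
    and im: "\<And>t. t \<in> {0..1} \<Longrightarrow> x + t *\<^sub>R (s *\<^sub>R u) \<in> chart_img c"
    and fr: "\<And>t. t \<in> {0..1} \<Longrightarrow> X t ** H \<in> F c (x + t *\<^sub>R (s *\<^sub>R u))" by blast
  note P = X[unfolded segment_transport_def fundamental_pair_def]
  have X0: "X 0 = mat 1" using P by simp
  have nz: "det (X t) \<noteq> 0" if "t \<in> {0..1}" for t
    using P that invertible_det_nz unfolding invertible_def by blast
  have "(X has_vector_derivative - chris c x (s *\<^sub>R u)) (at 0 within {0..1})"
    using P X0 by (auto dest!: bspec[of _ _ 0])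
  from has_vector_derivative_det_at_identity[OF this X0]
  have "((\<lambda>t. det (X t)) has_vector_derivative - trace (chris c x (s *\<^sub>R u))) (at 0 within {0..1})"
    by (simp add: linear_neg[OF linear_trace])
  from has_vector_derivative_ln_cmod[OF this _ _ nz]
  have "((\<lambda>t. ln (cmod (det (X t)))) has_vector_derivative - Re (trace (chris c x (s *\<^sub>R u)))) (at 0 within {0..1})"
    using X0 by simp
  from bounded_linear.has_vector_derivative[OF bounded_linear_mult_right[of "-2"] this]
  have "((\<lambda>t. - 2 * ln (cmod (det (X t)))) has_vector_derivative 2 * Re (trace (chris c x (s *\<^sub>R u)))) (at 0 within {0..1})"
    by simp
  from has_vector_derivative_add[OF this has_vector_derivative_const[of "lam c x"]]
  have d: "((\<lambda>t. - 2 * ln (cmod (det (X t))) + lam c x) has_vector_derivative 2 * Re (trace (chris c x (s *\<^sub>R u)))) (at 0 within {0..1})"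
    by simp
  have "((\<lambda>t. lam c (x + t *\<^sub>R (s *\<^sub>R u))) has_vector_derivative 2 * Re (trace (chris c x (s *\<^sub>R u)))) (at 0 within {0..1})"
  proof (rule has_vector_derivative_transform[OF _ _ d])
    show "lam c (x + t *\<^sub>R (s *\<^sub>R u)) = - 2 * ln (cmod (det (X t))) + lam c x" if t: "t \<in> {0..1}" for t
      using lam_eq[OF c im[OF t] fr[OF t]] lam_eq[OF c x H] nz[OF t] F_det_nonzero[OF c x H]
      by (simp add: det_mul norm_mult ln_mult)
  qed simp
  moreover have "2 * Re (trace (chris c x (s *\<^sub>R u))) = s *\<^sub>R (2 * Re (trace (chris c x u)))"
    by (simp add: linear_scale[OF linear_chris[OF c x]] linear_scale[OF linear_trace])
  ultimately show "((\<lambda>t. lam c (x + t *\<^sub>R u)) has_vector_derivative 2 * Re (trace (chris c x u))) (at 0 within {0..})"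
    by (intro right_derivative_rescale[OF _ s]) simp
next
  fix x assume x: "x \<in> chart_img c"
  show "linear (\<lambda>u. 2 * Re (trace (chris c x u)))"
    by (intro linearI) (simp_all add: linear_add[OF linear_chris[OF c x]] linear_scale[OF linear_chris[OF c x]]
        linear_add[OF linear_trace] linear_scale[OF linear_trace])
next
  fix u
  show "continuous_on (chart_img c) (\<lambda>x. 2 * Re (trace (chris c x u)))"
    by (intro continuous_intros bounded_linear.continuous_on[OF bounded_linear_trace] continuous_on_chris c)
qed

lemma Re_trace_chris_has_derivative:
  assumes c: "c \<in> A" and x: "x \<in> chart_img c"
  shows "((\<lambda>y. 2 * Re (trace (chris c y u))) has_derivative (\<lambda>w. 2 * Re (dtheta c x w u))) (at x)"
  unfolding dtheta_def
  by (intro has_derivative_mult_right bounded_linear.has_derivative[OF bounded_linear_Re]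
      bounded_linear.has_derivative[OF bounded_linear_trace] chris_has_derivative c x)

text \<open>The second derivative of \<open>lam\<close> is symmetric: the curvature of a metric connection on a line bundle
  is imaginary.\<close>

lemma Re_dtheta_sym:
  assumes c: "c \<in> A" and x: "x \<in> chart_img c"
  shows "Re (dtheta c x u v) = Re (dtheta c x v u)"
  using symmetric_second_derivative[OF open_img[OF c] x lam_has_derivative[OF c]
      Re_trace_chris_has_derivative[OF c x, of u] Re_trace_chris_has_derivative[OF c x, of v]] by simp

lemma ricci_form_antisym:
  assumes "c \<in> A" "x \<in> chart_img c" shows "ricci_form \<Gamma> c x v u = - ricci_form \<Gamma> c x u v"
  by (simp add: ricci_form_dtheta[OF assms])

lemma ricci_form_add_left:
  assumes "c \<in> A" "x \<in> chart_img c"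
  shows "ricci_form \<Gamma> c x (u + w) v = ricci_form \<Gamma> c x u v + ricci_form \<Gamma> c x w v"
  using linear_add[OF linear_dtheta_left[OF assms]] linear_add[OF linear_dtheta_right[OF assms]]
  by (simp add: ricci_form_dtheta[OF assms])

text \<open>Since \<open>\<theta>\<close> is complex linear, \<open>d\<theta>\<close> has no part of type \<open>(0,2)\<close>.  Being imaginary, it has none of
  type \<open>(2,0)\<close> either.\<close>

lemma ricci_form_I_invariant:
  assumes c: "c \<in> A" and x: "x \<in> chart_img c"
  shows "ricci_form \<Gamma> c x (\<i> *s u) (\<i> *s v) = ricci_form \<Gamma> c x u v"
proof -
  have "Re (dtheta c x (\<i> *s u) v) = Re (dtheta c x v (\<i> *s u))" "Re (dtheta c x (\<i> *s v) u) = Re (dtheta c x u (\<i> *s v))"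
    by (rule Re_dtheta_sym[OF c x])+
  then show ?thesis by (simp add: ricci_form_dtheta[OF c x] dtheta_i[OF c x])
qed

lemma ricci_form_I:
  assumes c: "c \<in> A" and x: "x \<in> chart_img c"
  shows "ricci_form \<Gamma> c x u (\<i> *s u) = - (Re (dtheta c x u u) + Re (dtheta c x (\<i> *s u) (\<i> *s u)))"
  by (simp add: ricci_form_dtheta[OF c x] dtheta_i[OF c x])

lemma ricci_form_zeroI:
  assumes c: "c \<in> A" and x: "x \<in> chart_img c" and z: "\<And>u. ricci_form \<Gamma> c x u (\<i> *s u) = 0"
  shows "ricci_form \<Gamma> c x u v = 0"
proof -
  have *: "ricci_form \<Gamma> c x u (\<i> *s w) = 0" for w
  proof -
    have add_right: "ricci_form \<Gamma> c x a (b + d) = ricci_form \<Gamma> c x a b + ricci_form \<Gamma> c x a d" for a b d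
      using ricci_form_add_left[OF c x, of b d a] ricci_form_antisym[OF c x, of a "b + d"]
        ricci_form_antisym[OF c x, of a b] ricci_form_antisym[OF c x, of a d] by linarith
    have "0 = ricci_form \<Gamma> c x (u + w) (\<i> *s u + \<i> *s w)"
      using z[of "u + w"] by (simp add: vector_add_ldistrib)
    also have "\<dots> = ricci_form \<Gamma> c x u (\<i> *s w) + ricci_form \<Gamma> c x w (\<i> *s u)"
      by (simp add: ricci_form_add_left[OF c x] add_right z)
    also have "ricci_form \<Gamma> c x w (\<i> *s u) = ricci_form \<Gamma> c x (\<i> *s w) (\<i> *s (\<i> *s u))"
      by (rule ricci_form_I_invariant[OF c x, symmetric])
    also have "\<i> *s (\<i> *s u) = (- 1) *s u" by (simp add: vector_smult_assoc)
    also have "ricci_form \<Gamma> c x (\<i> *s w) ((- 1) *s u) = ricci_form \<Gamma> c x u (\<i> *s w)"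
    proof -
      have "ricci_form \<Gamma> c x (\<i> *s w) (- u) + ricci_form \<Gamma> c x (\<i> *s w) u = ricci_form \<Gamma> c x (\<i> *s w) 0"
        using add_right[of "\<i> *s w" "- u" u] by simp
      moreover have "ricci_form \<Gamma> c x (\<i> *s w) 0 = 0" using add_right[of "\<i> *s w" 0 0] by simp
      moreover have "ricci_form \<Gamma> c x u (\<i> *s w) = - ricci_form \<Gamma> c x (\<i> *s w) u"
        by (rule ricci_form_antisym[OF c x])
      ultimately have "ricci_form \<Gamma> c x (\<i> *s w) (- u) = ricci_form \<Gamma> c x u (\<i> *s w)" by linarith
      moreover have "(- 1) *s u = - u" by (simp add: vec_eq_iff)
      ultimately show ?thesis by metis
    qed
    finally show ?thesis by simp
  qed
  have "v = \<i> *s ((- \<i>) *s v)" by (simp add: vec_eq_iff)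
  then show ?thesis using *[of "(- \<i>) *s v"] by simp
qed

lemma lam_second_deriv:
  assumes c: "c \<in> A" and x: "x \<in> chart_img c"
  shows "has_second_deriv_0 (\<lambda>t. lam c (x + t *\<^sub>R u)) (2 * Re (dtheta c x u u))"
proof -
  let ?p = "\<lambda>t. 2 * Re (trace (chris c (x + t *\<^sub>R u) u))"
  have line: "((\<lambda>t. x + t *\<^sub>R u) has_derivative (\<lambda>h. h *\<^sub>R u)) (at t)" for t
    by (auto intro!: derivative_eq_intros)
  have "((\<lambda>t. x + t *\<^sub>R u) \<longlongrightarrow> x + 0 *\<^sub>R u) (nhds 0)"
    by (intro tendsto_intros filterlim_ident)
  then have ev: "\<forall>\<^sub>F t in nhds 0. x + t *\<^sub>R u \<in> chart_img c"
    using x open_img[OF c] topological_tendstoD by fastforce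
  have "((\<lambda>t. lam c (x + t *\<^sub>R u)) has_real_derivative ?p t) (at t)" if i: "x + t *\<^sub>R u \<in> chart_img c" for t
  proof -
    from has_derivative_compose[OF line lam_has_derivative[OF c i]]
    have "((\<lambda>t. lam c (x + t *\<^sub>R u)) has_derivative (\<lambda>h. h * ?p t)) (at t)"
      by (simp add: linear_scale[OF linear_chris[OF c i]] linear_scale[OF linear_trace] mult.left_commute)
    then show ?thesis by (simp add: has_field_derivative_def mult_commute_abs)
  qed
  then have 1: "\<forall>\<^sub>F t in nhds 0. ((\<lambda>t. lam c (x + t *\<^sub>R u)) has_real_derivative ?p t) (at t)"
    using ev by (rule eventually_mono[rotated]) 
  have x0: "x = x + 0 *\<^sub>R u" by simp
  from has_derivative_compose[OF line, of _ _ 0, OF Re_trace_chris_has_derivative[OF c, of "x + 0 *\<^sub>R u"]]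
  have "(?p has_derivative (\<lambda>h. 2 * Re (dtheta c x (h *\<^sub>R u) u))) (at 0)"
    using x by simp
  then have "(?p has_derivative (\<lambda>h. h * (2 * Re (dtheta c x u u)))) (at 0)"
    using linear_scale[OF linear_dtheta_left[OF c x]] by (simp add: algebra_simps)
  then have "(?p has_real_derivative 2 * Re (dtheta c x u u)) (at 0)"
    by (simp add: has_field_derivative_def mult_commute_abs)
  with 1 show ?thesis unfolding has_second_deriv_0_def by (intro exI[of _ ?p]) simp
qed

end

section \<open>The Bochner argument\<close>

text \<open>The logarithm of \<open>\<bar>f\<bar>\<close> is locally the real part of a holomorphic function \<open>g\<close>, up to a constant, and the
  second derivative of \<open>g\<close> changes sign when the direction is multiplied by \<open>\<i>\<close>.\<close>

lemma ln_cmod_holomorphic_second_deriv: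
  assumes f: "f holomorphic_on U" and U: "open U" "0 \<in> U" and f0: "f 0 \<noteq> 0"
  shows "\<exists>a. has_second_deriv_0 (\<lambda>t. ln (cmod (f (of_real t)))) a \<and>
             has_second_deriv_0 (\<lambda>t. ln (cmod (f (\<i> * of_real t)))) (- a)"
proof -
  define V where "V = U \<inter> (\<lambda>\<zeta>. f \<zeta> / f 0) -` ball 1 1"
  have "continuous_on U (\<lambda>\<zeta>. f \<zeta> / f 0)"
    using holomorphic_on_imp_continuous_on[OF f] f0 by (intro continuous_intros) auto
  then have V: "open V" unfolding V_def using U(1) by (intro continuous_open_preimage) auto
  have V0: "0 \<in> V" using U f0 by (simp add: V_def)
  define g where "g = (\<lambda>\<zeta>. Ln (f \<zeta> / f 0))"
  have pos: "0 < Re (f \<zeta> / f 0)" if "\<zeta> \<in> V" for \<zeta>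
  proof -
    have "\<bar>Re (1 - f \<zeta> / f 0)\<bar> < 1" using that abs_Re_le_cmod[of "1 - f \<zeta> / f 0"] by (simp add: V_def dist_norm)
    then show ?thesis by simp
  qed
  have g: "g holomorphic_on V" unfolding g_def
  proof (intro holomorphic_on_Ln' holomorphic_intros)
    show "f holomorphic_on V" using f by (rule holomorphic_on_subset) (simp add: V_def)
    show "f \<zeta> / f 0 \<notin> \<real>\<^sub>\<le>\<^sub>0" if "\<zeta> \<in> V" for \<zeta> using pos[OF that] by (auto simp: complex_nonpos_Reals_iff)
  qed (use f0 in auto)
  have Reg: "ln (cmod (f \<zeta>)) = Re (g \<zeta>) + ln (cmod (f 0))" if "\<zeta> \<in> V" for \<zeta>
  proof -
    have "f \<zeta> / f 0 \<noteq> 0" using pos[OF that] by force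
    then show ?thesis using f0 unfolding g_def by (simp add: norm_divide ln_div)
  qed
  have main: "has_second_deriv_0 (\<lambda>t. ln (cmod (f (w * of_real t)))) (Re (w * w * deriv (deriv g) 0))" for w
  proof -
    have "((\<lambda>t. w * of_real t) \<longlongrightarrow> w * of_real 0) (nhds (0 :: real))"
      by (intro tendsto_intros filterlim_ident)
    then have ev: "\<forall>\<^sub>F t in nhds (0 :: real). w * of_real t \<in> V"
      using V V0 topological_tendstoD by fastforce
    have hol': "deriv g holomorphic_on V" by (rule holomorphic_deriv[OF g V])
    have d: "((\<lambda>t. Re (h (w * of_real t))) has_real_derivative Re (w * deriv h (w * of_real t))) (at t)"
      if h: "h holomorphic_on V" and t: "w * of_real t \<in> V" for h and t :: real
    proof -
      have "((\<lambda>z. h (w * z)) has_field_derivative deriv h (w * of_real t) * w) (at (of_real t))"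
      proof (rule DERIV_chain2[where f = h and g = "(*) w"])
        show "(h has_field_derivative deriv h (w * of_real t)) (at (w * of_real t))"
          by (rule holomorphic_derivI[OF h V t])
        show "((*) w has_field_derivative w) (at (of_real t))"
          using DERIV_cmult_Id[of w] by simp
      qed
      from bounded_linear.has_vector_derivative[OF bounded_linear_Re has_vector_derivative_real_field[OF this]]
      show ?thesis by (simp add: has_real_derivative_iff_has_vector_derivative mult.commute)
    qed
    have "has_second_deriv_0 (\<lambda>t. Re (g (w * of_real t)) + ln (cmod (f 0))) (Re (w * w * deriv (deriv g) 0) + 0)"
    proof (rule has_second_deriv_0_add)
      have 1: "\<forall>\<^sub>F t in nhds 0. ((\<lambda>t. Re (g (w * of_real t))) has_real_derivative Re (w * deriv g (w * of_real t))) (at t)"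
        using ev by eventually_elim (rule d[OF g])
      have hol2: "(\<lambda>\<zeta>. w * deriv g \<zeta>) holomorphic_on V" by (intro holomorphic_intros hol')
      have 2: "((\<lambda>t. Re (w * deriv g (w * of_real t))) has_real_derivative Re (w * w * deriv (deriv g) 0)) (at 0)"
      proof -
        have "deriv (\<lambda>\<zeta>. w * deriv g \<zeta>) 0 = w * deriv (deriv g) 0"
          using holomorphic_derivI[OF hol' V V0] by (intro DERIV_imp_deriv DERIV_cmult)
        then show ?thesis using d[OF hol2, of 0] V0 by (simp add: mult.assoc)
      qed
      show "has_second_deriv_0 (\<lambda>t. Re (g (w * of_real t))) (Re (w * w * deriv (deriv g) 0))"
        unfolding has_second_deriv_0_def using 1 2 by (intro exI[of _ "\<lambda>t. Re (w * deriv g (w * of_real t))"] conjI)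
      show "has_second_deriv_0 (\<lambda>t. ln (cmod (f 0))) 0"
        unfolding has_second_deriv_0_def by (intro exI[of _ "\<lambda>t. 0"]) simp
    qed
    then have "has_second_deriv_0 (\<lambda>t. Re (g (w * of_real t)) + ln (cmod (f 0))) (Re (w * w * deriv (deriv g) 0))" by simp
    then show ?thesis
      by (rule has_second_deriv_0_cong) (use ev in \<open>eventually_elim, simp add: Reg\<close>)
  qed
  show ?thesis
    using main[of 1] main[of \<i>] by (intro exI[of _ "Re (deriv (deriv g) 0)"]) simp
qed

text \<open>The columns of the frame, and their multiples by \<open>\<i>\<close> for the index \<open>True\<close>: a real basis.\<close>

definition frame_vector :: "complex ^ 'n ^ 'n \<Rightarrow> 'n \<times> bool \<Rightarrow> complex ^ 'n" where
  "frame_vector H p = (if snd p then \<i> *s (H *v axis (fst p) 1) else H *v axis (fst p) 1)"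

lemma sum_over_pairs_with_bool:
  fixes f :: "'n::finite \<times> bool \<Rightarrow> real"
  shows "(\<Sum>p\<in>UNIV. f p) = (\<Sum>k\<in>UNIV. f (k, False) + f (k, True))"
proof -
  have "(\<Sum>p\<in>UNIV. f p) = (\<Sum>k\<in>UNIV. \<Sum>b\<in>UNIV. f (k, b))"
    by (simp add: sum.cartesian_product)
  then show ?thesis by (simp add: UNIV_bool)
qed

lemma matrix_vector_mult_axis_sum:
  fixes H :: "complex ^ 'n ^ 'm"
  shows "H *v w = (\<Sum>k\<in>UNIV. w $ k *s (H *v axis k 1))"
  by (simp add: vec_eq_iff matrix_vector_mult_def axis_def if_distrib sum.delta mult.commute cong: if_cong)

text \<open>Ellipticity.  If \<open>\<xi>\<close> is written as \<open>H g\<close> with \<open>g = G \<xi>\<close>, then \<open>\<xi> \<bullet> \<xi>\<close> is a combination of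
  the numbers \<open>\<xi> \<bullet> e\<^sub>p\<close>, whose coefficients are at most \<open>\<bar>G \<xi>\<bar>\<close>.\<close>

lemma frame_vector_lower_bound:
  fixes H G :: "complex ^ 'n ^ 'n"
  assumes HG: "H ** G = mat 1" and G: "\<And>\<xi>. norm (G *v \<xi>) \<le> B * norm \<xi>" and B: "B > 0"
  shows "1 / (B\<^sup>2 * card (UNIV :: ('n \<times> bool) set)) * (norm \<xi>)\<^sup>2 \<le> (\<Sum>p\<in>UNIV. (\<xi> \<bullet> frame_vector H p)\<^sup>2)"
proof (cases "\<xi> = 0")
  case False
  define g where "g = G *v \<xi>"
  define N where "N = real (card (UNIV :: ('n \<times> bool) set))"
  have N: "N > 0" by (simp add: N_def card_gt_0_iff)
  have "\<xi> = H *v g" unfolding g_def using HG by (simp add: matrix_vector_mul_assoc)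
  also have "\<dots> = (\<Sum>k\<in>UNIV. g $ k *s (H *v axis k 1))" by (rule matrix_vector_mult_axis_sum)
  also have "\<dots> = (\<Sum>k\<in>UNIV. Re (g $ k) *\<^sub>R frame_vector H (k, False) + Im (g $ k) *\<^sub>R frame_vector H (k, True))"
    by (intro sum.cong refl) (simp add: frame_vector_def vec_eq_iff complex_eq_iff)
  finally have "\<xi> \<bullet> \<xi> = \<xi> \<bullet> (\<Sum>k\<in>UNIV. Re (g $ k) *\<^sub>R frame_vector H (k, False) + Im (g $ k) *\<^sub>R frame_vector H (k, True))"
    by simp
  also have "\<dots> = (\<Sum>k\<in>UNIV. Re (g $ k) * (\<xi> \<bullet> frame_vector H (k, False)) + Im (g $ k) * (\<xi> \<bullet> frame_vector H (k, True)))"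
    by (simp add: inner_sum_right inner_add_right)
  also have "\<dots> \<le> (\<Sum>k\<in>UNIV. norm g * \<bar>\<xi> \<bullet> frame_vector H (k, False)\<bar> + norm g * \<bar>\<xi> \<bullet> frame_vector H (k, True)\<bar>)"
  proof (intro sum_mono add_mono)
    fix k
    have n: "cmod (g $ k) \<le> norm g" using Finite_Cartesian_Product.norm_nth_le[of g k] by simp
    have "\<bar>Re (g $ k)\<bar> \<le> norm g" "\<bar>Im (g $ k)\<bar> \<le> norm g"
      using abs_Re_le_cmod[of "g $ k"] abs_Im_le_cmod[of "g $ k"] n by linarith+
    then have "\<bar>Re (g $ k) * (\<xi> \<bullet> frame_vector H (k, False))\<bar> \<le> norm g * \<bar>\<xi> \<bullet> frame_vector H (k, False)\<bar>"
      "\<bar>Im (g $ k) * (\<xi> \<bullet> frame_vector H (k, True))\<bar> \<le> norm g * \<bar>\<xi> \<bullet> frame_vector H (k, True)\<bar>"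
      unfolding abs_mult by (auto intro: mult_right_mono)
    then show "Re (g $ k) * (\<xi> \<bullet> frame_vector H (k, False)) \<le> norm g * \<bar>\<xi> \<bullet> frame_vector H (k, False)\<bar>"
      "Im (g $ k) * (\<xi> \<bullet> frame_vector H (k, True)) \<le> norm g * \<bar>\<xi> \<bullet> frame_vector H (k, True)\<bar>" by linarith+
  qed
  also have "\<dots> = norm g * (\<Sum>p\<in>UNIV. \<bar>\<xi> \<bullet> frame_vector H p\<bar>)"
    by (simp add: sum_over_pairs_with_bool sum_distrib_left algebra_simps)
  also have "\<dots> \<le> (B * norm \<xi>) * (\<Sum>p\<in>UNIV. \<bar>\<xi> \<bullet> frame_vector H p\<bar>)"
    unfolding g_def by (intro mult_right_mono G sum_nonneg) auto
  finally have "norm \<xi> * norm \<xi> \<le> norm \<xi> * (B * (\<Sum>p\<in>UNIV. \<bar>\<xi> \<bullet> frame_vector H p\<bar>))"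
    by (simp add: power2_norm_eq_inner[symmetric] power2_eq_square mult_ac)
  then have "norm \<xi> \<le> B * (\<Sum>p\<in>UNIV. \<bar>\<xi> \<bullet> frame_vector H p\<bar>)" using False by simp
  then have "(norm \<xi>)\<^sup>2 \<le> (B * (\<Sum>p\<in>UNIV. \<bar>\<xi> \<bullet> frame_vector H p\<bar>))\<^sup>2" by (intro power_mono) auto
  also have "\<dots> = B\<^sup>2 * (\<Sum>p\<in>UNIV. \<bar>\<xi> \<bullet> frame_vector H p\<bar>)\<^sup>2" by (simp add: power_mult_distrib)
  also have "\<dots> \<le> B\<^sup>2 * ((\<Sum>p\<in>UNIV. \<bar>\<xi> \<bullet> frame_vector H p\<bar>\<^sup>2) * N)"
    unfolding N_def by (intro mult_left_mono sum_squared_le_sum_of_squares) auto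
  finally have "(norm \<xi>)\<^sup>2 \<le> (B\<^sup>2 * N) * (\<Sum>p\<in>UNIV. (\<xi> \<bullet> frame_vector H p)\<^sup>2)" by (simp add: mult_ac)
  moreover have "B\<^sup>2 * N > 0" using B N by simp
  ultimately show ?thesis unfolding N_def[symmetric] by (simp add: divide_le_eq mult.commute)
qed simp

lemma norm_axis_one: "norm (axis k (1 :: complex) :: complex ^ 'n) = 1"
  by (simp add: norm_eq_1 inner_axis_axis)

context frame_bundle
begin

text \<open>One frame is transported along the radial segments that start at \<open>x\<close>.\<close>

lemma bounded_frames:
  assumes c: "c \<in> A" and x: "x \<in> chart_img c" and U: "open U" "x \<in> U"
  obtains R B H G where "R > 0" "B > 0" "ball x R \<subseteq> chart_img c \<inter> U"
    "\<And>y. y \<in> ball x R \<Longrightarrow> H y \<in> F c y \<and> H y ** G y = mat 1"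
    "\<And>y v. y \<in> ball x R \<Longrightarrow> norm (H y *v v) \<le> B * norm v"
    "\<And>y v. y \<in> ball x R \<Longrightarrow> norm (G y *v v) \<le> B * norm v"
proof -
  obtain r C where r: "r > 0" "C > 0" "ball x r \<subseteq> chart_img c" and ex:
    "\<And>y z. y \<in> ball x r \<Longrightarrow> z \<in> ball x r \<Longrightarrow> \<exists>X Y. segment_transport c y z X Y \<and>
       (\<forall>t\<in>{0..1}. norm (X t - mat 1) \<le> C * norm (z - y) \<and> norm (Y t - mat 1) \<le> C * norm (z - y))"
    by (rule segment_transport_exists[OF c x]) blast
  obtain H0 where H0: "H0 \<in> F c x" using F_nonempty[OF c x] by blast
  then obtain G0 where G0: "H0 ** G0 = mat 1" using F_invertible[OF c x H0] unfolding invertible_def by blast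
  obtain r' where r': "r' > 0" "ball x r' \<subseteq> U" using U open_contains_ball by blast
  define R where "R = min r r'"
  have xb: "x \<in> ball x r" using r by simp
  have "\<exists>X Y. segment_transport c x y X Y \<and> norm (X 1 - mat 1) \<le> C * r \<and> norm (Y 1 - mat 1) \<le> C * r"
    if "y \<in> ball x R" for y
  proof -
    have "y \<in> ball x r" "norm (y - x) \<le> r" using that by (auto simp: R_def dist_norm norm_minus_commute)
    then show ?thesis using ex[OF xb, of y] r(2) by (meson atLeastAtMost_iff mult_left_mono less_imp_le order_trans order_refl zero_le_one)
  qed
  then obtain X Y where X: "\<And>y. y \<in> ball x R \<Longrightarrow> segment_transport c x y (X y) (Y y)"
    "\<And>y. y \<in> ball x R \<Longrightarrow> norm (X y 1 - mat 1) \<le> C * r"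
    "\<And>y. y \<in> ball x R \<Longrightarrow> norm (Y y 1 - mat 1) \<le> C * r" by metis
  define H where "H = (\<lambda>y. X y 1 ** H0)"
  define G where "G = (\<lambda>y. G0 ** Y y 1)"
  obtain K where K: "K > 0" "\<And>(P :: complex ^ 'n ^ 'n) (Q :: complex ^ 'n ^ 'n). norm (P ** Q) \<le> norm P * norm Q * K"
    using bounded_bilinear.pos_bounded[OF bounded_bilinear_matrix_matrix_mult] by blast
  obtain L where L: "L > 0" "\<And>(P :: complex ^ 'n ^ 'n) v. norm (P *v v) \<le> norm P * norm v * L"
    using bounded_bilinear.pos_bounded[OF bounded_bilinear_matrix_vector_mult] by blast
  define m where "m = norm (mat 1 :: complex ^ 'n ^ 'n) + C * r"
  have m: "m \<ge> 0" using r by (simp add: m_def)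
  have Xm: "norm (X y 1) \<le> m" "norm (Y y 1) \<le> m" if "y \<in> ball x R" for y
    using X(2,3)[OF that] norm_triangle_sub[of "X y 1" "mat 1"] norm_triangle_sub[of "Y y 1" "mat 1"]
    by (auto simp: m_def)
  define B where "B = m * (norm H0 + norm G0) * K * L + 1"
  have nonneg: "0 \<le> m * norm H0 * K * L" "0 \<le> m * norm G0 * K * L" using m K L by auto
  have B0: "B > 0" using nonneg by (simp add: B_def algebra_simps)
  have bd: "norm (P *v v) \<le> B * norm v" if P: "norm P \<le> m * a * K" and a: "a = norm H0 \<or> a = norm G0" 
    for P :: "complex ^ 'n ^ 'n" and v a
  proof -
    have "norm (P *v v) \<le> norm P * norm v * L" by (rule L)
    also have "\<dots> \<le> (m * a * K) * norm v * L" using P L by (intro mult_right_mono) auto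
    also have "\<dots> = (m * a * K * L) * norm v" by (simp add: mult_ac)
    also have "\<dots> \<le> B * norm v" using a nonneg by (intro mult_right_mono) (auto simp: B_def algebra_simps)
    finally show ?thesis .
  qed
  show ?thesis
  proof (rule that[of R B H G])
    show "R > 0" using r r' by (simp add: R_def)
    show "B > 0" by fact
    show "ball x R \<subseteq> chart_img c \<inter> U" using r r' by (auto simp: R_def)
    show "H y \<in> F c y \<and> H y ** G y = mat 1" if y: "y \<in> ball x R" for y
    proof
      have yr: "y \<in> ball x r" using y by (simp add: R_def)
      show "H y \<in> F c y"
        unfolding H_def using frames_along_segment(2)[OF c r(3) xb yr X(1)[OF y] H0, of 1] by simp
      have "H y ** G y = X y 1 ** (H0 ** G0) ** Y y 1" by (simp add: H_def G_def matrix_mul_assoc)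
      also have "\<dots> = mat 1" using X(1)[OF y] unfolding G0 segment_transport_def fundamental_pair_def
        by (simp add: matrix_mul_rid)
      finally show "H y ** G y = mat 1" .
    qed
    show "norm (H y *v v) \<le> B * norm v" if y: "y \<in> ball x R" for y v
    proof (rule bd)
      have "norm (X y 1 ** H0) \<le> norm (X y 1) * norm H0 * K" by (rule K)
      also have "\<dots> \<le> m * norm H0 * K" using Xm[OF y] K by (intro mult_right_mono) auto
      finally show "norm (H y) \<le> m * norm H0 * K" by (simp add: H_def)
    qed simp
    show "norm (G y *v v) \<le> B * norm v" if y: "y \<in> ball x R" for y v
    proof (rule bd)
      have "norm (G0 ** Y y 1) \<le> norm G0 * norm (Y y 1) * K" by (rule K)
      also have "\<dots> \<le> norm G0 * m * K" using Xm[OF y] K by (intro mult_right_mono mult_left_mono) auto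
      finally show "norm (G y) \<le> m * norm G0 * K" by (simp add: G_def mult_ac)
    qed simp
  qed
qed

text \<open>The square of the norm of a section of \<open>K\<^sup>N\<close>, with the metric \<open>h\<^sup>-\<^sup>N\<close> that is dual to that on the
  anticanonical bundle.\<close>

definition sqnorm :: "nat \<Rightarrow> (('p, 'n) chart \<Rightarrow> complex ^ 'n \<Rightarrow> complex) \<Rightarrow> ('p, 'n) chart \<Rightarrow> complex ^ 'n \<Rightarrow> real" where
  "sqnorm N s c x = (cmod (s c x))\<^sup>2 * exp (- real N * lam c x)"

lemma sqnorm_transition:
  assumes s: "s \<in> pluricanonical_sections A N" and c: "c \<in> A" "d \<in> A" and x: "x \<in> overlap c d"
  shows "sqnorm N s d (transition c d x) = sqnorm N s c x"
proof -
  define J where "J = cmod (det (jacobian c d x))"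
  have J: "J > 0" using det_jacobian_nonzero[OF c x] by (simp add: J_def)
  have "s c x = det (jacobian c d x) ^ N * s d (transition c d x)"
    using s c x unfolding pluricanonical_sections_def jacobian_def by blast
  then have "(cmod (s c x))\<^sup>2 = (J ^ N)\<^sup>2 * (cmod (s d (transition c d x)))\<^sup>2"
    by (simp add: norm_mult norm_power J_def power_mult_distrib)
  moreover have "exp (- real N * lam c x) = exp (- real N * lam d (transition c d x)) * inverse ((J ^ N)\<^sup>2)"
  proof -
    have "- real N * lam c x = - real N * lam d (transition c d x) - real (N * 2) * ln J"
      unfolding lam_transition[OF c x] J_def by (simp add: algebra_simps)
    then have "exp (- real N * lam c x) = exp (- real N * lam d (transition c d x)) * inverse (exp (real (N * 2) * ln J))"
      by (simp only: exp_diff divide_inverse)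
    also have "exp (real (N * 2) * ln J) = J ^ (N * 2)" using J by (metis exp_ln exp_of_nat_mult)
    finally show ?thesis by (simp add: power_mult)
  qed
  ultimately show ?thesis using J by (simp add: sqnorm_def)
qed

lemma sqnorm_continuous:
  assumes s: "s \<in> pluricanonical_sections A N" and c: "c \<in> A"
  shows "continuous_on (chart_img c) (sqnorm N s c)"
proof -
  have "continuous_on (chart_img c) (s c)"
    using s c unfolding pluricanonical_sections_def by (blast intro: holomorphic_fun_continuous_on)
  moreover have "continuous_on (chart_img c) (lam c)"
    by (intro continuous_at_imp_continuous_on ballI has_derivative_continuous[OF lam_has_derivative[OF c]])
  ultimately show ?thesis unfolding sqnorm_def[abs_def] by (intro continuous_intros)
qed

text \<open>The coefficient of the section contributes a harmonic function on the complex line through \<open>x\<close>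
  in the direction \<open>u\<close>.  What remains is the curvature of the metric.\<close>

lemma ln_sqnorm_second_deriv:
  assumes s: "s \<in> pluricanonical_sections A N" and c: "c \<in> A" and x: "x \<in> chart_img c"
    and nz: "s c x \<noteq> 0"
  obtains a b where "has_second_deriv_0 (\<lambda>t. ln (sqnorm N s c (x + t *\<^sub>R u))) a"
    "has_second_deriv_0 (\<lambda>t. ln (sqnorm N s c (x + t *\<^sub>R (\<i> *s u)))) b"
    "a + b = 2 * real N * ricci_form \<Gamma> c x u (\<i> *s u)"
proof -
  have hol: "holomorphic_fun (chart_img c) (s c)"
    using s c unfolding pluricanonical_sections_def by blast
  define f where "f = (\<lambda>\<zeta>. s c (x + \<zeta> *s u))"
  have "f holomorphic_on {\<zeta>. x + \<zeta> *s u \<in> chart_img c}"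
    unfolding f_def by (rule holomorphic_fun_line[OF hol])
  from ln_cmod_holomorphic_second_deriv[OF this open_complex_line_vimage[OF open_img[OF c]]]
  obtain k where k: "has_second_deriv_0 (\<lambda>t. ln (cmod (f (of_real t)))) k"
    "has_second_deriv_0 (\<lambda>t. ln (cmod (f (\<i> * of_real t)))) (- k)"
    using x nz by (auto simp: f_def)
  have f1: "f (of_real t) = s c (x + t *\<^sub>R u)" and f2: "f (\<i> * of_real t) = s c (x + t *\<^sub>R (\<i> *s u))" for t
    by (simp_all add: f_def scaleR_conv_vector_scalar_mult vector_smult_assoc mult.commute)
  have key: "has_second_deriv_0 (\<lambda>t. ln (sqnorm N s c (x + t *\<^sub>R v))) (2 * l + - real N * (2 * Re (dtheta c x v v)))"
    if l: "has_second_deriv_0 (\<lambda>t. ln (cmod (s c (x + t *\<^sub>R v)))) l" for l v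
  proof (rule has_second_deriv_0_cong)
    show "has_second_deriv_0 (\<lambda>t. 2 * ln (cmod (s c (x + t *\<^sub>R v))) + - real N * lam c (x + t *\<^sub>R v)) (2 * l + - real N * (2 * Re (dtheta c x v v)))"
      by (intro has_second_deriv_0_add has_second_deriv_0_cmult l lam_second_deriv c x)
    have "open (chart_img c \<inter> s c -` (- {0}))"
      by (rule continuous_open_preimage[OF holomorphic_fun_continuous_on[OF hol] open_img[OF c]]) auto
    moreover have "((\<lambda>t. x + t *\<^sub>R v) \<longlongrightarrow> x + 0 *\<^sub>R v) (nhds 0)"
      by (intro tendsto_intros filterlim_ident)
    ultimately have "\<forall>\<^sub>F t in nhds 0. x + t *\<^sub>R v \<in> chart_img c \<inter> s c -` (- {0})"
      using x nz topological_tendstoD by fastforce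
    then show "\<forall>\<^sub>F t in nhds 0. ln (sqnorm N s c (x + t *\<^sub>R v)) = 2 * ln (cmod (s c (x + t *\<^sub>R v))) + - real N * lam c (x + t *\<^sub>R v)"
      by eventually_elim (simp add: sqnorm_def ln_mult ln_realpow)
  qed
  show ?thesis
    by (rule that[OF key[OF k(1)[unfolded f1]] key[OF k(2)[unfolded f2]]])
      (simp add: ricci_form_I[OF c x] algebra_simps)
qed

text \<open>By the hypothesis \<open>tr\<close> the logarithm of the norm is annihilated by the elliptic operator that belongs
  to bounded frames of the bundle.\<close>

lemma sqnorm_locally_constant_at_max:
  assumes s: "s \<in> pluricanonical_sections A N" and c: "c \<in> A" and x0: "x0 \<in> chart_img c"
    and tr: "\<And>c x H. c \<in> A \<Longrightarrow> x \<in> chart_img c \<Longrightarrow> H \<in> F c x \<Longrightarrow>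
       (\<Sum>k\<in>UNIV. ricci_form \<Gamma> c x (H *v axis k 1) (\<i> *s (H *v axis k 1))) = 0"
    and max: "\<And>x. x \<in> chart_img c \<Longrightarrow> sqnorm N s c x \<le> sqnorm N s c x0" and pos: "0 < sqnorm N s c x0"
  shows "\<exists>r>0. ball x0 r \<subseteq> chart_img c \<and> (\<forall>x\<in>ball x0 r. sqnorm N s c x = sqnorm N s c x0)"
proof -
  have hol: "holomorphic_fun (chart_img c) (s c)"
    using s c unfolding pluricanonical_sections_def by blast
  let ?U = "chart_img c \<inter> s c -` (- {0})"
  have U: "open ?U"
    by (rule continuous_open_preimage[OF holomorphic_fun_continuous_on[OF hol] open_img[OF c]]) auto
  have x0U: "x0 \<in> ?U" using x0 pos by (auto simp: sqnorm_def)
  obtain R B H G where R: "R > 0" "B > 0" "ball x0 R \<subseteq> chart_img c \<inter> ?U"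
    and fr: "\<And>y. y \<in> ball x0 R \<Longrightarrow> H y \<in> F c y \<and> H y ** G y = mat 1"
    and bdH: "\<And>y v. y \<in> ball x0 R \<Longrightarrow> norm (H y *v v) \<le> B * norm v"
    and bdG: "\<And>y v. y \<in> ball x0 R \<Longrightarrow> norm (G y *v v) \<le> B * norm v"
    by (rule bounded_frames[OF c x0 U x0U]) blast
  have in_img: "y \<in> chart_img c" and nz: "s c y \<noteq> 0" if "y \<in> ball x0 R" for y
    using that R(3) by auto
  have sp: "sqnorm N s c y > 0" if "y \<in> ball x0 R" for y
    using nz[OF that] by (simp add: sqnorm_def)
  define \<psi> where "\<psi> = (\<lambda>x. ln (sqnorm N s c x))"
  define card2 where "card2 = real (card (UNIV :: ('n \<times> bool) set))"
  have c2: "card2 > 0" by (simp add: card2_def card_gt_0_iff)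
  have const: "\<psi> y = \<psi> x0" if y: "y \<in> ball x0 (R / 2)" for y
  proof (rule strong_maximum_principle[where K = "UNIV :: ('n \<times> bool) set" and e = "\<lambda>p x. frame_vector (H x) p"
        and \<Lambda> = "card2 * B\<^sup>2" and l = "1 / (B\<^sup>2 * card2)" and R = R, OF _ R(1) _ _ refl _ _ _ _ y])
    show "continuous_on (ball x0 R) \<psi>"
      unfolding \<psi>_def using R(3) sp
      by (intro continuous_on_ln continuous_on_subset[OF sqnorm_continuous[OF s c]]) (auto simp: less_imp_neq[symmetric])
    show "\<psi> x \<le> \<psi> x0" if "x \<in> ball x0 R" for x
      unfolding \<psi>_def using max[OF in_img[OF that]] sp[OF that] pos by simp
    show "(\<Sum>p\<in>UNIV. (norm (frame_vector (H x) p))\<^sup>2) \<le> card2 * B\<^sup>2" if x: "x \<in> ball x0 R" for x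
    proof -
      have "norm (frame_vector (H x) p) \<le> B" for p
        using bdH[OF x, of "axis (fst p) 1"] by (simp add: frame_vector_def norm_axis_one)
      then have "(norm (frame_vector (H x) p))\<^sup>2 \<le> B\<^sup>2" for p by (intro power_mono) auto
      then show ?thesis unfolding card2_def by (intro sum_bounded_above)
    qed
    show "1 / (B\<^sup>2 * card2) * (norm \<xi>)\<^sup>2 \<le> (\<Sum>p\<in>UNIV. (\<xi> \<bullet> frame_vector (H x) p)\<^sup>2)" if x: "x \<in> ball x0 R" for x \<xi>
      unfolding card2_def using fr[OF x] bdG[OF x] R(2) by (intro frame_vector_lower_bound) auto
    show "0 < 1 / (B\<^sup>2 * card2)" using R(2) c2 by simp
    show "\<exists>d. (\<forall>p\<in>UNIV. has_second_deriv_0 (\<lambda>t. \<psi> (x + t *\<^sub>R frame_vector (H x) p)) (d p)) \<and> 0 \<le> (\<Sum>p\<in>UNIV. d p)"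
      if x: "x \<in> ball x0 R" for x
    proof -
      let ?v = "\<lambda>k. H x *v axis k 1"
      have "\<exists>a b. has_second_deriv_0 (\<lambda>t. \<psi> (x + t *\<^sub>R ?v k)) a \<and> has_second_deriv_0 (\<lambda>t. \<psi> (x + t *\<^sub>R (\<i> *s ?v k))) b \<and>
          a + b = 2 * real N * ricci_form \<Gamma> c x (?v k) (\<i> *s ?v k)" for k
        unfolding \<psi>_def by (rule ln_sqnorm_second_deriv[OF s c in_img[OF x] nz[OF x], of "?v k"]) blast
      then obtain a b where ab: "\<And>k. has_second_deriv_0 (\<lambda>t. \<psi> (x + t *\<^sub>R ?v k)) (a k)"
        "\<And>k. has_second_deriv_0 (\<lambda>t. \<psi> (x + t *\<^sub>R (\<i> *s ?v k))) (b k)"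
        "\<And>k. a k + b k = 2 * real N * ricci_form \<Gamma> c x (?v k) (\<i> *s ?v k)" by metis
      define d where "d = (\<lambda>p. if snd p then b (fst p) else a (fst p))"
      have "(\<Sum>p\<in>UNIV. d p) = (\<Sum>k\<in>UNIV. a k + b k)"
        by (simp add: sum_over_pairs_with_bool d_def)
      also have "\<dots> = 2 * real N * (\<Sum>k\<in>UNIV. ricci_form \<Gamma> c x (?v k) (\<i> *s ?v k))"
        by (simp only: ab(3) sum_distrib_left)
      also have "\<dots> = 0" using tr[OF c in_img[OF x]] fr[OF x] by simp
      finally show ?thesis
        using ab(1,2) by (intro exI[of _ d]) (auto simp: d_def frame_vector_def)
    qed
  qed simp
  show ?thesis
  proof (intro exI conjI ballI)
    show "R / 2 > 0" using R by simp
    show "ball x0 (R / 2) \<subseteq> chart_img c" using R by (auto simp: subset_iff)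
    fix y assume y: "y \<in> ball x0 (R / 2)"
    then have "sqnorm N s c y > 0" using R(1) by (intro sp) auto
    then show "sqnorm N s c y = sqnorm N s c x0" using const[OF y] pos by (simp add: \<psi>_def)
  qed
qed

text \<open>On a compact connected manifold the maximum principle propagates, so that a non-zero section
  has constant positive norm.  Then \<open>lam\<close> is pluriharmonic, i.e. \<open>\<rho> = 0\<close>.\<close>

theorem ricci_flat_if_pluricanonical_section:
  assumes compact: "compact (UNIV :: 'p set)" and connected: "connected (UNIV :: 'p set)"
    and tr: "\<And>c x H. c \<in> A \<Longrightarrow> x \<in> chart_img c \<Longrightarrow> H \<in> F c x \<Longrightarrow>
       (\<Sum>k\<in>UNIV. ricci_form \<Gamma> c x (H *v axis k 1) (\<i> *s (H *v axis k 1))) = 0"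
    and N: "N \<ge> 1" and s: "s \<in> pluricanonical_sections A N" and s0: "s \<noteq> (\<lambda>c x. 0)"
    and c: "c \<in> A" and x: "x \<in> chart_img c"
  shows "ricci_form \<Gamma> c x u v = 0"
proof -
  define ch where "ch = (\<lambda>q. SOME c. c \<in> A \<and> q \<in> chart_dom c)"
  have ch: "ch q \<in> A" "q \<in> chart_dom (ch q)" for q
    using someI_ex[of "\<lambda>c. c \<in> A \<and> q \<in> chart_dom c"] charts_cover[of q] unfolding ch_def by blast+
  define \<Phi> where "\<Phi> = (\<lambda>q. sqnorm N s (ch q) (snd (ch q) q))"
  have \<Phi>: "\<Phi> q = sqnorm N s c (snd c q)" if c: "c \<in> A" and q: "q \<in> chart_dom c" for c q
  proof -
    have "snd c q \<in> overlap c (ch q)" using c q ch[of q] by (auto simp: overlap_def)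
    from sqnorm_transition[OF s c ch(1)[of q] this] show ?thesis
      using c q by (simp add: \<Phi>_def transition_eq)
  qed
  have \<Phi>x: "\<Phi> (point c x) = sqnorm N s c x" if "c \<in> A" "x \<in> chart_img c" for c x
    using \<Phi>[OF that(1) point_in[OF that]] that by simp
  have cont: "continuous_on UNIV \<Phi>"
  proof (rule continuous_at_imp_continuous_on, rule ballI)
    fix q :: 'p
    have snd_cont: "continuous_on (chart_dom (ch q)) (snd (ch q))"
      using homeo[OF ch(1)[of q]] by (simp add: homeomorphism_def)
    have "continuous_on (chart_dom (ch q)) (\<lambda>p. sqnorm N s (ch q) (snd (ch q) p))"
      by (rule continuous_on_compose2[OF sqnorm_continuous[OF s ch(1)[of q]] snd_cont]) auto
    then have "continuous_on (chart_dom (ch q)) \<Phi>"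
      by (rule continuous_on_eq) (simp add: \<Phi>[OF ch(1)])
    then show "isCont \<Phi> q"
      using continuous_on_eq_continuous_at[OF open_dom[OF ch(1)[of q]]] ch(2)[of q] by blast
  qed
  obtain m where m: "\<And>q. \<Phi> q \<le> \<Phi> m"
    using continuous_attains_sup[OF compact _ cont] by auto
  have pos: "\<Phi> m > 0"
  proof -
    obtain d y where nz: "s d y \<noteq> 0" using s0 by (auto simp: fun_eq_iff)
    then have d: "d \<in> A" "y \<in> chart_img d" using s unfolding pluricanonical_sections_def by blast+
    have "\<Phi> (point d y) > 0" unfolding \<Phi>x[OF d] using nz by (simp add: sqnorm_def)
    then show ?thesis using m[of "point d y"] by simp
  qed
  define Z where "Z = {q. \<Phi> q = \<Phi> m}"
  have "closed Z" unfolding Z_def by (intro closed_Collect_eq cont continuous_on_const)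
  moreover have "open Z"
  proof (subst open_subopen, rule ballI)
    fix q assume q: "q \<in> Z"
    define d where "d = ch q"
    have d: "d \<in> A" "q \<in> chart_dom d" using ch by (auto simp: d_def)
    define x0 where "x0 = snd d q"
    have x0: "x0 \<in> chart_img d" using d by (auto simp: x0_def)
    have M: "sqnorm N s d x0 = \<Phi> m" using q \<Phi>[OF d] by (simp add: Z_def x0_def)
    have "\<exists>r>0. ball x0 r \<subseteq> chart_img d \<and> (\<forall>x\<in>ball x0 r. sqnorm N s d x = sqnorm N s d x0)"
    proof (rule sqnorm_locally_constant_at_max[OF s d(1) x0 tr])
      show "sqnorm N s d x \<le> sqnorm N s d x0" if "x \<in> chart_img d" for x
        unfolding M using m[of "point d x"] \<Phi>x[OF d(1) that] by simp
    qed (use M pos in auto)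
    then obtain r where r: "r > 0" "ball x0 r \<subseteq> chart_img d" "\<And>x. x \<in> ball x0 r \<Longrightarrow> sqnorm N s d x = \<Phi> m"
      using M by auto
    have "open (chart_dom d \<inter> snd d -` ball x0 r)"
      using homeo[OF d(1)] open_dom[OF d(1)] by (intro continuous_open_preimage) (auto simp: homeomorphism_def)
    moreover have "q \<in> chart_dom d \<inter> snd d -` ball x0 r" using d r by (simp add: x0_def)
    moreover have "chart_dom d \<inter> snd d -` ball x0 r \<subseteq> Z"
      using r(3) \<Phi>[OF d(1)] by (auto simp: Z_def)
    ultimately show "\<exists>T. open T \<and> q \<in> T \<and> T \<subseteq> Z" by blast
  qed
  ultimately have "Z = UNIV"
    using connected unfolding connected_clopen open_openin[symmetric] closed_closedin[symmetric] 
    by (auto simp: Z_def)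
  then have all: "\<Phi> q = \<Phi> m" for q by (auto simp: Z_def)
  have sq: "sqnorm N s c y = \<Phi> m" if "y \<in> chart_img c" for y
    using all[of "point c y"] \<Phi>x[OF c that] by simp
  have nz: "s c x \<noteq> 0" using sq[OF x] pos by (auto simp: sqnorm_def)
  have zero: "a = 0" if a: "has_second_deriv_0 (\<lambda>t. ln (sqnorm N s c (x + t *\<^sub>R w))) a" for a w
  proof -
    have "((\<lambda>t. x + t *\<^sub>R w) \<longlongrightarrow> x + 0 *\<^sub>R w) (nhds 0)"
      by (intro tendsto_intros filterlim_ident)
    then have ev: "\<forall>\<^sub>F t in nhds 0. x + t *\<^sub>R w \<in> chart_img c"
      using x open_img[OF c] topological_tendstoD by fastforce
    have "a \<le> 0"
      by (rule has_second_deriv_0_local_max[OF a]) (use ev in \<open>eventually_elim, simp add: sq x\<close>)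
    moreover have "(- 1) * a \<le> 0"
      by (rule has_second_deriv_0_local_max[OF has_second_deriv_0_cmult[OF a]])
        (use ev in \<open>eventually_elim, simp add: sq x\<close>)
    ultimately show ?thesis by simp
  qed
  have "ricci_form \<Gamma> c x u (\<i> *s u) = 0" for u
  proof -
    obtain a b where "has_second_deriv_0 (\<lambda>t. ln (sqnorm N s c (x + t *\<^sub>R u))) a"
      "has_second_deriv_0 (\<lambda>t. ln (sqnorm N s c (x + t *\<^sub>R (\<i> *s u)))) b"
      and ab: "a + b = 2 * real N * ricci_form \<Gamma> c x u (\<i> *s u)"
      by (rule ln_sqnorm_second_deriv[OF s c x nz])
    then have "a = 0" "b = 0" using zero by blast+
    then show ?thesis using ab N by simp
  qed
  then show ?thesis by (rule ricci_form_zeroI[OF c x])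
qed

end

section \<open>Polygonal parallel transport and holonomy\<close>

lemma vector_derivative_cong_within:
  assumes "t \<in> S" "\<And>s. s \<in> S \<Longrightarrow> f s = g s"
  shows "vector_derivative f (at t within S) = vector_derivative g (at t within S)"
proof -
  have "(f has_vector_derivative D) (at t within S) \<longleftrightarrow> (g has_vector_derivative D) (at t within S)" for D
    using has_vector_derivative_transform[of t S f g D] has_vector_derivative_transform[of t S g f D] assms by metis
  then show ?thesis by (simp add: vector_derivative_def)
qed

lemma has_vector_derivative_vec_components:
  fixes f :: "real \<Rightarrow> complex ^ 'n"
  assumes "\<And>k. ((\<lambda>x. f x $ k) has_vector_derivative D $ k) (at x within S)"
  shows "(f has_vector_derivative D) (at x within S)"
  using assms unfolding has_vector_derivative_def by (intro has_derivative_vec_components) simp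

lemma has_vector_derivative_shift:
  fixes f :: "real \<Rightarrow> 'a::real_normed_vector"
  assumes "(f has_vector_derivative D) (at (t - K) within {0..1})"
  shows "((\<lambda>s. f (s - K)) has_vector_derivative D) (at t within {K..K+1})"
proof -
  have m: "((\<lambda>s. s - K) has_vector_derivative 1) (at t within {K..K+1})"
    unfolding has_real_derivative_iff_has_vector_derivative[symmetric] by (auto intro!: derivative_eq_intros)
  have "(\<lambda>s. s - K) ` {K..K+1} = {0..1}" by (simp add: image_minus_const_atLeastAtMost' add.commute)
  with vector_diff_chain_within[OF m, of f D] assms show ?thesis by (simp add: o_def)
qed

context complex_connection
begin

text \<open>Parallel transport along finitely many segments in charts, as a linear map between coordinate
  tangent spaces.  Composition (\<open>transports_trans\<close>) and inverses (\<open>transports_sym\<close>) make it a groupoid, so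
  that two transports between the same points differ by the transport around a loop.\<close>

inductive transports :: "('p, 'n) chart \<Rightarrow> complex ^ 'n \<Rightarrow> ('p, 'n) chart \<Rightarrow> complex ^ 'n \<Rightarrow> complex ^ 'n ^ 'n \<Rightarrow> bool"
  for c x where
  start: "c \<in> A \<Longrightarrow> x \<in> chart_img c \<Longrightarrow> transports c x c x (mat 1)"
| segment: "transports c x d y P \<Longrightarrow> segment_transport d y z X Y \<Longrightarrow> closed_segment y z \<subseteq> chart_img d \<Longrightarrow>
     transports c x d z (X 1 ** P)"
| change_chart: "transports c x d y P \<Longrightarrow> e \<in> A \<Longrightarrow> y \<in> overlap d e \<Longrightarrow>
     transports c x e (transition d e y) (jacobian d e y ** P)"

lemma transports_in:
  assumes "transports c x d y P"
  shows "c \<in> A \<and> x \<in> chart_img c \<and> d \<in> A \<and> y \<in> chart_img d"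
  using assms
proof induction
  case (change_chart d y P e)
  then show ?case using transition_in[of d e y] overlap_subset[of e "transition d e y" d] by blast
qed auto

lemma transports_trans:
  assumes "transports d y e z Q" "transports c x d y P"
  shows "transports c x e z (Q ** P)"
  using assms
proof induction
  case start
  then show ?case by simp
next
  case (segment d' y' P' z X Y)
  then show ?case using transports.segment[of c x d' y' "P' ** P" z X Y] by (simp add: matrix_mul_assoc)
next
  case (change_chart d' y' P' e)
  then show ?case using transports.change_chart[of c x d' y' "P' ** P" e] by (simp add: matrix_mul_assoc)
qed

lemma transports_sym:
  assumes "transports c x d y P"
  shows "\<exists>Q. transports d y c x Q \<and> Q ** P = mat 1"
  using assms
proof induction
  case start
  then show ?case using transports.start by fastforce
next
  case (segment d y P z X Y)
  then obtain Q where Q: "transports d y c x Q" "Q ** P = mat 1" by blast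
  have d: "d \<in> A" "z \<in> chart_img d" using segment transports_in by auto
  have seg: "closed_segment z y \<subseteq> chart_img d" using segment by (simp add: closed_segment_commute)
  have F: "X 0 = mat 1" "Y 1 ** X 1 = mat 1" using segment(2) by (simp_all add: segment_transport_def fundamental_pair_def)
  have "transports d z d y (X (1 - 1) ** Y 1 ** mat 1)"
    by (rule transports.segment[OF transports.start[OF d] segment_transport_reverse[OF segment(2,3) d(1)] seg])
  then have "transports d z d y (Y 1)" using F by simp
  from transports_trans[OF Q(1) this] have "transports d z c x (Q ** Y 1)" .
  moreover have "Q ** Y 1 ** (X 1 ** P) = mat 1"
  proof -
    have "Q ** Y 1 ** (X 1 ** P) = Q ** (Y 1 ** X 1) ** P" by (simp add: matrix_mul_assoc)
    then show ?thesis using F Q by simp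
  qed
  ultimately show ?case by blast
next
  case (change_chart d y P e)
  then obtain Q where Q: "transports d y c x Q" "Q ** P = mat 1" by blast
  have d: "d \<in> A" "e \<in> A" using change_chart transports_in by auto
  let ?J = "jacobian e d (transition d e y)"
  have ov: "transition d e y \<in> overlap e d" using transition_in[OF d change_chart(3)] .
  have "transports e (transition d e y) d (transition e d (transition d e y)) (?J ** mat 1)"
    by (rule transports.change_chart[OF transports.start d(1) ov]) (use d ov overlap_subset in auto)
  moreover have "transition e d (transition d e y) = y"
    using transition_transition[OF d change_chart(3), of d] transition_self[OF d(1)] overlap_subset[OF d(1) change_chart(3)] by simp
  ultimately have "transports e (transition d e y) d y ?J" by simp
  from transports_trans[OF Q(1) this] have "transports e (transition d e y) c x (Q ** ?J)" .
  moreover have "Q ** ?J ** (jacobian d e y ** P) = mat 1"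
  proof -
    have "Q ** ?J ** (jacobian d e y ** P) = Q ** (?J ** jacobian d e y) ** P" by (simp add: matrix_mul_assoc)
    then show ?thesis using jacobian_inverse(1)[OF d change_chart(3)] Q by simp
  qed
  ultimately show ?case by blast
qed

text \<open>The polygonal path that underlies a transport is built on the interval \<open>[0,K]\<close>, with one unit of
  time for each segment, so that appending a segment does not change the earlier part.\<close>

definition smooth_path :: "real \<Rightarrow> real set \<Rightarrow> (real \<Rightarrow> 'p) \<Rightarrow> bool" where
  "smooth_path K Q \<gamma> \<longleftrightarrow> 0 \<le> K \<and> continuous_on {0..K} \<gamma> \<and> finite Q \<and> {0, K} \<subseteq> Q \<and> Q \<subseteq> {0..K} \<and>
     (\<forall>a b. consecutive Q a b \<longrightarrow> smooth_curve A a b \<gamma>)"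

definition parallel_on :: "real \<Rightarrow> real set \<Rightarrow> (real \<Rightarrow> 'p) \<Rightarrow> (('p, 'n) chart \<Rightarrow> real \<Rightarrow> complex ^ 'n) \<Rightarrow> bool" where
  "parallel_on K Q \<gamma> V \<longleftrightarrow>
     (\<forall>c\<in>A. \<forall>d\<in>A. \<forall>t\<in>{0..K}. \<gamma> t \<in> chart_dom c \<inter> chart_dom d \<longrightarrow>
        V d t = dtrans c d (snd c (\<gamma> t)) (V c t)) \<and>
     (\<forall>a b. consecutive Q a b \<longrightarrow> (\<forall>c\<in>A. \<forall>t\<in>{a..b}. \<gamma> t \<in> chart_dom c \<longrightarrow>
        (V c has_vector_derivative
           - \<Gamma> c (snd c (\<gamma> t)) (vector_derivative (snd c \<circ> \<gamma>) (at t within {a..b})) (V c t))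
          (at t within {a..b})))"

lemma parallel_on_chart:
  "parallel_on K Q \<gamma> V \<Longrightarrow> c \<in> A \<Longrightarrow> d \<in> A \<Longrightarrow> t \<in> {0..K} \<Longrightarrow> \<gamma> t \<in> chart_dom c \<Longrightarrow> \<gamma> t \<in> chart_dom d \<Longrightarrow>
     V d t = dtrans c d (snd c (\<gamma> t)) (V c t)"
  unfolding parallel_on_def by blast

lemma parallel_on_derivative:
  "parallel_on K Q \<gamma> V \<Longrightarrow> consecutive Q a b \<Longrightarrow> c \<in> A \<Longrightarrow> t \<in> {a..b} \<Longrightarrow> \<gamma> t \<in> chart_dom c \<Longrightarrow>
     (V c has_vector_derivative
        - \<Gamma> c (snd c (\<gamma> t)) (vector_derivative (snd c \<circ> \<gamma>) (at t within {a..b})) (V c t)) (at t within {a..b})"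
  unfolding parallel_on_def by blast

lemma smooth_curve_cong:
  assumes s: "smooth_curve A a b \<gamma>" and eq: "\<And>t. t \<in> {a..b} \<Longrightarrow> \<gamma>' t = \<gamma> t"
  shows "smooth_curve A a b \<gamma>'"
  unfolding smooth_curve_def
proof
  fix c assume "c \<in> A"
  then obtain D where D: "D 0 = snd c \<circ> \<gamma>" "\<And>k t. t \<in> {a..b} \<Longrightarrow> \<gamma> t \<in> chart_dom c \<Longrightarrow>
           (D k has_vector_derivative D (Suc k) t) (at t within {a..b})"
    using s unfolding smooth_curve_def by blast
  define D' where "D' = (\<lambda>k. if k = 0 then snd c \<circ> \<gamma>' else D k)"
  have "(D' k has_vector_derivative D' (Suc k) t) (at t within {a..b})"
    if t: "t \<in> {a..b}" "\<gamma>' t \<in> chart_dom c" for k t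
  proof -
    have "(D k has_vector_derivative D (Suc k) t) (at t within {a..b})" using D(2) t eq by simp
    then have "(D' k has_vector_derivative D (Suc k) t) (at t within {a..b})"
      by (rule has_vector_derivative_transform[OF t(1), rotated]) (simp add: D'_def D(1) eq)
    then show ?thesis by (simp add: D'_def)
  qed
  then show "\<exists>D. D 0 = snd c \<circ> \<gamma>' \<and> (\<forall>k. \<forall>t\<in>{a..b}. \<gamma>' t \<in> chart_dom c \<longrightarrow>
      (D k has_vector_derivative D (Suc k) t) (at t within {a..b}))"
    by (intro exI[of _ D']) (auto simp: D'_def)
qed

text \<open>In any other chart the segment is the restriction of a holomorphic curve to real times.  The
  derivatives of all orders are complex derivatives of this curve.\<close>

lemma smooth_curve_segment:
  assumes d: "d \<in> A" and img: "closed_segment y z \<subseteq> chart_img d"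
    and \<gamma>: "\<And>t. t \<in> {K..K+1} \<Longrightarrow> \<gamma> t = point d (y + (t - K) *\<^sub>R (z - y))"
  shows "smooth_curve A K (K + 1) \<gamma>"
  unfolding smooth_curve_def
proof
  fix c assume c: "c \<in> A"
  define f where "f = (\<lambda>i \<zeta>. transition d c (y + \<zeta> *s (z - y)) $ i)"
  define W where "W = {\<zeta>. y + \<zeta> *s (z - y) \<in> overlap d c}"
  have W: "open W" unfolding W_def by (rule open_complex_line_vimage[OF open_overlap[OF d c]])
  have hol: "f i holomorphic_on W" for i
    unfolding f_def W_def by (rule holomorphic_fun_line[OF holomorphic_transition[OF d c]])
  define E where "E = (\<lambda>k t. \<chi> i. (deriv ^^ k) (f i) (of_real t))"
  define D where "D = (\<lambda>k t. if k = 0 then (snd c \<circ> \<gamma>) t else E k (t - K))"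
  have D0: "D 0 t = E 0 (t - K)" if "t \<in> {K..K+1}" for t
    using \<gamma>[OF that] by (simp add: D_def E_def f_def transition_eq vec_eq_iff scaleR_conv_vector_scalar_mult)
  have "(D k has_vector_derivative D (Suc k) t) (at t within {K..K+1})"
    if t: "t \<in> {K..K+1}" and dom: "\<gamma> t \<in> chart_dom c" for k t
  proof -
    have "y + (t - K) *\<^sub>R (z - y) \<in> closed_segment y z"
      unfolding in_segment using t by (intro exI[of _ "t - K"]) (simp add: algebra_simps)
    then have "y + (t - K) *\<^sub>R (z - y) \<in> overlap d c"
      using img \<gamma>[OF t] dom by (auto simp: overlap_iff[OF d])
    then have "of_real (t - K) \<in> W" by (simp add: W_def scaleR_conv_vector_scalar_mult)
    from higher_deriv_of_real_has_vector_derivative[OF hol W this]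
    have "(E k has_vector_derivative E (Suc k) (t - K)) (at (t - K) within {0..1})"
      unfolding E_def by (intro has_vector_derivative_vec_components) (simp del: funpow.simps)
    from has_vector_derivative_shift[OF this]
    have "((\<lambda>s. E k (s - K)) has_vector_derivative D (Suc k) t) (at t within {K..K+1})" by (simp add: D_def)
    then show ?thesis
      by (rule has_vector_derivative_transform[OF t, rotated]) (use D0 in \<open>auto simp: D_def\<close>)
  qed
  then show "\<exists>D. D 0 = snd c \<circ> \<gamma> \<and> (\<forall>k. \<forall>t\<in>{K..K+1}. \<gamma> t \<in> chart_dom c \<longrightarrow>
      (D k has_vector_derivative D (Suc k) t) (at t within {K..K+1}))"
    by (intro exI[of _ D]) (auto simp: D_def)
qed

lemma consecutive_insert_end:
  assumes Q: "K \<in> Q" "Q \<subseteq> {0..K}" and ab: "consecutive (insert (K + 1) Q) a b"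
  shows "(consecutive Q a b \<and> 0 \<le> a \<and> b \<le> K) \<or> (a = K \<and> b = K + 1)"
proof (cases "b = K + 1")
  case True
  then have "a \<in> Q" using ab by (auto simp: consecutive_def)
  moreover have "\<not> a < K" using ab Q True by (auto simp: consecutive_def)
  ultimately show ?thesis using Q True by force
next
  case False
  then have "b \<in> Q" "a \<in> Q" using ab Q by (auto simp: consecutive_def)
  then show ?thesis using ab Q by (auto simp: consecutive_def)
qed

text \<open>In another chart the coordinate expression of a parallel field along a straight segment is
  parallel as well: this is the transformation law of the Christoffel symbols.\<close>

lemma parallel_in_other_chart:
  assumes d: "d \<in> A" and c: "c \<in> A" and img: "closed_segment y z \<subseteq> chart_img d"
    and X: "segment_transport d y z X Y" and t: "t \<in> {K..K+1}"
    and ov: "y + (t - K) *\<^sub>R (z - y) \<in> overlap d c"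
  defines "l \<equiv> \<lambda>t. y + (t - K) *\<^sub>R (z - y)"
  shows "((\<lambda>s. jacobian d c (l s) *v (X (s - K) *v w)) has_vector_derivative
     - \<Gamma> c (transition d c (l t)) (dtrans d c (l t) (z - y)) (jacobian d c (l t) *v (X (t - K) *v w))) (at t within {K..K+1})"
    and "((\<lambda>s. transition d c (l s)) has_vector_derivative dtrans d c (l t) (z - y)) (at t within {K..K+1})"
proof -
  have ov': "l t \<in> overlap d c" using ov by (simp add: l_def)
  have lder: "(l has_vector_derivative (z - y)) (at t within {K..K+1})"
    unfolding l_def has_vector_derivative_def by (auto intro!: derivative_eq_intros)
  have comp: "((\<lambda>s. g (l s)) has_vector_derivative g' (z - y)) (at t within {K..K+1})"
    if "(g has_derivative g') (at (l t))" for g :: "complex ^ 'n \<Rightarrow> complex ^ 'n" and g'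
    using has_derivative_compose[OF lder[unfolded has_vector_derivative_def] that] has_derivative_linear[OF that]
    by (simp add: has_vector_derivative_def linear_scale)
  show "((\<lambda>s. transition d c (l s)) has_vector_derivative dtrans d c (l t) (z - y)) (at t within {K..K+1})"
    by (rule comp[OF transition_has_derivative[OF d c ov']])
  have Lder: "((\<lambda>s. jacobian d c (l s) *v v) has_vector_derivative d2trans d c (l t) (z - y) v) (at t within {K..K+1})" for v
  proof (rule comp)
    show "((\<lambda>y. jacobian d c y *v v) has_derivative (\<lambda>u. d2trans d c (l t) u v)) (at (l t))"
      by (rule has_derivative_transform_within_open[OF d2trans_has_derivative[OF d c ov'] open_overlap[OF d c] ov'])
        (simp add: dtrans_jacobian[OF d c])
  qed
  have t': "t - K \<in> {0..1}" using t by auto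
  have im: "l t \<in> chart_img d" by (rule overlap_subset[OF d ov'])
  let ?f = "\<lambda>s. X (s - K) *v w"
  have "(X has_vector_derivative - (chris d (l t) (z - y) ** X (t - K))) (at (t - K) within {0..1})"
    using X t' unfolding segment_transport_def fundamental_pair_def l_def by blast
  from bounded_linear.has_vector_derivative[OF bounded_bilinear.bounded_linear_left[OF bounded_bilinear_matrix_vector_mult]
      has_vector_derivative_shift[OF this]]
  have fder: "(?f has_vector_derivative - \<Gamma> d (l t) (z - y) (?f t)) (at t within {K..K+1})"
    by (simp add: \<Gamma>_chris[OF d im] matrix_vector_mul_assoc[symmetric] bounded_bilinear.minus_left[OF bounded_bilinear_matrix_vector_mult])
  have "((\<lambda>s. jacobian d c (l s) *v (?f s)) has_vector_derivative
      d2trans d c (l t) (z - y) (?f t) + jacobian d c (l t) *v (- \<Gamma> d (l t) (z - y) (?f t))) (at t within {K..K+1})"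
    by (rule has_vector_derivative_linear_family[OF t _ _ Lder fder])
      (use linear_complex_matrix_vector_mult Lder in auto)
  moreover have "d2trans d c (l t) (z - y) (?f t) + jacobian d c (l t) *v (- \<Gamma> d (l t) (z - y) (?f t))
      = - \<Gamma> c (transition d c (l t)) (dtrans d c (l t) (z - y)) (jacobian d c (l t) *v ?f t)"
    using \<Gamma>_transition[OF d c ov', of "z - y" "?f t"]
    by (simp add: dtrans_jacobian[OF d c ov'] linear_neg[OF linear_complex_matrix_vector_mult])
  ultimately show "((\<lambda>s. jacobian d c (l s) *v (X (s - K) *v w)) has_vector_derivative
     - \<Gamma> c (transition d c (l t)) (dtrans d c (l t) (z - y)) (jacobian d c (l t) *v (X (t - K) *v w))) (at t within {K..K+1})"
    by simp
qed

text \<open>On the new segment a parallel field solves the transport equation in the chart \<open>d\<close>; its coordinate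
  expressions in the other charts are defined by the Jacobian matrices.\<close>

lemma extend_path:
  assumes \<gamma>: "smooth_path K Q \<gamma>" and d: "d \<in> A" and img: "closed_segment y z \<subseteq> chart_img d"
    and \<gamma>K: "\<gamma> K = point d y"
  defines "\<gamma>' \<equiv> \<lambda>t. if t \<le> K then \<gamma> t else point d (y + (t - K) *\<^sub>R (z - y))"
  shows "smooth_path (K + 1) (insert (K + 1) Q) \<gamma>'"
    and "segment_transport d y z X Y \<Longrightarrow> parallel_on K Q \<gamma> V \<Longrightarrow>
      \<exists>V'. parallel_on (K + 1) (insert (K + 1) Q) \<gamma>' V' \<and> (\<forall>c. V' c 0 = V c 0) \<and> V' d (K + 1) = X 1 *v V d K"
proof -
  note S = \<gamma>[unfolded smooth_path_def]
  have K: "K \<ge> 0" using S by simp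
  define l where "l = (\<lambda>t. y + (t - K) *\<^sub>R (z - y))"
  have new: "\<gamma>' t = point d (l t)" if "t \<in> {K..K+1}" for t
    using that \<gamma>K by (cases "t = K") (auto simp: \<gamma>'_def l_def)
  have old: "\<gamma>' t = \<gamma> t" if "t \<le> K" for t using that by (simp add: \<gamma>'_def)
  have limg: "l t \<in> chart_img d" if "t \<in> {K..K+1}" for t
  proof -
    have "l t \<in> closed_segment y z"
      unfolding in_segment l_def using that by (intro exI[of _ "t - K"]) (simp add: algebra_simps)
    then show ?thesis using img by blast
  qed
  have cases: "(consecutive Q a b \<and> 0 \<le> a \<and> b \<le> K) \<or> (a = K \<and> b = K + 1)"
    if "consecutive (insert (K + 1) Q) a b" for a b
    using consecutive_insert_end[OF _ _ that] S by blast
  have "continuous_on {K..K+1} (\<lambda>t. point d (l t))"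
  proof (rule continuous_on_compose2[where g = "point d" and f = l])
    show "continuous_on (chart_img d) (point d)" using homeo[OF d] by (simp add: homeomorphism_def)
    show "continuous_on {K..K+1} l" unfolding l_def by (intro continuous_intros)
  qed (use limg in auto)
  then have c2: "continuous_on {K..K+1} \<gamma>'" by (rule continuous_on_eq) (simp add: new)
  have c1: "continuous_on {0..K} \<gamma>'"
    by (rule continuous_on_eq[of _ \<gamma>]) (use S in \<open>auto simp: old\<close>)
  have "{0..K} \<union> {K..K+1} = {0..K+1}" using K by auto
  with continuous_on_closed_Un[OF _ _ c1 c2] have cont: "continuous_on {0..K+1} \<gamma>'" by simp
  have "smooth_curve A a b \<gamma>'" if ab: "consecutive (insert (K + 1) Q) a b" for a b
    using cases[OF ab]
  proof
    assume h: "consecutive Q a b \<and> 0 \<le> a \<and> b \<le> K"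
    then have "smooth_curve A a b \<gamma>" using S by blast
    then show ?thesis by (rule smooth_curve_cong) (use h old in auto)
  next
    assume "a = K \<and> b = K + 1"
    then show ?thesis using smooth_curve_segment[OF d img, of K \<gamma>'] new by (simp add: l_def)
  qed
  then show "smooth_path (K + 1) (insert (K + 1) Q) \<gamma>'"
    using S cont unfolding smooth_path_def by auto
  assume X: "segment_transport d y z X Y" and V: "parallel_on K Q \<gamma> V"
  have X0: "X 0 = mat 1" using X by (simp add: segment_transport_def fundamental_pair_def)
  define w where "w = V d K"
  define V' where "V' = (\<lambda>c t. if t \<le> K then V c t else jacobian d c (l t) *v (X (t - K) *v w))"
  have Vnew: "V' c t = jacobian d c (l t) *v (X (t - K) *v w)"
    if c: "c \<in> A" and t: "t \<in> {K..K+1}" and dom: "\<gamma>' t \<in> chart_dom c" for c t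
  proof (cases "t = K")
    case True
    have yd: "y \<in> chart_img d" using limg[of K] by (simp add: l_def)
    have yo: "y \<in> overlap d c" using dom \<gamma>K True yd by (simp add: overlap_iff[OF d] old)
    have "V c K = dtrans d c (snd d (\<gamma> K)) (V d K)"
      by (rule parallel_on_chart[OF V d c]) (use K dom \<gamma>K True yd d old in auto)
    then show ?thesis using True X0 yo yd by (simp add: V'_def w_def \<gamma>K d l_def dtrans_jacobian[OF d c])
  qed (use t in \<open>auto simp: V'_def\<close>)
  have compat: "V' e t = dtrans c e (snd c (\<gamma>' t)) (V' c t)"
    if c: "c \<in> A" "e \<in> A" and t: "t \<in> {0..K+1}" and dom: "\<gamma>' t \<in> chart_dom c \<inter> chart_dom e" for c e t
  proof (cases "t \<le> K")
    case True
    then have "t \<in> {0..K}" using t by simp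
    moreover have "\<gamma> t \<in> chart_dom c \<inter> chart_dom e" using dom old[OF True] by simp
    ultimately have "V e t = dtrans c e (snd c (\<gamma> t)) (V c t)"
      using V c unfolding parallel_on_def by blast
    then show ?thesis using True by (simp add: V'_def old)
  next
    case False
    then have t': "t \<in> {K..K+1}" using t by simp
    have oc: "l t \<in> overlap d c" and oe: "l t \<in> overlap d e"
      using dom limg[OF t'] by (simp_all add: overlap_iff[OF d] new[OF t'])
    have sn: "snd c (\<gamma>' t) = transition d c (l t)" by (simp add: new[OF t'] transition_eq)
    have "dtrans c e (transition d c (l t)) v = jacobian c e (transition d c (l t)) *v v" for v
      by (rule dtrans_jacobian[OF c transition_overlap[OF d c(1) oc oe]])
    then show ?thesis
      using Vnew[OF c(1) t'] Vnew[OF c(2) t'] dom jacobian_chain[OF d c oc oe]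
      by (simp add: sn matrix_vector_mul_assoc matrix_mul_assoc)
  qed
  have ode: "(V' c has_vector_derivative
           - \<Gamma> c (snd c (\<gamma>' t)) (vector_derivative (snd c \<circ> \<gamma>') (at t within {a..b})) (V' c t)) (at t within {a..b})"
    if ab: "consecutive (insert (K + 1) Q) a b" and c: "c \<in> A" and t: "t \<in> {a..b}" and dom: "\<gamma>' t \<in> chart_dom c" for a b c t
    using cases[OF ab]
  proof
    assume h: "consecutive Q a b \<and> 0 \<le> a \<and> b \<le> K"
    have "(V c has_vector_derivative
           - \<Gamma> c (snd c (\<gamma> t)) (vector_derivative (snd c \<circ> \<gamma>) (at t within {a..b})) (V c t)) (at t within {a..b})"
      by (rule parallel_on_derivative[OF V _ c t]) (use h t dom old[of t] in auto)
    then have "(V' c has_vector_derivative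
           - \<Gamma> c (snd c (\<gamma> t)) (vector_derivative (snd c \<circ> \<gamma>) (at t within {a..b})) (V c t)) (at t within {a..b})"
      by (rule has_vector_derivative_transform[OF t, rotated]) (use h in \<open>auto simp: V'_def\<close>)
    moreover have "vector_derivative (snd c \<circ> \<gamma>') (at t within {a..b}) = vector_derivative (snd c \<circ> \<gamma>) (at t within {a..b})"
      by (rule vector_derivative_cong_within[OF t]) (use h old in auto)
    ultimately show ?thesis using h t by (simp add: V'_def old)
  next
    assume ab: "a = K \<and> b = K + 1"
    have t': "t \<in> {K..K+1}" using t ab by simp
    have oc: "l t \<in> overlap d c" using dom limg[OF t'] by (simp add: overlap_iff[OF d] new[OF t'])
    have sn: "snd c (\<gamma>' t) = transition d c (l t)" by (simp add: new[OF t'] transition_eq)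
    have l_eq: "y + (t - K) *\<^sub>R (z - y) = l t" for t by (simp add: l_def)
    note P = parallel_in_other_chart[OF d c img X t', unfolded l_eq, OF oc]
    have "((snd c \<circ> \<gamma>') has_vector_derivative dtrans d c (l t) (z - y)) (at t within {K..K+1})"
      by (rule has_vector_derivative_transform[OF t' _ P(2)]) (simp add: new transition_eq)
    then have vd: "vector_derivative (snd c \<circ> \<gamma>') (at t within {K..K+1}) = dtrans d c (l t) (z - y)"
      using t' by (intro vector_derivative_within_closed_interval) auto
    have nb: "\<forall>\<^sub>F s in at t within {K..K+1}. \<gamma>' s \<in> chart_dom c"
    proof -
      have "(\<gamma>' \<longlongrightarrow> \<gamma>' t) (at t within {K..K+1})" using c2 t' by (simp add: continuous_on_def)
      then show ?thesis using open_dom[OF c] dom topological_tendstoD by blast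
    qed
    have "(V' c has_vector_derivative
      - \<Gamma> c (transition d c (l t)) (dtrans d c (l t) (z - y)) (jacobian d c (l t) *v (X (t - K) *v w))) (at t within {K..K+1})"
      unfolding has_vector_derivative_def
    proof (rule has_derivative_transform_eventually[OF P(1)[unfolded has_vector_derivative_def] _ _ t'])
      have "\<forall>\<^sub>F s in at t within {K..K+1}. s \<in> {K..K+1}" by (simp add: eventually_at_filter)
      then show "\<forall>\<^sub>F s in at t within {K..K+1}. jacobian d c (l s) *v (X (s - K) *v w) = V' c s"
        using nb by eventually_elim (simp add: Vnew[OF c])
      show "jacobian d c (l t) *v (X (t - K) *v w) = V' c t" using Vnew[OF c t' dom] by simp
    qed
    then show ?thesis using ab Vnew[OF c t' dom] by (simp add: sn vd)
  qed
  have "V' d (K + 1) = X 1 *v V d K"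
    using Vnew[OF d, of "K + 1"] limg[of "K + 1"] by (simp add: new l_def jacobian_self[OF d] w_def d)
  moreover have par: "parallel_on (K + 1) (insert (K + 1) Q) \<gamma>' V'"
    unfolding parallel_on_def
  proof (intro conjI ballI allI impI)
    show "V' e t = dtrans c e (snd c (\<gamma>' t)) (V' c t)"
      if "c \<in> A" "e \<in> A" "t \<in> {0..K+1}" "\<gamma>' t \<in> chart_dom c \<inter> chart_dom e" for c e t
      using compat[OF that] .
  qed (rule ode)
  moreover have V0: "\<forall>c. V' c 0 = V c 0" using K by (simp add: V'_def)
  ultimately show "\<exists>V'. parallel_on (K + 1) (insert (K + 1) Q) \<gamma>' V' \<and> (\<forall>c. V' c 0 = V c 0) \<and> V' d (K + 1) = X 1 *v V d K"
    using par V0 by blast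
qed

lemma path_of_transports:
  assumes "transports c x d y P"
  shows "\<exists>K Q \<gamma>. smooth_path K Q \<gamma> \<and> \<gamma> 0 = point c x \<and> \<gamma> K = point d y \<and>
    (\<forall>u. \<exists>V. parallel_on K Q \<gamma> V \<and> V c 0 = u \<and> V d K = P *v u)"
  using assms
proof induction
  case start
  have nc: "\<not> consecutive {0} a b" for a b by (auto simp: consecutive_def)
  have "smooth_path 0 {0} (\<lambda>t. point c x)" by (simp add: smooth_path_def nc)
  moreover have "\<exists>V. parallel_on 0 {0} (\<lambda>t. point c x) V \<and> V c 0 = u \<and> V c 0 = mat 1 *v u" for u
  proof -
    let ?V = "\<lambda>d (t :: real). jacobian c d x *v u"
    have 0: "?V c 0 = u" "?V c 0 = mat 1 *v u" using start by (simp_all add: jacobian_self)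
    have "?V e 0 = dtrans d e (snd d (point c x)) (?V d 0)"
      if d: "d \<in> A" "e \<in> A" "point c x \<in> chart_dom d" "point c x \<in> chart_dom e" for d e
    proof -
      have o: "x \<in> overlap c d" "x \<in> overlap c e" using d start by (simp_all add: overlap_iff)
      have "dtrans d e (transition c d x) v = jacobian d e (transition c d x) *v v" for v
        by (rule dtrans_jacobian[OF d(1,2) transition_overlap[OF start(1) d(1) o]])
      then show ?thesis
        using jacobian_chain[OF start(1) d(1,2) o] by (simp add: transition_eq[symmetric] matrix_vector_mul_assoc)
    qed
    then have "parallel_on 0 {0} (\<lambda>t. point c x) ?V"
      unfolding parallel_on_def using nc by (intro conjI ballI allI impI) blast+
    with 0 show ?thesis by (intro exI[of _ ?V] conjI)
  qed
  ultimately show ?case by (intro exI[of _ 0] exI[of _ "{0}"] exI[of _ "\<lambda>t. point c x"]) simp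
next
  case (segment d y P z X Y)
  then obtain K Q \<gamma> where \<gamma>: "smooth_path K Q \<gamma>" "\<gamma> 0 = point c x" "\<gamma> K = point d y"
    "\<And>u. \<exists>V. parallel_on K Q \<gamma> V \<and> V c 0 = u \<and> V d K = P *v u" by blast
  have d: "d \<in> A" using segment transports_in by blast
  define \<gamma>' where "\<gamma>' = (\<lambda>t. if t \<le> K then \<gamma> t else point d (y + (t - K) *\<^sub>R (z - y)))"
  have K: "K \<ge> 0" using \<gamma> by (simp add: smooth_path_def)
  have "smooth_path (K + 1) (insert (K + 1) Q) \<gamma>'"
    unfolding \<gamma>'_def by (rule extend_path(1)[OF \<gamma>(1) d segment(3) \<gamma>(3)])
  moreover have "\<exists>V. parallel_on (K + 1) (insert (K + 1) Q) \<gamma>' V \<and> V c 0 = u \<and> V d (K + 1) = (X 1 ** P) *v u" for u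
  proof -
    obtain V where V: "parallel_on K Q \<gamma> V" "V c 0 = u" "V d K = P *v u" using \<gamma>(4) by blast
    from extend_path(2)[OF \<gamma>(1) d segment(3) \<gamma>(3) segment(2) V(1), folded \<gamma>'_def]
    show ?thesis using V by (metis matrix_vector_mul_assoc)
  qed
  moreover have "\<gamma>' 0 = point c x" "\<gamma>' (K + 1) = point d z" using \<gamma> K by (auto simp: \<gamma>'_def)
  ultimately show ?case by blast
next
  case (change_chart d y P e)
  then obtain K Q \<gamma> where \<gamma>: "smooth_path K Q \<gamma>" "\<gamma> 0 = point c x" "\<gamma> K = point d y"
    "\<And>u. \<exists>V. parallel_on K Q \<gamma> V \<and> V c 0 = u \<and> V d K = P *v u" by blast
  have d: "d \<in> A" "y \<in> chart_img d" using change_chart transports_in by blast+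
  have K: "K \<ge> 0" using \<gamma> by (simp add: smooth_path_def)
  have "V e K = (jacobian d e y ** P) *v u" if V: "parallel_on K Q \<gamma> V" "V d K = P *v u" for V u
  proof -
    have "V e K = dtrans d e (snd d (\<gamma> K)) (V d K)"
    proof (rule parallel_on_chart[OF V(1) d(1) change_chart(2)])
      show "\<gamma> K \<in> chart_dom e" using change_chart(3) \<gamma>(3) by (simp add: overlap_iff[OF d(1)])
    qed (use K d \<gamma>(3) in simp_all)
    then show ?thesis
      using V(2) \<gamma>(3) d by (simp add: dtrans_jacobian[OF d(1) change_chart(2,3)] matrix_vector_mul_assoc)
  qed
  then have "\<exists>V. parallel_on K Q \<gamma> V \<and> V c 0 = u \<and> V e K = (jacobian d e y ** P) *v u" for u
    using \<gamma>(4)[of u] by blast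
  moreover have "\<gamma> K = point e (transition d e y)"
    using \<gamma>(3) point_transition[OF d(1) change_chart(2,3)] by simp
  ultimately show ?case using \<gamma>(1,2) by blast
qed

lemma smooth_curve_rescale:
  assumes K: "K > 0" and s: "smooth_curve A (K * a) (K * b) \<gamma>"
  shows "smooth_curve A a b (\<lambda>t. \<gamma> (K * t))"
  unfolding smooth_curve_def
proof
  fix c assume "c \<in> A"
  then obtain D where D: "D 0 = snd c \<circ> \<gamma>" "\<And>k t. t \<in> {K * a..K * b} \<Longrightarrow> \<gamma> t \<in> chart_dom c \<Longrightarrow>
           (D k has_vector_derivative D (Suc k) t) (at t within {K * a..K * b})"
    using s unfolding smooth_curve_def by blast
  define E where "E = (\<lambda>k t. K ^ k *\<^sub>R D k (K * t))"
  have "(E k has_vector_derivative E (Suc k) t) (at t within {a..b})"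
    if t: "t \<in> {a..b}" "\<gamma> (K * t) \<in> chart_dom c" for k t
  proof -
    have m: "((\<lambda>t. K * t) has_vector_derivative K) (at t within {a..b})"
      unfolding has_real_derivative_iff_has_vector_derivative[symmetric] by (auto intro!: derivative_eq_intros)
    have im: "(\<lambda>t. K * t) ` {a..b} = {K * a..K * b}" using K t by (simp add: image_mult_atLeastAtMost)
    have "(D k has_vector_derivative D (Suc k) (K * t)) (at (K * t) within (\<lambda>t. K * t) ` {a..b})"
      unfolding im using t K by (intro D(2)) auto
    from bounded_linear.has_vector_derivative[OF bounded_linear_scaleR_right[of "K ^ k"] vector_diff_chain_within[OF m this]]
    show ?thesis by (simp add: E_def o_def mult.commute)
  qed
  then show "\<exists>D. D 0 = snd c \<circ> (\<lambda>t. \<gamma> (K * t)) \<and> (\<forall>k. \<forall>t\<in>{a..b}. \<gamma> (K * t) \<in> chart_dom c \<longrightarrow>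
      (D k has_vector_derivative D (Suc k) t) (at t within {a..b}))"
    by (intro exI[of _ E]) (auto simp: E_def D(1))
qed

lemma consecutive_rescale:
  assumes K: "K > 0" and ab: "consecutive ((\<lambda>t. t / K) ` Q) a b"
  shows "consecutive Q (K * a) (K * b)"
proof -
  have "t \<notin> {K * a<..<K * b}" if "t \<in> Q" for t
  proof
    assume "t \<in> {K * a<..<K * b}"
    then have "t / K \<in> {a<..<b}" using K by (simp add: field_simps)
    then show False using ab that by (auto simp: consecutive_def)
  qed
  then show ?thesis using ab K by (auto simp: consecutive_def)
qed

lemma piecewise_smooth_rescale:
  assumes K: "K > 0" and s: "smooth_path K Q \<gamma>"
  shows "piecewise_smooth_curve A ((\<lambda>t. t / K) ` Q) (\<lambda>t. \<gamma> (K * t))"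
proof -
  note S = s[unfolded smooth_path_def]
  have "continuous_on {0..1} (\<lambda>t. \<gamma> (K * t))"
    by (rule continuous_on_compose2[of "{0..K}" \<gamma>]) (use S K in \<open>auto intro!: continuous_intros\<close>)
  moreover have "{0, 1} \<subseteq> (\<lambda>t. t / K) ` Q"
  proof -
    have "0 / K \<in> (\<lambda>t. t / K) ` Q" "K / K \<in> (\<lambda>t. t / K) ` Q" using S by blast+
    then show ?thesis using K by simp
  qed
  moreover have "(\<lambda>t. t / K) ` Q \<subseteq> {0..1}" using S K by (auto simp: subset_iff)
  moreover have "smooth_curve A a b (\<lambda>t. \<gamma> (K * t))" if "consecutive ((\<lambda>t. t / K) ` Q) a b" for a b
    using S consecutive_rescale[OF K that] by (intro smooth_curve_rescale[OF K]) blast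
  ultimately show ?thesis using S unfolding piecewise_smooth_curve_def by blast
qed

lemma parallel_along_rescale:
  assumes K: "K > 0" and s: "smooth_path K Q \<gamma>" and V: "parallel_on K Q \<gamma> V"
  shows "parallel_along A \<Gamma> ((\<lambda>t. t / K) ` Q) (\<lambda>t. \<gamma> (K * t)) (\<lambda>c t. V c (K * t))"
  unfolding parallel_along_def
proof (intro conjI ballI allI impI)
  fix c d t assume "c \<in> A" "d \<in> A" "t \<in> {0..1::real}" "\<gamma> (K * t) \<in> chart_dom c \<inter> chart_dom d"
  moreover from this have "K * t \<in> {0..K}" using K by simp
  ultimately show "V d (K * t) = dtrans c d (snd c (\<gamma> (K * t))) (V c (K * t))"
    using V unfolding parallel_on_def by blast
next
  fix a b c t
  assume ab: "consecutive ((\<lambda>t. t / K) ` Q) a b" and c: "c \<in> A" and t: "t \<in> {a..b}" and dom: "\<gamma> (K * t) \<in> chart_dom c"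
  have ab': "consecutive Q (K * a) (K * b)" by (rule consecutive_rescale[OF K ab])
  have lt: "a < b" "K * a < K * b" using ab ab' by (auto simp: consecutive_def)
  have t': "K * t \<in> {K * a..K * b}" using t K by auto
  have m: "((\<lambda>t. K * t) has_vector_derivative K) (at t within {a..b})"
    unfolding has_real_derivative_iff_has_vector_derivative[symmetric] by (auto intro!: derivative_eq_intros)
  have im: "(\<lambda>t. K * t) ` {a..b} = {K * a..K * b}" using K lt by (simp add: image_mult_atLeastAtMost)
  have "smooth_curve A (K * a) (K * b) \<gamma>" using s ab' unfolding smooth_path_def by blast
  then obtain D :: "nat \<Rightarrow> real \<Rightarrow> complex ^ 'n" where "D 0 = snd c \<circ> \<gamma>" "(D 0 has_vector_derivative D (Suc 0) (K * t)) (at (K * t) within {K * a..K * b})"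
    using c t' dom unfolding smooth_curve_def by blast
  then have g: "((snd c \<circ> \<gamma>) has_vector_derivative D 1 (K * t)) (at (K * t) within {K * a..K * b})" by simp
  have vg: "vector_derivative (snd c \<circ> \<gamma>) (at (K * t) within {K * a..K * b}) = D 1 (K * t)"
    by (rule vector_derivative_within_closed_interval[OF lt(2) _ g]) (use t' in simp)
  have "(((snd c \<circ> \<gamma>) \<circ> (\<lambda>t. K * t)) has_vector_derivative K *\<^sub>R D 1 (K * t)) (at t within {a..b})"
    using vector_diff_chain_within[OF m, of "snd c \<circ> \<gamma>"] g im by simp
  then have "((snd c \<circ> (\<lambda>t. \<gamma> (K * t))) has_vector_derivative K *\<^sub>R D 1 (K * t)) (at t within {a..b})"
    by (simp add: o_def)
  then have vd: "vector_derivative (snd c \<circ> (\<lambda>t. \<gamma> (K * t))) (at t within {a..b}) = K *\<^sub>R D 1 (K * t)"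
    by (rule vector_derivative_within_closed_interval[OF lt(1), rotated]) (use t in simp)
  have "(V c has_vector_derivative - \<Gamma> c (snd c (\<gamma> (K * t))) (D 1 (K * t)) (V c (K * t))) (at (K * t) within {K * a..K * b})"
    using parallel_on_derivative[OF V ab' c t' dom] unfolding vg .
  from vector_diff_chain_within[OF m this[folded im]]
  have "((V c \<circ> (\<lambda>t. K * t)) has_vector_derivative K *\<^sub>R (- \<Gamma> c (snd c (\<gamma> (K * t))) (D 1 (K * t)) (V c (K * t)))) (at t within {a..b})"
    .
  moreover have "K *\<^sub>R (- \<Gamma> c (snd c (\<gamma> (K * t))) (D 1 (K * t)) (V c (K * t)))
      = - \<Gamma> c (snd c (\<gamma> (K * t))) (K *\<^sub>R D 1 (K * t)) (V c (K * t))"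
    using bilinear_\<Gamma>[OF c, of "snd c (\<gamma> (K * t))"] dom by (simp add: bilinear_lmul)
  ultimately show "((\<lambda>t. V c (K * t)) has_vector_derivative
      - \<Gamma> c (snd c (\<gamma> (K * t))) (vector_derivative (snd c \<circ> (\<lambda>t. \<gamma> (K * t))) (at t within {a..b})) (V c (K * t)))
      (at t within {a..b})"
    unfolding vd by (simp add: o_def)
qed

text \<open>The path on \<open>[0,K]\<close> is rescaled to the unit interval.\<close>

theorem holonomy_of_transports:
  assumes P: "transports c x c x P"
  shows "(\<lambda>u. P *v u) \<in> holonomy_group A \<Gamma> c (point c x)"
proof -
  have c: "c \<in> A" "x \<in> chart_img c" using transports_in[OF P] by auto
  obtain K Q \<gamma> where \<gamma>: "smooth_path K Q \<gamma>" "\<gamma> 0 = point c x" "\<gamma> K = point c x"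
    "\<And>u. \<exists>V. parallel_on K Q \<gamma> V \<and> V c 0 = u \<and> V c K = P *v u"
    using path_of_transports[OF P] by blast
  have K: "K \<ge> 0" using \<gamma> by (simp add: smooth_path_def)
  \<comment> \<open>a constant segment is appended, as \<open>K\<close> may be \<open>0\<close>\<close>
  have triv: "segment_transport c x x (\<lambda>t. mat 1) (\<lambda>t. mat 1)"
    using linear_0[OF linear_chris[OF c]]
    by (simp add: segment_transport_def fundamental_pair_def bounded_bilinear.zero_left[OF bounded_bilinear_matrix_matrix_mult]
        bounded_bilinear.zero_right[OF bounded_bilinear_matrix_matrix_mult])
  have seg: "closed_segment x x \<subseteq> chart_img c" using c by simp
  define \<gamma>' where "\<gamma>' = (\<lambda>t. if t \<le> K then \<gamma> t else point c (x + (t - K) *\<^sub>R (x - x)))"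
  define Q' where "Q' = insert (K + 1) Q"
  have \<gamma>': "smooth_path (K + 1) Q' \<gamma>'"
    unfolding \<gamma>'_def Q'_def by (rule extend_path(1)[OF \<gamma>(1) c(1) seg \<gamma>(3)])
  have V': "\<exists>V. parallel_on (K + 1) Q' \<gamma>' V \<and> V c 0 = u \<and> V c (K + 1) = P *v u" for u
  proof -
    obtain V where V: "parallel_on K Q \<gamma> V" "V c 0 = u" "V c K = P *v u" using \<gamma>(4) by blast
    from extend_path(2)[OF \<gamma>(1) c(1) seg \<gamma>(3) triv V(1), folded \<gamma>'_def Q'_def]
    obtain V' where "parallel_on (K + 1) Q' \<gamma>' V'" "\<forall>c. V' c 0 = V c 0" "V' c (K + 1) = mat 1 *v V c K" by blast
    then show ?thesis using V by (metis matrix_vector_mul_lid)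
  qed
  have K1: "K + 1 > 0" using K by simp
  have "\<gamma>' 0 = point c x" "\<gamma>' (K + 1) = point c x" using \<gamma> K by (auto simp: \<gamma>'_def)
  moreover have "\<exists>V. parallel_along A \<Gamma> ((\<lambda>t. t / (K + 1)) ` Q') (\<lambda>t. \<gamma>' ((K + 1) * t)) V \<and> V c 0 = u \<and> V c 1 = P *v u" for u
  proof -
    obtain V where V: "parallel_on (K + 1) Q' \<gamma>' V" "V c 0 = u" "V c (K + 1) = P *v u" using V' by blast
    then show ?thesis
      using parallel_along_rescale[OF K1 \<gamma>' V(1)] by (intro exI[of _ "\<lambda>c t. V c ((K + 1) * t)"]) simp
  qed
  ultimately show ?thesis
    unfolding holonomy_group_def using piecewise_smooth_rescale[OF K1 \<gamma>'] linear_complex_matrix_vector_mult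
    by (simp only: mem_Collect_eq, intro conjI exI[of _ "(\<lambda>t. t / (K + 1)) ` Q'"] exI[of _ "\<lambda>t. \<gamma>' ((K + 1) * t)"]) auto
qed

text \<open>The points that are reached from one point form an open and closed set.\<close>

lemma transports_everywhere:
  assumes connected: "connected (UNIV :: 'p set)" and c: "c \<in> A" "x \<in> chart_img c"
    and d: "d \<in> A" "y \<in> chart_img d"
  shows "\<exists>P. transports c x d y P"
proof -
  define S where "S = {q. \<exists>d y P. transports c x d y P \<and> point d y = q}"
  have reach: "\<exists>P. transports c x d y P" if q: "point d y \<in> S" and d: "d \<in> A" "y \<in> chart_img d" for d y
  proof -
    obtain d' y' P where P: "transports c x d' y' P" "point d' y' = point d y" using q by (auto simp: S_def)
    have d': "d' \<in> A" "y' \<in> chart_img d'" using transports_in[OF P(1)] by auto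
    have "y' \<in> overlap d' d" using d' d P by (simp add: overlap_iff)
    from transports.change_chart[OF P(1) d(1) this]
    have "transports c x d (transition d' d y') (jacobian d' d y' ** P)" .
    moreover have "transition d' d y' = y" using P(2) d by (simp add: transition_eq)
    ultimately show ?thesis by auto
  qed
  have nbhd: "\<exists>T. open T \<and> q \<in> T \<and> (T \<subseteq> S \<or> T \<subseteq> - S)" for q
  proof -
    obtain d where d: "d \<in> A" "q \<in> chart_dom d" using charts_cover by blast
    define y where "y = snd d q"
    have y: "y \<in> chart_img d" "point d y = q" using d by (auto simp: y_def)
    obtain r C where r: "r > 0" "ball y r \<subseteq> chart_img d" and ex:
      "\<And>y' z. y' \<in> ball y r \<Longrightarrow> z \<in> ball y r \<Longrightarrow> \<exists>X Y. segment_transport d y' z X Y \<and>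
       (\<forall>t\<in>{0..1}. norm (X t - mat 1) \<le> C * norm (z - y') \<and> norm (Y t - mat 1) \<le> C * norm (z - y'))"
      by (rule segment_transport_exists[OF d(1) y(1)]) blast
    define T where "T = chart_dom d \<inter> snd d -` ball y r"
    have T: "open T" unfolding T_def
      using homeo[OF d(1)] open_dom[OF d(1)] by (intro continuous_open_preimage) (auto simp: homeomorphism_def)
    have qT: "q \<in> T" using d r by (simp add: T_def y_def)
    have spread: "p' \<in> S" if p: "p \<in> S" "p \<in> T" and p': "p' \<in> T" for p p'
    proof -
      have b: "snd d p \<in> ball y r" "snd d p' \<in> ball y r" using p p' by (auto simp: T_def)
      have pp: "point d (snd d p) = p" "point d (snd d p') = p'" using p p' d by (auto simp: T_def)
      have m: "snd d p \<in> chart_img d" using b r by blast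
      have "point d (snd d p) \<in> S" unfolding pp(1) by (rule p(1))
      from reach[OF this d(1) m] obtain P where P: "transports c x d (snd d p) P" by blast
      obtain X Y where X: "segment_transport d (snd d p) (snd d p') X Y" using ex[OF b] by blast
      have "closed_segment (snd d p) (snd d p') \<subseteq> chart_img d"
        using closed_segment_subset[OF b convex_ball] r by blast
      from transports.segment[OF P X this] show ?thesis using pp(2) unfolding S_def by blast
    qed
    show ?thesis
    proof (cases "T \<subseteq> - S")
      case False
      then obtain p where "p \<in> T" "p \<in> S" by blast
      then have "T \<subseteq> S" using spread by blast
      then show ?thesis using T qT by blast
    qed (use T qT in blast)
  qed
  have "open S" by (subst open_subopen) (use nbhd in blast)
  moreover have "open (- S)" by (subst open_subopen) (use nbhd in blast)
  moreover have "point c x \<in> S" using transports.start[OF c] unfolding S_def by blast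
  ultimately have "S = UNIV"
    using connected unfolding connected_clopen open_openin[symmetric] closed_closedin[symmetric] closed_def
    by (auto simp: closed_def)
  then show ?thesis using reach d by blast
qed

end

section \<open>Traces of quaternionic curvature\<close>

text \<open>The trace over the reals of a real linear map, in the basis of the vectors \<open>e\<^sub>k\<close> and \<open>\<i>e\<^sub>k\<close>.\<close>

definition rtrace :: "(complex ^ 'n \<Rightarrow> complex ^ 'n) \<Rightarrow> real" where
  "rtrace f = (\<Sum>k\<in>UNIV. Re (f (axis k 1) $ k) + Im (f (axis k \<i>) $ k))"

lemma axis_i: "axis k \<i> = \<i> *s (axis k 1 :: complex ^ 'n)"
  by (simp add: vec_eq_iff axis_def)

lemma rtrace_diff: "rtrace (\<lambda>e. f e - g e) = rtrace f - rtrace g"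
  by (simp add: rtrace_def sum_subtractf[symmetric] algebra_simps)

lemma rtrace_cmult: "rtrace (\<lambda>e. r *\<^sub>R f e) = r * rtrace f"
  by (simp add: rtrace_def sum_distrib_left algebra_simps)

lemma rtrace_antilinear:
  assumes "\<And>e. f (\<i> *s e) = - (\<i> *s f e)" shows "rtrace f = 0"
  by (simp add: rtrace_def axis_i assms)

lemma rtrace_complex_linear: "rtrace (\<lambda>e. A *v e) = 2 * Re (trace A)"
proof -
  have "(A *v axis k 1) $ k = A $ k $ k" for k
    by (simp add: matrix_vector_mult_def axis_def if_distrib sum.delta cong: if_cong)
  then show ?thesis by (simp add: rtrace_def axis_i trace_def sum_distrib_left)
qed

lemma rtrace_rank_one:
  assumes l: "linear l" shows "rtrace (\<lambda>e. l e *\<^sub>R z) = l z"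
proof -
  have "z = (\<Sum>k\<in>UNIV. Re (z $ k) *\<^sub>R axis k 1 + Im (z $ k) *\<^sub>R axis k \<i>)"
  proof -
    have "(\<Sum>k\<in>UNIV. Re (z $ k) *\<^sub>R axis k 1 + Im (z $ k) *\<^sub>R axis k \<i>) = (\<Sum>k\<in>UNIV. z $ k *s axis k 1)"
      by (intro sum.cong refl) (simp add: vec_eq_iff axis_def complex_eq_iff)
    also have "\<dots> = z" using matrix_vector_mult_axis_sum[of "mat 1" z] by simp
    finally show ?thesis by simp
  qed
  then have "l z = l (\<Sum>k\<in>UNIV. Re (z $ k) *\<^sub>R axis k 1 + Im (z $ k) *\<^sub>R axis k \<i>)" by simp
  also have "\<dots> = (\<Sum>k\<in>UNIV. Re (z $ k) * l (axis k 1) + Im (z $ k) * l (axis k \<i>))"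
    using l by (simp add: linear_sum linear_add linear_scale)
  finally show ?thesis by (simp add: rtrace_def mult.commute)
qed

text \<open>The curvature at one point of a torsion-free complex connection.\<close>

locale curvature_tensor =
  fixes R :: "complex ^ 'n \<Rightarrow> complex ^ 'n \<Rightarrow> complex ^ 'n ^ 'n"
  assumes R_linear: "\<And>v. linear (\<lambda>u. R u v)"
    and R_antisym: "\<And>u v. R v u = - R u v"
    and bianchi: "\<And>u v w. R u v *v w + R v w *v u + R w u *v v = 0"
begin

definition ric :: "complex ^ 'n \<Rightarrow> complex ^ 'n \<Rightarrow> real" where
  "ric v w = rtrace (\<lambda>e. R e v *v w)"

lemma bianchi': "R u v *v e = R e v *v u - R e u *v v"
proof -
  have "R u v *v e = - (R v e *v u) - R e u *v v" using bianchi[of u v e] by (simp add: algebra_simps eq_neg_iff_add_eq_0)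
  then show ?thesis using R_antisym[of v e] by (simp add: bounded_bilinear.minus_left[OF bounded_bilinear_matrix_vector_mult])
qed

lemma ric_minus_right: "ric v (- w) = - ric v w"
  using rtrace_cmult[of "-1" "\<lambda>e. R e v *v w"]
  by (simp add: ric_def bounded_bilinear.minus_right[OF bounded_bilinear_matrix_vector_mult])

text \<open>Contraction of the Bianchi identity after multiplication by \<open>\<i>\<close>.\<close>

lemma ric_I: "ric v (\<i> *s u) - ric u (\<i> *s v) = - 2 * Im (trace (R u v))"
proof -
  have "ric v (\<i> *s u) - ric u (\<i> *s v) = rtrace (\<lambda>e. \<i> *s (R e v *v u - R e u *v v))"
    by (simp add: ric_def rtrace_diff[symmetric] vector_ssub_ldistrib)
  also have "\<dots> = rtrace (\<lambda>e. (mat \<i> ** R u v) *v e)"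
    by (simp add: bianchi'[of u v] matrix_vector_mul_assoc[symmetric] mat_mult_vec)
  also have "\<dots> = - 2 * Im (trace (R u v))" by (simp add: rtrace_complex_linear trace_mat_mult)
  finally show ?thesis .
qed

text \<open>The trace of the antilinear map \<open>J \<circ> R(u,v)\<close> is zero.  The Bianchi identity turns this into a
  relation between the Ricci tensor and the form \<open>a\<close> that measures how far \<open>R\<close> is from commuting
  with \<open>J\<close>.\<close>

lemma ric_J:
  assumes J: "linear J" "\<And>v. J (\<i> *s v) = - (\<i> *s J v)"
    and RJ: "\<And>u v w. R u v *v J w = J (R u v *v w) + (2 * a u v) *\<^sub>R (\<i> *s J w)"
    and a: "\<And>v. linear (\<lambda>u. a u v)"
  shows "ric v (J u) - ric u (J v) = 2 * a (\<i> *s J u) v - 2 * a (\<i> *s J v) u"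
proof -
  have "J (R u v *v e) = (R e v *v J u - R e u *v J v) - 2 *\<^sub>R (a e v *\<^sub>R (\<i> *s J u) - a e u *\<^sub>R (\<i> *s J v))" for e
  proof -
    have "J (R u v *v e) = J (R e v *v u) - J (R e u *v v)"
      unfolding bianchi'[of u v e] using J(1) by (rule linear_diff)
    then show ?thesis using RJ[of e v u] RJ[of e u v] by (simp add: scaleR_diff_right)
  qed
  then have "rtrace (\<lambda>e. J (R u v *v e)) = (ric v (J u) - ric u (J v)) - 2 * (a (\<i> *s J u) v - a (\<i> *s J v) u)"
    by (simp only: rtrace_diff rtrace_cmult ric_def rtrace_rank_one[OF a])
  moreover have "rtrace (\<lambda>e. J (R u v *v e)) = 0"
    by (rule rtrace_antilinear) (simp add: J(2))
  ultimately show ?thesis by simp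
qed

text \<open>Write \<open>s(w) = a(w,\<i>w)\<close> and \<open>K = I J\<close>.  The contractions with \<open>I\<close>, \<open>J\<close> and \<open>K\<close> give
  \<open>2 Ric(u,u) = (2n - 4) s(Ju) - 4 s(u)\<close>.  This is invariant under \<open>u \<mapsto> \<i>u\<close>, and therefore
  the contraction with \<open>I\<close> alone gives \<open>2 Ric(u,u) = - 2n s(u)\<close>.  The difference is
  \<open>(2n - 4) (s(u) + s(Ju)) = 0\<close>.\<close>

lemma trace_form_J_anti_invariant:
  assumes J: "linear J" "\<And>v. J (\<i> *s v) = - (\<i> *s J v)" "\<And>v. J (J v) = - v"
    and RJ: "\<And>u v w. R u v *v J w = J (R u v *v w) + (2 * a u v) *\<^sub>R (\<i> *s J w)"
    and a: "\<And>u v. Im (trace (R u v)) = real CARD('n) * a u v"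
    and inv: "\<And>u v. a (\<i> *s u) (\<i> *s v) = a u v"
    and n: "CARD('n) > 2"
  shows "a u (\<i> *s u) + a (J u) (\<i> *s J u) = 0"
proof -
  define n where "n = real CARD('n)"
  have n2: "n > 2" using n by (simp add: n_def)
  have aeq: "a u v = Im (trace (R u v)) / n" for u v using a[of u v] n2 by (simp add: n_def)
  have alin: "linear (\<lambda>u. a u v)" for v
    unfolding aeq
    by (intro linearI) (simp_all add: linear_add[OF R_linear] linear_scale[OF R_linear]
        linear_add[OF linear_trace] linear_scale[OF linear_trace] add_divide_distrib)
  have aanti: "a v u = - a u v" for u v
    unfolding aeq using R_antisym[of v u] by (simp add: linear_neg[OF linear_trace])
  define K where "K = (\<lambda>v. \<i> *s J v)"
  have Klin: "linear K"
    unfolding K_def using linear_compose[OF J(1) linear_vector_scalar_mult_right] by (simp add: o_def)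
  have ii: "\<i> *s (\<i> *s v) = - v" for v :: "complex ^ 'n" by (simp add: vec_eq_iff)
  have iminus: "\<i> *s (- v) = - (\<i> *s v)" for v :: "complex ^ 'n" by (simp add: vec_eq_iff)
  have Kanti: "K (\<i> *s v) = - (\<i> *s K v)" for v by (simp add: K_def J(2) iminus)
  have KK: "K (K v) = - v" for v by (simp add: K_def J(2,3) ii iminus)
  have RK: "R u v *v K w = K (R u v *v w) + (2 * a u v) *\<^sub>R (\<i> *s K w)" for u v w
    by (simp add: K_def RJ vector_add_ldistrib) (simp add: vec_eq_iff)
  have aminus: "a (- u) v = - a u v" "a u (- v) = - a u v" for u v
    using linear_neg[OF alin, of v u] linear_neg[OF alin, of u v] aanti[of "- v" u] aanti[of v u] by simp_all
  define s where "s = (\<lambda>w. a w (\<i> *s w))"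
  have s_neg: "s (- w) = s w" for w by (simp add: s_def iminus aminus)
  have s_i: "s (\<i> *s w) = s w" for w
    unfolding s_def using inv[of w "\<i> *s w"] by simp
  have sI: "ric (\<i> *s w) (\<i> *s w) + ric w w = - 2 * n * s w" for w
    using ric_I[of "\<i> *s w" w] a[of w "\<i> *s w"] by (simp add: ii ric_minus_right n_def s_def)
  have sJ: "ric (L w) (L w) + ric w w = - 2 * s (L w) - 2 * s w"
    if L: "linear L" "\<And>v. L (\<i> *s v) = - (\<i> *s L v)" "\<And>v. L (L v) = - v"
      "\<And>u v w. R u v *v L w = L (R u v *v w) + (2 * a u v) *\<^sub>R (\<i> *s L w)" for L w
    using ric_J[OF L(1,2,4) alin, of "L w" w] aanti[of "\<i> *s L w" "L w"] aanti[of "\<i> *s w" w]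
    by (simp add: L(3) ric_minus_right iminus aminus s_def)
  have two: "2 * ric w w = 2 * n * s (J w) - 4 * s (J w) - 4 * s w" for w
  proof -
    have sK: "s (K w) = s (J w)" by (simp add: K_def s_i)
    have "ric (J w) (J w) + ric w w = - 2 * s (J w) - 2 * s w" by (rule sJ[OF J RJ])
    moreover have "ric (K w) (K w) + ric w w = - 2 * s (J w) - 2 * s w"
      using sJ[OF Klin Kanti KK RK, of w] sK by simp
    moreover have "ric (K w) (K w) + ric (J w) (J w) = - 2 * n * s (J w)"
      using sI[of "J w"] by (simp add: K_def)
    ultimately show ?thesis by simp
  qed
  have "s (J (\<i> *s u)) = s (J u)" by (simp add: J(2) s_neg s_i)
  then have "ric (\<i> *s u) (\<i> *s u) = ric u u" using two[of u] two[of "\<i> *s u"] s_i[of u] by simp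
  then have "(n - 2) * (s u + s (J u)) = 0" using sI[of u] two[of u] by (simp add: algebra_simps)
  then show ?thesis using n2 by (simp add: s_def)
qed

end

context complex_connection
begin

lemma curv_antisym: "curv c x v u = - curv c x u v"
  by (simp add: curv_def)

lemma dchris_sym:
  assumes c: "c \<in> A" "x \<in> chart_img c"
  shows "dchris c x w u *v v = dchris c x w v *v u"
proof -
  have d: "((\<lambda>y. chris c y u *v v) has_derivative (\<lambda>w. dchris c x w u *v v)) (at x)" for u v
    by (rule bounded_linear.has_derivative[OF
        bounded_bilinear.bounded_linear_left[OF bounded_bilinear_matrix_vector_mult] chris_has_derivative[OF c]])
  have sym: "chris c y v *v u = chris c y u *v v" if "y \<in> chart_img c" for y
    using \<Gamma>_chris[OF c(1) that, of v u] \<Gamma>_chris[OF c(1) that, of u v] \<Gamma>_sym[OF c(1) that, of v u] by simp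
  have "((\<lambda>y. chris c y u *v v) has_derivative (\<lambda>w. dchris c x w v *v u)) (at x)"
    by (rule has_derivative_transform_within_open[OF d open_img[OF c(1)] c(2)]) (rule sym)
  then show ?thesis using has_derivative_unique[OF d] by metis
qed

lemma curvature_tensor_curv:
  assumes c: "c \<in> A" "x \<in> chart_img c"
  shows "curvature_tensor (curv c x)"
  unfolding curvature_tensor_def
proof (intro conjI allI)
  show "linear (\<lambda>u. curv c x u v)" for v
    unfolding curv_def using linear_add[OF linear_dchris_left[OF c]] linear_add[OF linear_dchris_right[OF c]]
      linear_add[OF linear_chris[OF c]] linear_scale[OF linear_dchris_left[OF c]] linear_scale[OF linear_dchris_right[OF c]]
      linear_scale[OF linear_chris[OF c]]
    by (intro linearI) (simp_all add: bounded_bilinear.add_left[OF bounded_bilinear_matrix_matrix_mult]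
        bounded_bilinear.add_right[OF bounded_bilinear_matrix_matrix_mult] matrix_scaleR_left matrix_scaleR_right algebra_simps)
  show "curv c x v u = - curv c x u v" for u v by (rule curv_antisym)
  show "curv c x u v *v w + curv c x v w *v u + curv c x w u *v v = 0" for u v w
  proof -
    have sy: "chris c x p *v q = chris c x q *v p" for p q using \<Gamma>_sym[OF c] \<Gamma>_chris[OF c] by metis
    have e: "curv c x p q *v r = dchris c x p q *v r - dchris c x q p *v r
        + chris c x p *v (chris c x q *v r) - chris c x q *v (chris c x p *v r)" for p q r
      by (simp add: curv_def matrix_vector_mult_add_rdistrib matrix_vector_mult_diff_rdistrib matrix_vector_mul_assoc)
    show ?thesis
      unfolding e using dchris_sym[OF c, of u v w] dchris_sym[OF c, of v u w] dchris_sym[OF c, of w u v]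
        sy[of v w] sy[of u w] sy[of u v] by (simp add: algebra_simps)
  qed
qed

end

section \<open>Parallel quaternionic structures up to a phase\<close>

definition quat_matrix :: "complex ^ ('m::finite + 'm) ^ ('m + 'm)" where
  "quat_matrix = (\<chi> i j. case i of Inl k \<Rightarrow> (if j = Inr k then 1 else 0) | Inr k \<Rightarrow> (if j = Inl k then - 1 else 0))"

definition cnj_vec :: "complex ^ 'n \<Rightarrow> complex ^ 'n" where
  "cnj_vec v = (\<chi> i. cnj (v $ i))"

lemma quat_map_matrix: "quat_map v = quat_matrix *v cnj_vec v"
  by (simp add: vec_eq_iff quat_map_def quat_matrix_def cnj_vec_def matrix_vector_mult_def
      if_distrib if_distribR sum.delta split: sum.split cong: if_cong)

lemma cnj_vec_mult: "cnj_vec (A *v v) = cnj_matrix A *v cnj_vec v"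
  by (simp add: vec_eq_iff cnj_vec_def cnj_matrix_def matrix_vector_mult_def)

lemma cnj_vec_cnj_vec [simp]: "cnj_vec (cnj_vec v) = v"
  by (simp add: vec_eq_iff cnj_vec_def)

lemma linear_cnj_vec: "linear cnj_vec"
  by (rule linearI) (simp_all add: vec_eq_iff cnj_vec_def)

lemma cnj_vec_i: "cnj_vec (\<i> *s v) = - (\<i> *s cnj_vec v)"
  by (simp add: vec_eq_iff cnj_vec_def)

lemma cnj_quat_matrix [simp]: "cnj_matrix quat_matrix = quat_matrix"
  by (simp add: vec_eq_iff cnj_matrix_def quat_matrix_def split: sum.split)

lemma quat_matrix_square: "quat_matrix ** quat_matrix = (- mat 1 :: complex ^ ('m::finite + 'm) ^ ('m + 'm))"
proof -
  have q: "quat_matrix *v v = quat_map (cnj_vec v)" for v by (simp add: quat_map_matrix)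
  have "(quat_matrix ** quat_matrix) *v v = (- mat 1) *v v" for v :: "complex ^ ('m + 'm)"
    unfolding matrix_vector_mul_assoc[symmetric] q bounded_bilinear.minus_left[OF bounded_bilinear_matrix_vector_mult]
    by (simp add: vec_eq_iff quat_map_def cnj_vec_def split: sum.split)
  then show ?thesis by (simp only: matrix_eq) simp
qed

lemma mat_commute: "A ** mat \<zeta> = mat \<zeta> ** (A :: complex ^ 'n ^ 'n)"
  by (simp add: vec_eq_iff matrix_matrix_mult_def mat_def if_distrib if_distribR sum.delta mult.commute cong: if_cong)

lemma mat_left_commute: "(A :: complex ^ 'n ^ 'n) ** (mat \<zeta> ** C) = mat \<zeta> ** (A ** (C :: complex ^ 'n ^ 'n))"
  using mat_commute[of A \<zeta>] by (simp add: matrix_mul_assoc)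

lemma mat_mult_mat: "mat a ** mat b = (mat (a * b) :: complex ^ 'n ^ 'n)"
  by (simp add: vec_eq_iff mat_mult_component) (simp add: mat_def)

lemma cnj_matrix_mat: "cnj_matrix (mat a) = mat (cnj a)"
  by (simp add: vec_eq_iff cnj_matrix_def mat_def)

lemma det_mat: "det (mat \<zeta> :: complex ^ 'n ^ 'n) = \<zeta> ^ CARD('n)"
  by (subst det_diagonal) (simp_all add: mat_def)

text \<open>An element of \<open>U\<^sup>*(2m)\<close> is \<open>e\<^sup>i\<^sup>\<theta> B\<close> with \<open>B\<close> commuting with the antilinear structure.  The
  scalar is conjugated when it passes through the structure; so it commutes up to \<open>e\<^sup>2\<^sup>i\<^sup>\<theta>\<close>.\<close>

lemma U_star_quat:
  assumes "B \<in> U_star"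
  shows "cmod (det B) = 1" "\<exists>\<zeta>. \<zeta> \<noteq> 0 \<and> B ** quat_matrix = mat \<zeta> ** quat_matrix ** cnj_matrix B"
proof -
  obtain \<theta> B0 where B: "B = mat (cis \<theta>) ** B0" "B0 \<in> SU_star" using assms by (auto simp: U_star_def)
  have B0: "det B0 = 1" "\<And>v. B0 *v quat_map v = quat_map (B0 *v v)" using B(2) by (auto simp: SU_star_def)
  show "cmod (det B) = 1" by (simp add: B(1) det_mul B0(1) det_mat norm_power)
  have "(B0 ** quat_matrix) *v v = (quat_matrix ** cnj_matrix B0) *v v" for v
    using B0(2)[of "cnj_vec v"] by (simp add: quat_map_matrix cnj_vec_mult matrix_vector_mul_assoc)
  then have c: "B0 ** quat_matrix = quat_matrix ** cnj_matrix B0" by (simp add: matrix_eq)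
  have "mat (cis \<theta> * cis \<theta>) ** quat_matrix ** cnj_matrix B
      = mat (cis \<theta> * cis \<theta>) ** mat (cnj (cis \<theta>)) ** (quat_matrix ** cnj_matrix B0)"
    by (simp only: B(1) cnj_matrix_mult cnj_matrix_mat matrix_mul_assoc[symmetric] mat_left_commute[of quat_matrix])
  also have "\<dots> = mat (cis \<theta>) ** (quat_matrix ** cnj_matrix B0)"
    by (simp add: mat_mult_mat cis_cnj cis_mult mult.assoc)
  also have "\<dots> = B ** quat_matrix" by (simp add: B(1) c[symmetric] matrix_mul_assoc)
  finally show "\<exists>\<zeta>. \<zeta> \<noteq> 0 \<and> B ** quat_matrix = mat \<zeta> ** quat_matrix ** cnj_matrix B"
    by (intro exI[of _ "cis \<theta> * cis \<theta>"]) simp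
qed

lemmas matrix_mult_distribs =
  bounded_bilinear.add_left[OF bounded_bilinear_matrix_matrix_mult]
  bounded_bilinear.add_right[OF bounded_bilinear_matrix_matrix_mult]
  bounded_bilinear.diff_left[OF bounded_bilinear_matrix_matrix_mult]
  bounded_bilinear.diff_right[OF bounded_bilinear_matrix_matrix_mult]
  bounded_bilinear.minus_left[OF bounded_bilinear_matrix_matrix_mult]
  bounded_bilinear.minus_right[OF bounded_bilinear_matrix_matrix_mult]

lemmas cnj_matrix_linear =
  linear_add[OF bounded_linear.linear[OF bounded_linear_cnj_matrix]]
  linear_diff[OF bounded_linear.linear[OF bounded_linear_cnj_matrix]]
  linear_neg[OF bounded_linear.linear[OF bounded_linear_cnj_matrix]]

lemma bounded_linear_mat: "bounded_linear (mat :: complex \<Rightarrow> complex ^ 'n ^ 'n)"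
  unfolding linear_conv_bounded_linear[symmetric]
  by (rule linearI) (simp_all add: vec_eq_iff mat_def)

lemma mat_diff: "mat (a - b) = (mat a - mat b :: complex ^ 'n ^ 'n)"
  by (simp add: vec_eq_iff mat_def)

lemma bounded_linear_component2: "bounded_linear (\<lambda>M :: complex ^ 'n ^ 'm. M $ l $ j)"
  using bounded_linear_compose[OF bounded_linear_vec_nth bounded_linear_vec_nth, of l j] by simp

text \<open>The commutator of two covariant derivatives of a section \<open>N\<close>, parallel up to a scalar factor, of
  the bundle of antilinear endomorphisms.\<close>

lemma curvature_of_parallel_antilinear:
  fixes N G1 G2 D12 D21 P1 P2 :: "complex ^ 'n ^ 'n"
  assumes P1: "P1 = - (G1 ** N) + N ** cnj_matrix G1 + mat s1 ** N"
    and P2: "P2 = - (G2 ** N) + N ** cnj_matrix G2 + mat s2 ** N"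
    and E: "- (D21 ** N + G1 ** P2) + (P2 ** cnj_matrix G1 + N ** cnj_matrix D21) + (mat t12 ** N + mat s1 ** P2)
      = - (D12 ** N + G2 ** P1) + (P1 ** cnj_matrix G2 + N ** cnj_matrix D12) + (mat t21 ** N + mat s2 ** P1)"
  shows "(D12 - D21 + G1 ** G2 - G2 ** G1) ** N - N ** cnj_matrix (D12 - D21 + G1 ** G2 - G2 ** G1) = mat (t21 - t12) ** N"
proof -
  note rules = P1 P2 matrix_mult_distribs cnj_matrix_linear cnj_matrix_mult mat_diff matrix_mul_assoc[symmetric]
    mat_left_commute[of G1] mat_left_commute[of G2]
  have mm: "mat s2 ** (mat s1 ** N) = mat s1 ** (mat s2 ** N)" by (rule mat_left_commute)
  have "((D12 - D21 + G1 ** G2 - G2 ** G1) ** N - N ** cnj_matrix (D12 - D21 + G1 ** G2 - G2 ** G1)) - mat (t21 - t12) ** N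
    = (- (D21 ** N + G1 ** P2) + (P2 ** cnj_matrix G1 + N ** cnj_matrix D21) + (mat t12 ** N + mat s1 ** P2))
     - (- (D12 ** N + G2 ** P1) + (P1 ** cnj_matrix G2 + N ** cnj_matrix D12) + (mat t21 ** N + mat s2 ** P1))"
    by (simp add: rules mm)
  then show ?thesis using E by simp
qed

definition normalized :: "'n \<Rightarrow> 'n \<Rightarrow> complex ^ 'n ^ 'n \<Rightarrow> complex ^ 'n ^ 'n" where
  "normalized l j M = mat (inverse (M $ l $ j)) ** M"

lemma normalized_mat:
  fixes M :: "complex ^ 'n ^ 'n"
  shows "\<zeta> \<noteq> 0 \<Longrightarrow> normalized l j (mat \<zeta> ** M) = normalized l j M"
  by (simp add: normalized_def mat_mult_component vec_eq_iff)

lemma normalized_component: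
  fixes M :: "complex ^ 'n ^ 'n"
  shows "normalized l j M $ l $ j \<noteq> 0 \<longleftrightarrow> M $ l $ j \<noteq> 0"
  by (simp add: normalized_def mat_mult_component)

lemma tendsto_normalized:
  fixes M :: "complex ^ 'n ^ 'n"
  assumes f: "(f \<longlongrightarrow> M) Fi" and M: "M $ l $ j \<noteq> 0"
  shows "((\<lambda>z. normalized l j (f z)) \<longlongrightarrow> normalized l j M) Fi"
  unfolding normalized_def
  by (intro bounded_bilinear.tendsto[OF bounded_bilinear_matrix_matrix_mult]
      bounded_linear.tendsto[OF bounded_linear_mat] tendsto_inverse bounded_linear.tendsto[OF bounded_linear_component2] f M)

lemma has_vector_derivative_normalized:
  fixes f :: "real \<Rightarrow> complex ^ 'n ^ 'n"
  assumes f: "(f has_vector_derivative f') (at t within S)" and M: "f t $ l $ j \<noteq> 0"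
  defines "P \<equiv> mat (inverse (f t $ l $ j)) ** f'"
  shows "((\<lambda>s. normalized l j (f s)) has_vector_derivative (P - mat (P $ l $ j) ** normalized l j (f t))) (at t within S)"
proof -
  let ?m = "f t $ l $ j"
  have "((\<lambda>s. f s $ l $ j) has_vector_derivative f' $ l $ j) (at t within S)"
    by (rule bounded_linear.has_vector_derivative[OF bounded_linear_component2 f])
  from Deriv.has_derivative_inverse[OF M this[unfolded has_vector_derivative_def]]
  have "((\<lambda>s. inverse (f s $ l $ j)) has_vector_derivative (- (inverse ?m * f' $ l $ j * inverse ?m))) (at t within S)"
    unfolding has_vector_derivative_def by simp
  from bounded_bilinear.has_vector_derivative[OF bounded_bilinear_matrix_matrix_mult
      bounded_linear.has_vector_derivative[OF bounded_linear_mat this] f]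
  have "((\<lambda>s. normalized l j (f s)) has_vector_derivative
     (mat (inverse ?m) ** f' + mat (- (inverse ?m * f' $ l $ j * inverse ?m)) ** f t)) (at t within S)"
    by (simp add: normalized_def)
  moreover have "mat (inverse ?m) ** f' + mat (- (inverse ?m * f' $ l $ j * inverse ?m)) ** f t
     = P - mat (P $ l $ j) ** normalized l j (f t)"
    by (simp add: vec_eq_iff P_def normalized_def mat_mult_component)
  ultimately show ?thesis by simp
qed

locale quaternionic_frame_bundle = frame_bundle A \<Gamma> F
  for A :: "('p::t2_space, 'm::finite + 'm) chart set" and \<Gamma> F +
  assumes F_U_star: "\<And>c x H H'. c \<in> A \<Longrightarrow> x \<in> chart_img c \<Longrightarrow> H \<in> F c x \<Longrightarrow> H' \<in> F c x \<Longrightarrow> \<exists>B\<in>U_star. H = H' ** B"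
begin

definition Jmat :: "complex ^ ('m + 'm) ^ ('m + 'm) \<Rightarrow> complex ^ ('m + 'm) ^ ('m + 'm) \<Rightarrow> complex ^ ('m + 'm) ^ ('m + 'm)" where
  "Jmat H G = H ** quat_matrix ** cnj_matrix G"

lemma Jmat_phase:
  assumes c: "c \<in> A" "x \<in> chart_img c" and H: "H \<in> F c x" "H' \<in> F c x" and G: "H ** G = mat 1" "H' ** G' = mat 1"
  shows "\<exists>\<zeta>. \<zeta> \<noteq> 0 \<and> Jmat H G = mat \<zeta> ** Jmat H' G'"
proof -
  obtain B where B: "B \<in> U_star" "H = H' ** B" using F_U_star[OF c H] by blast
  obtain \<zeta> where \<zeta>: "\<zeta> \<noteq> 0" "B ** quat_matrix = mat \<zeta> ** quat_matrix ** cnj_matrix B" using U_star_quat(2)[OF B(1)] by blast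
  have GH: "G' ** H' = mat 1" using G(2) matrix_left_right_inverse by blast
  have "G' = G' ** (H ** G)" by (simp add: G(1))
  also have "\<dots> = (G' ** H') ** (B ** G)" by (simp add: B(2) matrix_mul_assoc)
  finally have BG: "B ** G = G'" by (simp add: GH)
  have "Jmat H G = H' ** (B ** quat_matrix) ** cnj_matrix G" by (simp add: Jmat_def B(2) matrix_mul_assoc)
  also have "\<dots> = H' ** (mat \<zeta> ** (quat_matrix ** cnj_matrix G'))"
    by (simp add: \<zeta>(2) BG[symmetric] cnj_matrix_mult matrix_mul_assoc)
  also have "\<dots> = mat \<zeta> ** Jmat H' G'" by (simp add: mat_left_commute[of H'] Jmat_def mat_commute[of H'] matrix_mul_assoc)
  finally show ?thesis using \<zeta>(1) by blast
qed

text \<open>The quaternionic structure \<open>Jmat\<close> is determined up to a phase only.  Dividing it by one of its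
  entries gives a well-defined matrix function, which is parallel up to a scalar factor.  This
  avoids a smooth choice of the phase.\<close>

definition Jnorm :: "('p, 'm + 'm) chart \<Rightarrow> 'm + 'm \<Rightarrow> 'm + 'm \<Rightarrow> complex ^ ('m + 'm) \<Rightarrow> complex ^ ('m + 'm) ^ ('m + 'm)" where
  "Jnorm c l j y = (SOME N. \<exists>H G. H \<in> F c y \<and> H ** G = mat 1 \<and> N = normalized l j (Jmat H G))"

lemma Jnorm_eq:
  assumes c: "c \<in> A" "y \<in> chart_img c" and H: "H \<in> F c y" "H ** G = mat 1"
  shows "Jnorm c l j y = normalized l j (Jmat H G)"
proof -
  have "\<exists>H' G'. H' \<in> F c y \<and> H' ** G' = mat 1 \<and> Jnorm c l j y = normalized l j (Jmat H' G')"
    unfolding Jnorm_def by (rule someI_ex) (use H in blast)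
  then obtain H' G' where H': "H' \<in> F c y" "H' ** G' = mat 1" "Jnorm c l j y = normalized l j (Jmat H' G')" by blast
  from Jmat_phase[OF c H'(1) H(1) H'(2) H(2)] show ?thesis using H'(3) normalized_mat by metis
qed

lemma frame_inverse:
  assumes c: "c \<in> A" "x \<in> chart_img c"
  obtains H G where "H \<in> F c x" "H ** G = mat 1"
  using F_nonempty[OF c] F_invertible[OF c] unfolding invertible_def by blast

text \<open>The matrix \<open>M\<close> of an antilinear map \<open>v \<mapsto> M (cnj v)\<close> is transported by \<open>X\<close> on the left and by the
  conjugate of its inverse on the right.\<close>

lemma Jmat_transport:
  assumes "X ** Y = mat 1" "H ** G = mat 1"
  shows "(X ** H) ** (G ** Y) = mat 1" "Jmat (X ** H) (G ** Y) = X ** Jmat H G ** cnj_matrix Y"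
proof -
  have "(X ** H) ** (G ** Y) = X ** (H ** G) ** Y" by (simp add: matrix_mul_assoc)
  then show "(X ** H) ** (G ** Y) = mat 1" using assms by simp
  show "Jmat (X ** H) (G ** Y) = X ** Jmat H G ** cnj_matrix Y"
    by (simp add: Jmat_def cnj_matrix_mult matrix_mul_assoc)
qed

text \<open>At a nearby point the frame can be taken to be the transport of the frame at \<open>y\<close>, which tends to
  that frame.\<close>

lemma Jnorm_continuous:
  assumes c: "c \<in> A" "y \<in> chart_img c" and nz: "Jnorm c l j y $ l $ j \<noteq> 0"
  shows "isCont (Jnorm c l j) y"
proof -
  obtain H G where H: "H \<in> F c y" "H ** G = mat 1" by (rule frame_inverse[OF c])
  define M where "M = Jmat H G"
  have Ny: "Jnorm c l j y = normalized l j M" unfolding M_def by (rule Jnorm_eq[OF c H])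
  have m: "M $ l $ j \<noteq> 0" using nz normalized_component Ny by metis
  obtain r C where r: "r > 0" "C > 0" "ball y r \<subseteq> chart_img c" and ex:
    "\<And>y' z. y' \<in> ball y r \<Longrightarrow> z \<in> ball y r \<Longrightarrow> \<exists>X Y. segment_transport c y' z X Y \<and>
       (\<forall>t\<in>{0..1}. norm (X t - mat 1) \<le> C * norm (z - y') \<and> norm (Y t - mat 1) \<le> C * norm (z - y'))"
    by (rule segment_transport_exists[OF c]) blast
  have yb: "y \<in> ball y r" using r by simp
  obtain X Y where X: "\<And>z. z \<in> ball y r \<Longrightarrow> segment_transport c y z (X z) (Y z)"
    "\<And>z t. z \<in> ball y r \<Longrightarrow> t \<in> {0..1} \<Longrightarrow> norm (X z t - mat 1) \<le> C * norm (z - y)"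
    "\<And>z t. z \<in> ball y r \<Longrightarrow> t \<in> {0..1} \<Longrightarrow> norm (Y z t - mat 1) \<le> C * norm (z - y)"
    using ex[OF yb] by metis
  have ev: "\<forall>\<^sub>F z in at y. z \<in> ball y r" using r by (intro eventually_at_in_open') auto
  have lim0: "((\<lambda>z. C * norm (z - y)) \<longlongrightarrow> 0) (at y)"
  proof -
    have "((\<lambda>z. C * norm (z - y)) \<longlongrightarrow> C * norm (y - y)) (at y)" by (intro tendsto_intros)
    then show ?thesis by simp
  qed
  have X1: "((\<lambda>z. X z 1) \<longlongrightarrow> mat 1) (at y)"
    by (rule LIM_zero_cancel, rule Lim_null_comparison[OF _ lim0]) (use ev in \<open>eventually_elim, simp add: X\<close>)
  have Y1: "((\<lambda>z. Y z 1) \<longlongrightarrow> mat 1) (at y)"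
    by (rule LIM_zero_cancel, rule Lim_null_comparison[OF _ lim0]) (use ev in \<open>eventually_elim, simp add: X\<close>)
  have "((\<lambda>z. X z 1 ** M ** cnj_matrix (Y z 1)) \<longlongrightarrow> mat 1 ** M ** cnj_matrix (mat 1)) (at y)"
    by (intro bounded_bilinear.tendsto[OF bounded_bilinear_matrix_matrix_mult] X1 tendsto_const
        bounded_linear.tendsto[OF bounded_linear_cnj_matrix] Y1)
  then have "((\<lambda>z. normalized l j (X z 1 ** M ** cnj_matrix (Y z 1))) \<longlongrightarrow> normalized l j M) (at y)"
    by (intro tendsto_normalized m) simp
  moreover have "\<forall>\<^sub>F z in at y. normalized l j (X z 1 ** M ** cnj_matrix (Y z 1)) = Jnorm c l j z"
    using ev
  proof eventually_elim
    case (elim z)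
    have one: "(1::real) \<in> {0..1}" by simp
    have z: "z \<in> chart_img c" "X z 1 ** H \<in> F c z"
      using frames_along_segment[OF c(1) r(3) yb elim X(1)[OF elim] H(1) one] by simp_all
    have XY: "X z 1 ** Y z 1 = mat 1" using X(1)[OF elim] one unfolding segment_transport_def fundamental_pair_def by blast
    show ?case using Jnorm_eq[OF c(1) z Jmat_transport(1)[OF XY H(2)]] Jmat_transport(2)[OF XY H(2)] by (simp add: M_def)
  qed
  ultimately show ?thesis unfolding isCont_def Ny by (rule Lim_transform_eventually)
qed

definition Jnorm_deriv :: "('p, 'm + 'm) chart \<Rightarrow> 'm + 'm \<Rightarrow> 'm + 'm \<Rightarrow> complex ^ ('m + 'm) \<Rightarrow> complex ^ ('m + 'm) \<Rightarrow> complex ^ ('m + 'm) ^ ('m + 'm)" where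
  "Jnorm_deriv c l j y u = - (chris c y u ** Jnorm c l j y) + Jnorm c l j y ** cnj_matrix (chris c y u)
     + mat ((chris c y u ** Jnorm c l j y - Jnorm c l j y ** cnj_matrix (chris c y u)) $ l $ j) ** Jnorm c l j y"

lemma Jnorm_right_derivative:
  assumes c: "c \<in> A" "y \<in> chart_img c" and nz: "Jnorm c l j y $ l $ j \<noteq> 0"
  shows "((\<lambda>t. Jnorm c l j (y + t *\<^sub>R u)) has_vector_derivative Jnorm_deriv c l j y u) (at 0 within {0..})"
proof -
  obtain H G where H: "H \<in> F c y" "H ** G = mat 1" by (rule frame_inverse[OF c])
  define M where "M = Jmat H G"
  have Ny: "Jnorm c l j y = normalized l j M" unfolding M_def by (rule Jnorm_eq[OF c H])
  have m: "M $ l $ j \<noteq> 0" using nz normalized_component Ny by metis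
  from frames_near[OF c H(1), of u] obtain s X Y where s: "s > 0" and X: "segment_transport c y (y + s *\<^sub>R u) X Y"
    and im: "\<And>t. t \<in> {0..1} \<Longrightarrow> y + t *\<^sub>R (s *\<^sub>R u) \<in> chart_img c"
    and fr: "\<And>t. t \<in> {0..1} \<Longrightarrow> X t ** H \<in> F c (y + t *\<^sub>R (s *\<^sub>R u))" by blast
  note P = X[unfolded segment_transport_def fundamental_pair_def]
  let ?C = "chris c y (s *\<^sub>R u)"
  have X0: "X 0 = mat 1" "Y 0 = mat 1" using P by simp_all
  have Xd: "(X has_vector_derivative - ?C) (at 0 within {0..1})"
    using P X0 by (auto dest!: bspec[of _ _ 0])
  have Yd: "(Y has_vector_derivative ?C) (at 0 within {0..1})"
    using P X0 by (auto dest!: bspec[of _ _ 0])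
  have "((\<lambda>t. X t ** M ** cnj_matrix (Y t)) has_vector_derivative
      (X 0 ** M ** cnj_matrix ?C + (- ?C ** M) ** cnj_matrix (Y 0))) (at 0 within {0..1})"
    by (rule bounded_bilinear.has_vector_derivative[OF bounded_bilinear_matrix_matrix_mult
        bounded_linear.has_vector_derivative[OF bounded_bilinear.bounded_linear_left[OF bounded_bilinear_matrix_matrix_mult] Xd]
        bounded_linear.has_vector_derivative[OF bounded_linear_cnj_matrix Yd]])
  then have d: "((\<lambda>t. X t ** M ** cnj_matrix (Y t)) has_vector_derivative (M ** cnj_matrix ?C - ?C ** M)) (at 0 within {0..1})"
    using X0 by (simp add: matrix_mult_distribs)
  let ?N = "Jnorm c l j y"
  define Q where "Q = ?N ** cnj_matrix ?C - ?C ** ?N"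
  have Q: "mat (inverse (M $ l $ j)) ** (M ** cnj_matrix ?C - ?C ** M) = Q"
    by (simp add: Q_def Ny normalized_def matrix_mult_distribs matrix_mul_assoc mat_commute[of ?C])
  have "((\<lambda>t. normalized l j (X t ** M ** cnj_matrix (Y t))) has_vector_derivative (Q - mat (Q $ l $ j) ** ?N)) (at 0 within {0..1})"
    using has_vector_derivative_normalized[OF d, of l j] m X0 Q by (simp add: Ny)
  then have "((\<lambda>t. Jnorm c l j (y + t *\<^sub>R (s *\<^sub>R u))) has_vector_derivative (Q - mat (Q $ l $ j) ** ?N)) (at 0 within {0..1})"
  proof (rule has_vector_derivative_transform[rotated 2])
    fix t :: real assume t: "t \<in> {0..1}"
    have XY: "X t ** Y t = mat 1" using P t by blast
    show "Jnorm c l j (y + t *\<^sub>R (s *\<^sub>R u)) = normalized l j (X t ** M ** cnj_matrix (Y t))"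
      using Jnorm_eq[OF c(1) im[OF t] fr[OF t] Jmat_transport(1)[OF XY H(2)]] Jmat_transport(2)[OF XY H(2)]
      by (simp add: M_def)
  qed simp
  moreover have "Q - mat (Q $ l $ j) ** ?N = s *\<^sub>R Jnorm_deriv c l j y u"
  proof -
    have C: "?C = s *\<^sub>R chris c y u" by (rule linear_scale[OF linear_chris[OF c]])
    have sc: "cnj_matrix (s *\<^sub>R chris c y u) = s *\<^sub>R cnj_matrix (chris c y u)"
      by (rule linear_scale[OF bounded_linear.linear[OF bounded_linear_cnj_matrix]])
    show ?thesis
      by (simp add: Q_def Jnorm_deriv_def C sc matrix_scaleR_left matrix_scaleR_right vec_eq_iff mat_mult_component algebra_simps)
  qed
  ultimately show ?thesis by (intro right_derivative_rescale[OF _ s]) simp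
qed

lemma Jmat_square:
  assumes "H ** G = mat 1" shows "Jmat H G ** cnj_matrix (Jmat H G) = - mat 1"
proof -
  have GH: "G ** H = mat 1" using assms matrix_left_right_inverse by blast
  have "Jmat H G ** cnj_matrix (Jmat H G) = H ** quat_matrix ** cnj_matrix (G ** H) ** quat_matrix ** G"
    by (simp add: Jmat_def cnj_matrix_mult matrix_mul_assoc)
  also have "\<dots> = H ** (quat_matrix ** quat_matrix) ** G" by (simp add: GH matrix_mul_assoc)
  also have "\<dots> = - mat 1" by (simp add: quat_matrix_square matrix_mult_distribs assms)
  finally show ?thesis .
qed

text \<open>On the open set where the chosen entry does not vanish, \<open>Jnorm\<close> is differentiable, and its derivative
  is an expression in the Christoffel symbols and \<open>Jnorm\<close> itself.  So it is twice differentiable, and the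
  symmetry of the second derivative is the assertion.\<close>

theorem curv_commutes_up_to_scalar:
  assumes c: "c \<in> A" "x \<in> chart_img c" and H: "H \<in> F c x" "H ** G = mat 1"
  shows "\<exists>\<kappa>. curv c x u v ** Jmat H G - Jmat H G ** cnj_matrix (curv c x u v) = mat \<kappa> ** Jmat H G"
proof -
  define M where "M = Jmat H G"
  have "M \<noteq> 0"
  proof
    assume "M = 0"
    then have "(- mat 1 :: complex ^ ('m + 'm) ^ ('m + 'm)) = 0"
      using Jmat_square[OF H(2)] by (simp add: M_def[symmetric] bounded_bilinear.zero_left[OF bounded_bilinear_matrix_matrix_mult])
    then have "(mat 1 :: complex ^ ('m + 'm) ^ ('m + 'm)) $ undefined $ undefined = 0" by simp
    then show False by (simp add: mat_def)
  qed
  then obtain l j where lj: "M $ l $ j \<noteq> 0" by (auto simp: vec_eq_iff)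
  define N where "N = Jnorm c l j"
  have Nx: "N x = normalized l j M" unfolding M_def N_def by (rule Jnorm_eq[OF c H])
  define S where "S = {y \<in> chart_img c. N y $ l $ j \<noteq> 0}"
  have xS: "x \<in> S" using c lj Nx normalized_component by (auto simp: S_def)
  have Ncont: "isCont N y" if "y \<in> S" for y
    using that unfolding S_def N_def by (intro Jnorm_continuous[OF c(1)]) auto
  have S: "open S"
  proof (subst open_subopen, rule ballI)
    fix y assume y: "y \<in> S"
    have "isCont (\<lambda>z. N z $ l $ j) y" by (rule bounded_linear.isCont[OF bounded_linear_component2 Ncont[OF y]])
    then have "((\<lambda>z. N z $ l $ j) \<longlongrightarrow> N y $ l $ j) (nhds y)" using tendsto_at_iff_tendsto_nhds[of "\<lambda>z. N z $ l $ j" y] by (simp add: isCont_def)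
    then have "\<forall>\<^sub>F z in nhds y. N z $ l $ j \<in> - {0}"
      using y by (intro topological_tendstoD) (auto simp: S_def)
    moreover have "\<forall>\<^sub>F z in nhds y. z \<in> chart_img c"
      using y open_img[OF c(1)] by (intro eventually_nhds_in_open) (auto simp: S_def)
    ultimately have "\<forall>\<^sub>F z in nhds y. z \<in> S" by eventually_elim (simp add: S_def)
    then show "\<exists>T. open T \<and> y \<in> T \<and> T \<subseteq> S" unfolding eventually_nhds by blast
  qed
  have Sc: "S \<subseteq> chart_img c" by (auto simp: S_def)
  have NcontS: "continuous_on S N" using Ncont by (intro continuous_at_imp_continuous_on) auto
  define \<Phi> where "\<Phi> = Jnorm_deriv c l j"
  define \<sigma> where "\<sigma> = (\<lambda>y u. (chris c y u ** N y - N y ** cnj_matrix (chris c y u)) $ l $ j)"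
  have \<Phi>: "\<Phi> y u = - (chris c y u ** N y) + N y ** cnj_matrix (chris c y u) + mat (\<sigma> y u) ** N y" for y u
    by (simp add: \<Phi>_def Jnorm_deriv_def N_def \<sigma>_def)
  have Nder: "(N has_derivative \<Phi> y) (at y)" if y: "y \<in> S" for y
  proof (rule has_derivative_from_right_derivatives[OF S _ _ _ y])
    show "((\<lambda>t. N (y + t *\<^sub>R u)) has_vector_derivative \<Phi> y u) (at 0 within {0..})" if "y \<in> S" for y u
      unfolding N_def \<Phi>_def by (rule Jnorm_right_derivative[OF c(1)]) (use that in \<open>auto simp: S_def N_def\<close>)
    show "linear (\<Phi> y)" if "y \<in> S" for y
    proof -
      have yi: "y \<in> chart_img c" using that Sc by blast
      show ?thesis unfolding \<Phi> \<sigma>_def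
        by (rule linearI) (simp_all add: linear_add[OF linear_chris[OF c(1) yi]] linear_scale[OF linear_chris[OF c(1) yi]]
            cnj_matrix_linear linear_scale[OF bounded_linear.linear[OF bounded_linear_cnj_matrix]] matrix_mult_distribs
            matrix_scaleR_left matrix_scaleR_right vec_eq_iff mat_mult_component algebra_simps)
    qed
    show "continuous_on S (\<lambda>y. \<Phi> y u)" for u
      unfolding \<Phi> \<sigma>_def
      by (intro continuous_intros bounded_bilinear.continuous_on[OF bounded_bilinear_matrix_matrix_mult]
          bounded_linear.continuous_on[OF bounded_linear_cnj_matrix] bounded_linear.continuous_on[OF bounded_linear_mat]
          bounded_linear.continuous_on[OF bounded_linear_component2] NcontS
          continuous_on_subset[OF continuous_on_chris[OF c(1)] Sc])
  qed
  have "\<exists>\<tau>. \<forall>u. ((\<lambda>y. \<Phi> y u) has_derivative (\<lambda>w. - (dchris c x w u ** N x + chris c x u ** \<Phi> x w)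
      + (\<Phi> x w ** cnj_matrix (chris c x u) + N x ** cnj_matrix (dchris c x w u))
      + (mat (\<tau> u w) ** N x + mat (\<sigma> x u) ** \<Phi> x w))) (at x)"
  proof -
    note dN = Nder[OF xS]
    note dC = chris_has_derivative[OF c]
    have dCN: "((\<lambda>y. chris c y u ** N y) has_derivative (\<lambda>w. chris c x u ** \<Phi> x w + dchris c x w u ** N x)) (at x)" for u
      by (rule bounded_bilinear.FDERIV[OF bounded_bilinear_matrix_matrix_mult dC dN])
    have dNC: "((\<lambda>y. N y ** cnj_matrix (chris c y u)) has_derivative (\<lambda>w. N x ** cnj_matrix (dchris c x w u) + \<Phi> x w ** cnj_matrix (chris c x u))) (at x)" for u
      by (rule bounded_bilinear.FDERIV[OF bounded_bilinear_matrix_matrix_mult dN bounded_linear.has_derivative[OF bounded_linear_cnj_matrix dC]])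
    define \<tau> where "\<tau> = (\<lambda>u w. ((chris c x u ** \<Phi> x w + dchris c x w u ** N x) - (N x ** cnj_matrix (dchris c x w u) + \<Phi> x w ** cnj_matrix (chris c x u))) $ l $ j)"
    have d\<sigma>: "((\<lambda>y. \<sigma> y u) has_derivative \<tau> u) (at x)" for u
      unfolding \<sigma>_def \<tau>_def by (rule bounded_linear.has_derivative[OF bounded_linear_component2 has_derivative_diff[OF dCN dNC]])
    have d\<sigma>N: "((\<lambda>y. mat (\<sigma> y u) ** N y) has_derivative (\<lambda>w. mat (\<sigma> x u) ** \<Phi> x w + mat (\<tau> u w) ** N x)) (at x)" for u
      by (rule bounded_bilinear.FDERIV[OF bounded_bilinear_matrix_matrix_mult bounded_linear.has_derivative[OF bounded_linear_mat d\<sigma>] dN])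
    have "((\<lambda>y. \<Phi> y u) has_derivative (\<lambda>w. - (chris c x u ** \<Phi> x w + dchris c x w u ** N x)
      + (N x ** cnj_matrix (dchris c x w u) + \<Phi> x w ** cnj_matrix (chris c x u))
      + (mat (\<sigma> x u) ** \<Phi> x w + mat (\<tau> u w) ** N x))) (at x)" for u
      unfolding \<Phi>[of _ u] by (rule has_derivative_add[OF has_derivative_add[OF has_derivative_minus[OF dCN] dNC] d\<sigma>N])
    then show ?thesis by (intro exI[of _ \<tau>] allI) (simp add: add_ac)
  qed
  then obtain \<tau> where d\<Phi>: "\<And>u. ((\<lambda>y. \<Phi> y u) has_derivative (\<lambda>w. - (dchris c x w u ** N x + chris c x u ** \<Phi> x w)
      + (\<Phi> x w ** cnj_matrix (chris c x u) + N x ** cnj_matrix (dchris c x w u))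
      + (mat (\<tau> u w) ** N x + mat (\<sigma> x u) ** \<Phi> x w))) (at x)" by blast
  have RN: "curv c x u v ** N x - N x ** cnj_matrix (curv c x u v) = mat (\<tau> v u - \<tau> u v) ** N x"
    unfolding curv_def
    by (rule curvature_of_parallel_antilinear[OF \<Phi>[of x u] \<Phi>[of x v] symmetric_second_derivative[OF S xS Nder d\<Phi> d\<Phi>]])
  have M: "M = mat (M $ l $ j) ** N x"
    using lj by (simp add: Nx normalized_def matrix_mul_assoc mat_mult_mat)
  have "curv c x u v ** M - M ** cnj_matrix (curv c x u v) = mat (M $ l $ j) ** (curv c x u v ** N x - N x ** cnj_matrix (curv c x u v))"
    by (subst (1 2) M) (simp add: matrix_mult_distribs mat_left_commute[of "curv c x u v"] mat_commute[of "curv c x u v"] matrix_mul_assoc)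
  also have "\<dots> = mat (\<tau> v u - \<tau> u v) ** (mat (M $ l $ j) ** N x)" unfolding RN by (rule mat_left_commute)
  finally show ?thesis unfolding M_def[symmetric] M[symmetric] by blast
qed

text \<open>The trace of the commutation relation determines the scalar.\<close>

lemma curv_commutator_scalar:
  fixes \<kappa> :: complex
  assumes H: "H ** G = mat 1" and \<kappa>: "R ** Jmat H G - Jmat H G ** cnj_matrix R = mat \<kappa> ** Jmat H G"
  shows "real CARD('m + 'm) * \<kappa> = 2 * \<i> * Im (trace R)"
proof -
  define M where "M = Jmat H G"
  have MM: "M ** cnj_matrix M = - mat 1" unfolding M_def by (rule Jmat_square[OF H])
  then have MM': "cnj_matrix M ** M = - mat 1"
  proof -
    have "M ** (- cnj_matrix M) = mat 1" using MM by (simp add: matrix_mult_distribs)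
    then have "(- cnj_matrix M) ** M = mat 1" using matrix_left_right_inverse by blast
    then have "- (cnj_matrix M ** M) = mat 1" by (simp add: matrix_mult_distribs)
    then show ?thesis by (metis minus_minus)
  qed
  have "(R ** M - M ** cnj_matrix R) ** cnj_matrix M = mat \<kappa> ** M ** cnj_matrix M"
    using \<kappa> by (simp add: M_def)
  then have "- R - M ** cnj_matrix R ** cnj_matrix M = - mat \<kappa>"
    by (simp add: matrix_mult_distribs matrix_mul_assoc[symmetric] MM)
  then have "trace R + trace (M ** cnj_matrix R ** cnj_matrix M) = trace (mat \<kappa> :: complex ^ ('m + 'm) ^ ('m + 'm))"
    by (metis (no_types, lifting) linear_add[OF linear_trace] minus_diff_eq minus_minus diff_minus_eq_add add.commute)
  moreover have "trace (M ** cnj_matrix R ** cnj_matrix M) = - cnj (trace R)"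
  proof -
    have "trace (M ** cnj_matrix R ** cnj_matrix M) = trace (cnj_matrix M ** (M ** cnj_matrix R))" by (rule trace_mult_commute)
    also have "\<dots> = trace (- cnj_matrix R)" by (simp add: matrix_mul_assoc MM' matrix_mult_distribs)
    also have "\<dots> = - cnj (trace R)" by (simp add: trace_def cnj_matrix_def sum_negf)
    finally show ?thesis .
  qed
  moreover have "trace (mat \<kappa> :: complex ^ ('m + 'm) ^ ('m + 'm)) = real CARD('m + 'm) * \<kappa>"
    by (simp add: trace_def mat_def)
  ultimately show ?thesis by (simp add: complex_eq_iff)
qed

text \<open>Up to sign, \<open>J\<close> maps the first half of the columns of a frame to the second half.\<close>

theorem ricci_form_trace_zero:
  assumes m: "CARD('m) > 1" and c: "c \<in> A" "x \<in> chart_img c" and H: "H \<in> F c x"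
  shows "(\<Sum>k\<in>UNIV. ricci_form \<Gamma> c x (H *v axis k 1) (\<i> *s (H *v axis k 1))) = 0"
proof -
  obtain G where HG: "H ** G = mat 1" using F_invertible[OF c H] unfolding invertible_def by blast
  have GH: "G ** H = mat 1" using HG matrix_left_right_inverse by blast
  define n where "n = real CARD('m + 'm)"
  have n: "n > 2" using m by (simp add: n_def)
  define a where "a = (\<lambda>u v. Im (trace (curv c x u v)) / n)"
  have ric_a: "ricci_form \<Gamma> c x u v = - n * a u v" for u v
    using n by (simp add: ricci_form_dtheta[OF c] a_def trace_curv)
  define J where "J = (\<lambda>w. Jmat H G *v cnj_vec w)"
  interpret curvature_tensor "curv c x" by (rule curvature_tensor_curv[OF c])
  have J_quat: "J w = H *v quat_map (G *v w)" for w
    by (simp add: J_def Jmat_def quat_map_matrix cnj_vec_mult matrix_vector_mul_assoc matrix_mul_assoc)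
  have Jlin: "linear J"
    unfolding J_def using linear_compose[OF linear_cnj_vec linear_complex_matrix_vector_mult] by (simp add: o_def)
  have Janti: "J (\<i> *s w) = - (\<i> *s J w)" for w
    by (simp add: J_def cnj_vec_i linear_neg[OF linear_complex_matrix_vector_mult])
  have JJ: "J (J w) = - w" for w
    using Jmat_square[OF HG] by (simp add: J_def cnj_vec_mult matrix_vector_mul_assoc
        bounded_bilinear.minus_left[OF bounded_bilinear_matrix_vector_mult])
  have RJ: "curv c x u v *v J w = J (curv c x u v *v w) + (2 * a u v) *\<^sub>R (\<i> *s J w)" for u v w
  proof -
    obtain \<kappa> where \<kappa>: "curv c x u v ** Jmat H G - Jmat H G ** cnj_matrix (curv c x u v) = mat \<kappa> ** Jmat H G"
      using curv_commutes_up_to_scalar[OF c H HG] by blast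
    have "of_real n * \<kappa> = 2 * \<i> * Im (trace (curv c x u v))"
      using curv_commutator_scalar[OF HG \<kappa>] by (simp add: n_def)
    then have "\<kappa> = of_real (2 * a u v) * \<i>" using n by (simp add: a_def field_simps)
    then have \<kappa>J: "\<kappa> *s J w = (2 * a u v) *\<^sub>R (\<i> *s J w)"
      by (simp add: scaleR_conv_vector_scalar_mult vector_smult_assoc)
    have "curv c x u v ** Jmat H G = Jmat H G ** cnj_matrix (curv c x u v) + mat \<kappa> ** Jmat H G"
      using \<kappa> by (metis add.commute diff_add_cancel)
    then have "(curv c x u v ** Jmat H G) *v cnj_vec w
        = (Jmat H G ** cnj_matrix (curv c x u v)) *v cnj_vec w + (mat \<kappa> ** Jmat H G) *v cnj_vec w"
      by (simp add: matrix_vector_mult_add_rdistrib)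
    then have "curv c x u v *v J w = J (curv c x u v *v w) + \<kappa> *s J w"
      by (simp add: J_def cnj_vec_mult matrix_vector_mul_assoc[symmetric] mat_mult_vec)
    then show ?thesis by (simp only: \<kappa>J)
  qed
  have s: "a w (\<i> *s w) + a (J w) (\<i> *s J w) = 0" for w
  proof (rule trace_form_J_anti_invariant[OF Jlin Janti JJ RJ])
    show "Im (trace (curv c x u v)) = real CARD('m + 'm) * a u v" for u v using n by (simp add: a_def n_def)
    show "a (\<i> *s u) (\<i> *s v) = a u v" for u v
      using ricci_form_I_invariant[OF c, of u v] n by (simp add: ric_a)
    show "2 < CARD('m + 'm)" using m by simp
  qed
  have pair: "ricci_form \<Gamma> c x (H *v axis (Inl k) 1) (\<i> *s (H *v axis (Inl k) 1))
     + ricci_form \<Gamma> c x (H *v axis (Inr k) 1) (\<i> *s (H *v axis (Inr k) 1)) = 0" for k :: 'm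
  proof -
    have "quat_map (axis (Inl k) 1) = - axis (Inr k) (1 :: complex)"
      by (simp add: vec_eq_iff quat_map_def axis_def split: sum.split)
    then have "J (H *v axis (Inl k) 1) = - (H *v axis (Inr k) 1)"
      by (simp add: J_quat matrix_vector_mul_assoc GH linear_neg[OF linear_complex_matrix_vector_mult])
    moreover have "ricci_form \<Gamma> c x (- w) (\<i> *s (- w)) = ricci_form \<Gamma> c x w (\<i> *s w)" for w
    proof -
      have "\<i> *s (\<i> *s w) = - w" for w :: "complex ^ ('m + 'm)" by (simp add: vec_eq_iff)
      then show ?thesis using ricci_form_I_invariant[OF c, of w "\<i> *s w"] ricci_form_I_invariant[OF c, of "\<i> *s w" "\<i> *s (\<i> *s w)"]
        by simp
    qed
    moreover have "ricci_form \<Gamma> c x w (\<i> *s w) + ricci_form \<Gamma> c x (J w) (\<i> *s J w) = 0" for w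
    proof -
      have "- n * a w (\<i> *s w) + - n * a (J w) (\<i> *s J w) = - n * (a w (\<i> *s w) + a (J w) (\<i> *s J w))"
        by (simp only: distrib_left)
      then show ?thesis by (simp only: ric_a s mult_zero_right)
    qed
    ultimately show ?thesis by metis
  qed
  have "(\<Sum>k\<in>UNIV. ricci_form \<Gamma> c x (H *v axis k 1) (\<i> *s (H *v axis k 1)))
    = (\<Sum>k\<in>(UNIV::'m set). ricci_form \<Gamma> c x (H *v axis (Inl k) 1) (\<i> *s (H *v axis (Inl k) 1)))
    + (\<Sum>k\<in>(UNIV::'m set). ricci_form \<Gamma> c x (H *v axis (Inr k) 1) (\<i> *s (H *v axis (Inr k) 1)))"
    unfolding UNIV_Plus_UNIV[symmetric] by (subst sum.Plus) simp_all
  also have "\<dots> = 0" by (simp only: sum.distrib[symmetric] pair sum.neutral_const)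
  finally show ?thesis .
qed

end

section \<open>Frames given by the holonomy group\<close>

lemma (in complex_connection) transports_invertible:
  "transports c x d y P \<Longrightarrow> invertible P"
  using transports_sym matrix_left_right_inverse unfolding invertible_def by blast

text \<open>The frame \<open>F0\<close> at the base point identifies the tangent space there with \<open>\<complex>\<^sup>n\<close>, with the holonomy group
  in \<open>U\<^sup>*(2m)\<close>.  The bundle consists of all transports of its inverse.\<close>

theorem quaternionic_frame_bundle_exists:
  fixes A :: "('p::t2_space, 'm::finite + 'm) chart set"
  assumes conn: "complex_connection A \<Gamma>" and connected: "connected (UNIV :: 'p set)"
    and hol: "holonomy_in_U_star A \<Gamma>"
  shows "\<exists>F. quaternionic_frame_bundle A \<Gamma> F"
proof -
  interpret complex_connection A \<Gamma> by (rule conn)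
  obtain p c0 and F0 :: "complex ^ ('m + 'm) ^ ('m + 'm)" where c0: "c0 \<in> A" "p \<in> chart_dom c0" and F0: "invertible F0"
    and U: "\<And>L. L \<in> holonomy_group A \<Gamma> c0 p \<Longrightarrow> \<exists>B\<in>U_star. \<forall>u. F0 *v L u = B *v (F0 *v u)"
    using hol unfolding holonomy_in_U_star_def by blast
  define x0 where "x0 = snd c0 p"
  have x0: "x0 \<in> chart_img c0" "point c0 x0 = p" using c0 by (auto simp: x0_def)
  obtain E where E: "F0 ** E = mat 1" "E ** F0 = mat 1" using F0 unfolding invertible_def by blast
  define F where "F = (\<lambda>c x. {P ** E | P. transports c0 x0 c x P})"
  have FU: "\<exists>B\<in>U_star. H = H' ** B" if "H \<in> F c x" "H' \<in> F c x" for c x H H'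
  proof -
    obtain P P' where P: "H = P ** E" "transports c0 x0 c x P" and P': "H' = P' ** E" "transports c0 x0 c x P'"
      using \<open>H \<in> F c x\<close> \<open>H' \<in> F c x\<close> unfolding F_def by blast
    obtain Q where Q: "transports c x c0 x0 Q" "Q ** P' = mat 1" using transports_sym[OF P'(2)] by blast
    have PQ: "P' ** Q = mat 1" using Q(2) matrix_left_right_inverse by blast
    have "(\<lambda>u. (Q ** P) *v u) \<in> holonomy_group A \<Gamma> c0 p"
      using holonomy_of_transports[OF transports_trans[OF Q(1) P(2)]] x0(2) by simp
    from U[OF this] obtain B where B: "B \<in> U_star" "\<And>u. F0 *v ((Q ** P) *v u) = B *v (F0 *v u)" by blast
    have "F0 ** (Q ** P) = B ** F0" by (simp add: matrix_eq matrix_vector_mul_assoc[symmetric]) (metis B(2) matrix_vector_mul_assoc)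
    then have BE: "F0 ** (Q ** P) ** E = B" by (metis E(1) matrix_mul_assoc matrix_mul_rid)
    have "H' ** B = P' ** (E ** F0) ** (Q ** P) ** E" unfolding P'(1) BE[symmetric] by (simp add: matrix_mul_assoc)
    also have "\<dots> = (P' ** Q) ** P ** E" by (simp add: E(2) matrix_mul_assoc)
    also have "\<dots> = H" by (simp add: PQ P(1))
    finally show ?thesis using B(1) by (intro bexI[of _ B]) simp_all
  qed
  have "quaternionic_frame_bundle A \<Gamma> F"
  proof unfold_locales
    show "invertible H" if a: "H \<in> F c x" for c x H
    proof -
      obtain P where P: "H = P ** E" "transports c0 x0 c x P" using a unfolding F_def by blast
      have "invertible E" using E unfolding invertible_def by blast
      then show ?thesis unfolding P(1) using transports_invertible[OF P(2)] by (intro invertible_mult)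
    qed
    show "F c x \<noteq> {}" if "c \<in> A" "x \<in> chart_img c" for c x
      using transports_everywhere[OF connected c0(1) x0(1) that] unfolding F_def by blast
    show "jacobian c d x ** H \<in> F d (transition c d x)"
      if a: "c \<in> A" "d \<in> A" "x \<in> overlap c d" "H \<in> F c x" for c d x H
    proof -
      obtain P where P: "H = P ** E" "transports c0 x0 c x P" using a(4) unfolding F_def by blast
      from transports.change_chart[OF P(2) a(2,3)] show ?thesis
        unfolding F_def P(1) by (auto simp: matrix_mul_assoc)
    qed
    show "X 1 ** H \<in> F c z"
      if a: "c \<in> A" "segment_transport c y z X Y" "closed_segment y z \<subseteq> chart_img c" "H \<in> F c y" for c y z X Y H
    proof -
      obtain P where P: "H = P ** E" "transports c0 x0 c y P" using a(4) unfolding F_def by blast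
      from transports.segment[OF P(2) a(2,3)] show ?thesis
        unfolding F_def P(1) by (auto simp: matrix_mul_assoc)
    qed
    show "\<exists>B\<in>U_star. H = H' ** B" if "H \<in> F c x" "H' \<in> F c x" for c x H H'
      by (rule FU[OF that])
    show "cmod (det H) = cmod (det H')" if a: "H \<in> F c x" "H' \<in> F c x" for c x H H'
    proof -
      obtain B where B: "B \<in> U_star" "H = H' ** B" using FU[OF a] by blast
      show ?thesis using U_star_quat(1)[OF B(1)] by (simp add: B(2) det_mul norm_mult)
    qed
  qed
  then show ?thesis by blast
qed

section \<open>Kaehler surfaces\<close>

lemma det_cnj_matrix: "det (cnj_matrix B) = cnj (det (B :: complex ^ 'n ^ 'n))"
  by (simp add: det_def cnj_matrix_def)

lemma inner_vec_complex: "v \<bullet> (w :: complex ^ 'n) = Re (\<Sum>i\<in>UNIV. v $ i * cnj (w $ i))"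
  by (simp add: inner_vec_def inner_complex_def)

lemma det_unitary:
  fixes B :: "complex ^ 'n ^ 'n"
  assumes B: "\<And>v w. (B *v v) \<bullet> (B *v w) = v \<bullet> w"
  shows "cmod (det B) = 1"
proof -
  have ent: "(transpose B ** cnj_matrix B) $ j $ k = mat 1 $ j $ k" for j k
  proof -
    let ?s = "\<lambda>v w :: complex ^ 'n. \<Sum>i\<in>UNIV. v $ i * cnj (w $ i)"
    have col: "(B *v axis l 1) $ i = B $ i $ l" for i l
      by (simp add: matrix_vector_mult_def axis_def if_distrib sum.delta cong: if_cong)
    have "Re (?s (B *v axis j 1) (B *v axis k 1)) = Re (?s (axis j 1) (axis k 1))"
      using B[of "axis j 1" "axis k 1"] by (simp only: inner_vec_complex)
    moreover have "Im (?s (B *v axis j 1) (B *v axis k 1)) = Im (?s (axis j 1) (axis k 1))"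
    proof -
      have "?s v (\<i> *s w) = - \<i> * ?s v w" for v w by (simp add: sum_distrib_left sum_negf mult_ac)
      then have "Im (?s v w) = v \<bullet> (\<i> *s w)" for v w by (simp only: inner_vec_complex) simp
      then show ?thesis using B[of "axis j 1" "\<i> *s axis k 1"] by simp
    qed
    ultimately have "?s (B *v axis j 1) (B *v axis k 1) = ?s (axis j 1) (axis k 1)" by (simp only: complex_eq_iff)
    moreover have "?s (axis j 1) (axis k 1) = mat 1 $ j $ k"
    proof (cases "j = k")
      case True
      then show ?thesis by (simp add: axis_def mat_def if_distrib if_distribR sum.delta cong: if_cong)
    next
      case False
      then show ?thesis by (auto simp: axis_def mat_def intro!: sum.neutral)
    qed
    ultimately show ?thesis by (simp add: col matrix_matrix_mult_def transpose_def cnj_matrix_def)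
  qed
  then have "transpose B ** cnj_matrix B = mat 1" by (simp add: vec_eq_iff)
  then have "det (transpose B ** cnj_matrix B) = 1" by simp
  then have "det B * cnj (det B) = 1" by (simp add: det_mul det_transpose det_cnj_matrix)
  then have "(cmod (det B))\<^sup>2 = 1" by (simp only: complex_norm_square[symmetric]) (metis of_real_eq_1_iff)
  then show ?thesis using norm_ge_zero[of "det B"] by (simp add: power2_eq_1_iff)
qed

lemma sum_Basis_complex_vec:
  fixes f :: "complex ^ 'n \<Rightarrow> real"
  shows "(\<Sum>b\<in>Basis. f b) = (\<Sum>k\<in>UNIV. f (axis k 1) + f (axis k \<i>))"
proof -
  have B: "(Basis :: (complex ^ 'n) set) = (\<lambda>(k, b). axis k b) ` (UNIV \<times> {1, \<i>})"
    by (auto simp: Basis_vec_def Basis_complex_def)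
  have inj: "inj_on (\<lambda>(k, b). axis k b :: complex ^ 'n) (UNIV \<times> {1, \<i>})"
    by (auto simp: inj_on_def axis_eq_axis)
  have "(\<Sum>b\<in>Basis. f b) = (\<Sum>(k, b)\<in>UNIV \<times> {1, \<i>}. f (axis k b))"
    unfolding B by (subst sum.reindex[OF inj]) (simp add: o_def case_prod_unfold)
  also have "\<dots> = (\<Sum>k\<in>UNIV. \<Sum>b\<in>{1, \<i>}. f (axis k b))" by (rule sum.cartesian_product[symmetric])
  finally show ?thesis by simp
qed

text \<open>Expanding the elements of \<open>B\<close> in the standard basis reduces the claim to Parseval's identity.\<close>

lemma sum_orthonormal_basis:
  fixes q :: "'a::euclidean_space \<Rightarrow> 'a \<Rightarrow> real"
  assumes q: "bilinear q" and B: "pairwise orthogonal B" "\<And>x. x \<in> B \<Longrightarrow> norm x = 1" "span B = UNIV" "finite B"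
  shows "(\<Sum>f\<in>B. q f f) = (\<Sum>b\<in>Basis. q b b)"
proof -
  have expand: "(\<Sum>f\<in>B. (f \<bullet> x) *\<^sub>R f) = x" for x
    using orthonormal_basis_expand[OF B(1,2) _ B(4), of x] B(3) by (simp add: inner_commute[of x])
  have parseval: "(\<Sum>f\<in>B. (f \<bullet> b) * (f \<bullet> b')) = b \<bullet> b'" for b b'
  proof -
    have "b \<bullet> b' = (\<Sum>f\<in>B. (f \<bullet> b) *\<^sub>R f) \<bullet> b'" by (simp only: expand)
    then show ?thesis by (simp add: inner_sum_left)
  qed
  have qe: "q f f = (\<Sum>b\<in>Basis. \<Sum>b'\<in>Basis. (f \<bullet> b) * (f \<bullet> b') * q b b')" for f
  proof -
    have "q f f = q (\<Sum>b\<in>Basis. (f \<bullet> b) *\<^sub>R b) (\<Sum>b\<in>Basis. (f \<bullet> b) *\<^sub>R b)" by (simp add: euclidean_representation)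
    also have "\<dots> = (\<Sum>(b, b')\<in>Basis \<times> Basis. q ((f \<bullet> b) *\<^sub>R b) ((f \<bullet> b') *\<^sub>R b'))"
      by (rule bilinear_sum[OF q])
    also have "\<dots> = (\<Sum>b\<in>Basis. \<Sum>b'\<in>Basis. (f \<bullet> b) * (f \<bullet> b') * q b b')"
      by (simp add: sum.cartesian_product bilinear_lmul[OF q] bilinear_rmul[OF q] mult_ac)
    finally show ?thesis .
  qed
  have "(\<Sum>f\<in>B. q f f) = (\<Sum>f\<in>B. \<Sum>b\<in>Basis. \<Sum>b'\<in>Basis. (f \<bullet> b) * (f \<bullet> b') * q b b')"
    by (simp only: qe)
  also have "\<dots> = (\<Sum>b\<in>Basis. \<Sum>f\<in>B. \<Sum>b'\<in>Basis. (f \<bullet> b) * (f \<bullet> b') * q b b')" by (rule sum.swap)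
  also have "\<dots> = (\<Sum>b\<in>Basis. \<Sum>b'\<in>Basis. (\<Sum>f\<in>B. (f \<bullet> b) * (f \<bullet> b')) * q b b')"
  proof (rule sum.cong[OF refl])
    fix b :: 'a
    have "(\<Sum>f\<in>B. \<Sum>b'\<in>Basis. (f \<bullet> b) * (f \<bullet> b') * q b b') = (\<Sum>b'\<in>Basis. \<Sum>f\<in>B. (f \<bullet> b) * (f \<bullet> b') * q b b')"
      by (rule sum.swap)
    then show "(\<Sum>f\<in>B. \<Sum>b'\<in>Basis. (f \<bullet> b) * (f \<bullet> b') * q b b') = (\<Sum>b'\<in>Basis. (\<Sum>f\<in>B. (f \<bullet> b) * (f \<bullet> b')) * q b b')"
      by (simp only: sum_distrib_right)
  qed
  also have "\<dots> = (\<Sum>b\<in>Basis. q b b)"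
    by (simp add: parseval inner_Basis if_distrib if_distribR sum.delta cong: if_cong)
  finally show ?thesis .
qed

text \<open>The covariant derivative \<open>S\<close> of the Kaehler form is antisymmetric in its last two arguments, and its
  cyclic sum vanishes since the form is closed.  The symmetry of \<open>\<Gamma>\<close> in holomorphic coordinates gives
  the relation \<open>S(\<i>u,v,w) + S(\<i>v,w,u) = S(\<i>w,u,v)\<close>.  Together with its cyclic permutations
  it implies \<open>S = 0\<close>.\<close>

lemma kaehler_parallel_complex_structure:
  assumes atlas: "complex_atlas A" and conn: "affine_connection A \<Gamma>"
    and K: "kaehler_metric A g" and LC: "levi_civita A \<Gamma> g"
  shows "parallel_complex_structure A \<Gamma>"
  unfolding parallel_complex_structure_def
proof (intro ballI allI)
  interpret complex_manifold A by unfold_locales (rule atlas)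
  fix c x u0 v0 assume c: "c \<in> A" "x \<in> chart_img c"
  have H: "hermitian_metric A g" using K by (simp add: kaehler_metric_def)
  have bil: "bilinear (g c y)" and sym: "g c y u v = g c y v u" and pos: "u \<noteq> 0 \<Longrightarrow> 0 < g c y u u"
    and inv: "g c y (\<i> *s u) (\<i> *s v) = g c y u v" if "y \<in> chart_img c" for y u v
    using H c(1) that unfolding hermitian_metric_def by blast+
  have sm: "smooth_on (chart_img c) (\<lambda>y. g c y u v)" for u v
    using H c(1) unfolding hermitian_metric_def by blast
  have diff: "(\<lambda>y. g c y u v) differentiable (at x)" for u v
  proof -
    have "Ck_on (Suc 0) (chart_img c) (\<lambda>y. g c y u v)" using sm unfolding smooth_on_def by blast
    then show ?thesis using c(2) by (simp only: Ck_on.simps)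
  qed
  have \<Gamma>bil: "bilinear (\<Gamma> c x)" using conn c unfolding affine_connection_def by blast
  have \<Gamma>sym: "\<Gamma> c x u v = \<Gamma> c x v u" for u v using LC c unfolding levi_civita_def torsion_free_def by blast
  have lc: "frechet_derivative (\<lambda>y. g c y v w) (at x) u = g c x (\<Gamma> c x u v) w + g c x v (\<Gamma> c x u w)" for u v w
    using LC c unfolding levi_civita_def by blast
  note gadd = bilinear_ladd[OF bil[OF c(2)]] bilinear_radd[OF bil[OF c(2)]] bilinear_lsub[OF bil[OF c(2)]]
    bilinear_rsub[OF bil[OF c(2)]] bilinear_lneg[OF bil[OF c(2)]] bilinear_rneg[OF bil[OF c(2)]]
  have ii: "\<i> *s (\<i> *s v) = - v" for v :: "complex ^ 'b" by (simp add: vec_eq_iff)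
  have skew: "g c y (\<i> *s v) w = - g c y v (\<i> *s w)" if "y \<in> chart_img c" for y v w
    using inv[OF that, of v "\<i> *s w"] by (simp add: ii bilinear_rneg[OF bil[OF that]])
  define S where "S = (\<lambda>u v w. g c x (\<Gamma> c x u (\<i> *s v) - \<i> *s \<Gamma> c x u v) w)"
  have S: "S u v w = g c x (\<Gamma> c x u (\<i> *s v)) w + g c x (\<Gamma> c x u v) (\<i> *s w)" for u v w
    by (simp add: S_def gadd skew[OF c(2)])
  have anti: "S u v w = - S u w v" for u v w
  proof -
    have d: "((\<lambda>y. g c y (\<i> *s v) w) has_derivative frechet_derivative (\<lambda>y. g c y (\<i> *s v) w) (at x)) (at x)"
      "((\<lambda>y. g c y v (\<i> *s w)) has_derivative frechet_derivative (\<lambda>y. g c y v (\<i> *s w)) (at x)) (at x)"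
      using diff by (simp_all add: frechet_derivative_works)
    have "((\<lambda>y. g c y (\<i> *s v) w) has_derivative (\<lambda>u. - frechet_derivative (\<lambda>y. g c y v (\<i> *s w)) (at x) u)) (at x)"
      by (rule has_derivative_transform_within_open[OF has_derivative_minus[OF d(2)] open_img[OF c(1)] c(2)]) (simp add: skew)
    with d(1) have "frechet_derivative (\<lambda>y. g c y (\<i> *s v) w) (at x) = (\<lambda>u. - frechet_derivative (\<lambda>y. g c y v (\<i> *s w)) (at x) u)"
      by (rule has_derivative_unique)
    then have "frechet_derivative (\<lambda>y. g c y (\<i> *s v) w) (at x) u = - frechet_derivative (\<lambda>y. g c y v (\<i> *s w)) (at x) u" by meson
    then show ?thesis unfolding lc S
      using sym[OF c(2), of v "\<Gamma> c x u (\<i> *s w)"] sym[OF c(2), of "\<i> *s v" "\<Gamma> c x u w"] by simp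
  qed
  have cyc: "S u v w + S v w u + S w u v = 0" for u v w
  proof -
    have "frechet_derivative (\<lambda>y. kaehler_form g c y v w) (at x) u
        + frechet_derivative (\<lambda>y. kaehler_form g c y w u) (at x) v
        + frechet_derivative (\<lambda>y. kaehler_form g c y u v) (at x) w = 0"
      using K c unfolding kaehler_metric_def by blast
    then show ?thesis unfolding kaehler_form_def lc S
      using sym[OF c(2), of "\<i> *s v" "\<Gamma> c x u w"] sym[OF c(2), of "\<i> *s w" "\<Gamma> c x v u"] sym[OF c(2), of "\<i> *s u" "\<Gamma> c x w v"]
        \<Gamma>sym[of u w] \<Gamma>sym[of v u] \<Gamma>sym[of w v] by simp
  qed
  have star: "S (\<i> *s u) v w + S (\<i> *s v) w u = S (\<i> *s w) u v" for u v w
  proof -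
    have "S (\<i> *s u) v w - S (\<i> *s v) u w = - (S u v (\<i> *s w) - S v u (\<i> *s w))"
      unfolding S using \<Gamma>sym[of "\<i> *s u" "\<i> *s v"] \<Gamma>sym[of "\<i> *s u" v] \<Gamma>sym[of "\<i> *s v" u] \<Gamma>sym[of u v]
      by (simp add: ii gadd)
    then show ?thesis using anti[of "\<i> *s v" u w] anti[of v u "\<i> *s w"] cyc[of u v "\<i> *s w"] by linarith
  qed
  have Si0: "S (\<i> *s v) w u = 0" for u v w
    using star[of u v w] star[of v w u] by linarith
  have "S u0 v0 w = 0" for w
  proof -
    have "S (\<i> *s (- (\<i> *s u0))) v0 w = 0" by (rule Si0)
    moreover have "\<i> *s (- (\<i> *s u0)) = u0" by (simp add: vec_eq_iff)
    ultimately show ?thesis by simp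
  qed
  then have "S u0 v0 (\<Gamma> c x u0 (\<i> *s v0) - \<i> *s \<Gamma> c x u0 v0) = 0" by blast
  then have "\<Gamma> c x u0 (\<i> *s v0) - \<i> *s \<Gamma> c x u0 v0 = 0"
    unfolding S_def using pos[OF c(2)] by fastforce
  then show "\<Gamma> c x u0 (\<i> *s v0) = \<i> *s \<Gamma> c x u0 v0" by simp
qed

locale kaehler_connection = complex_connection A \<Gamma>
  for A :: "('p::t2_space, 'n::finite) chart set" and \<Gamma> +
  fixes g :: "('p, 'n) metric"
  assumes hermitian: "hermitian_metric A g" and levi_civita: "levi_civita A \<Gamma> g"
begin

lemma g_bilinear: "c \<in> A \<Longrightarrow> x \<in> chart_img c \<Longrightarrow> bilinear (g c x)"
  and g_sym: "c \<in> A \<Longrightarrow> x \<in> chart_img c \<Longrightarrow> g c x u v = g c x v u"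
  and g_pos: "c \<in> A \<Longrightarrow> x \<in> chart_img c \<Longrightarrow> u \<noteq> 0 \<Longrightarrow> 0 < g c x u u"
  and g_I: "c \<in> A \<Longrightarrow> x \<in> chart_img c \<Longrightarrow> g c x (\<i> *s u) (\<i> *s v) = g c x u v"
  and g_smooth: "c \<in> A \<Longrightarrow> smooth_on (chart_img c) (\<lambda>x. g c x u v)"
  and g_chart: "c \<in> A \<Longrightarrow> d \<in> A \<Longrightarrow> x \<in> overlap c d \<Longrightarrow>
     g d (transition c d x) (dtrans c d x u) (dtrans c d x v) = g c x u v"
  using hermitian unfolding hermitian_metric_def by blast+

lemma g_has_derivative:
  assumes c: "c \<in> A" "x \<in> chart_img c"
  shows "((\<lambda>y. g c y v w) has_derivative (\<lambda>u. g c x (\<Gamma> c x u v) w + g c x v (\<Gamma> c x u w))) (at x)"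
proof -
  have "Ck_on (Suc 0) (chart_img c) (\<lambda>y. g c y v w)" using g_smooth[OF c(1)] unfolding smooth_on_def by blast
  then have "(\<lambda>y. g c y v w) differentiable (at x)" using c(2) by (simp only: Ck_on.simps)
  then have "((\<lambda>y. g c y v w) has_derivative frechet_derivative (\<lambda>y. g c y v w) (at x)) (at x)"
    by (simp add: frechet_derivative_works)
  moreover have "frechet_derivative (\<lambda>y. g c y v w) (at x) = (\<lambda>u. g c x (\<Gamma> c x u v) w + g c x v (\<Gamma> c x u w))"
    using levi_civita c unfolding levi_civita_def by blast
  ultimately show ?thesis by simp
qed

definition unitary_frames :: "('p, 'n) chart \<Rightarrow> complex ^ 'n \<Rightarrow> (complex ^ 'n ^ 'n) set" where
  "unitary_frames c x = {H. \<forall>v w. g c x (H *v v) (H *v w) = v \<bullet> w}"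

lemma unitary_frame_invertible:
  assumes c: "c \<in> A" "x \<in> chart_img c" and H: "H \<in> unitary_frames c x" shows "invertible H"
proof -
  have "v = 0" if "H *v v = 0" for v
  proof -
    have "v \<bullet> v = g c x (H *v v) (H *v v)" using H by (simp add: unitary_frames_def)
    also have "\<dots> = 0" unfolding that by (rule bilinear_lzero[OF g_bilinear[OF c]])
    finally show ?thesis by simp
  qed
  then obtain G where "G ** H = mat 1" using matrix_left_invertible_ker[of H] by blast
  then show ?thesis unfolding invertible_def using matrix_left_right_inverse by blast
qed

lemma metric_constant_along_transport:
  assumes c: "c \<in> A" and seg: "closed_segment y z \<subseteq> chart_img c" and X: "segment_transport c y z X Y"
  shows "g c z (X 1 *v a) (X 1 *v b) = g c y a b"
proof -
  define l where "l = (\<lambda>t. y + t *\<^sub>R (z - y))"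
  have limg: "l t \<in> chart_img c" if "t \<in> {0..1}" for t
  proof -
    have "l t \<in> closed_segment y z"
      unfolding in_segment l_def using that by (intro exI[of _ t]) (simp add: algebra_simps)
    then show ?thesis using seg by blast
  qed
  note P = X[unfolded segment_transport_def fundamental_pair_def]
  have lder: "(l has_derivative (\<lambda>h. h *\<^sub>R (z - y))) (at t within {0..1})" for t
    unfolding l_def by (auto intro!: derivative_eq_intros)
  have Xd: "((\<lambda>s. X s *v a) has_vector_derivative - \<Gamma> c (l t) (z - y) (X t *v a)) (at t within {0..1})" if t: "t \<in> {0..1}" for t a
  proof -
    have "(X has_vector_derivative - (chris c (l t) (z - y) ** X t)) (at t within {0..1})"
      using P t unfolding l_def by blast
    from bounded_linear.has_vector_derivative[OF bounded_bilinear.bounded_linear_left[OF bounded_bilinear_matrix_vector_mult] this]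
    show ?thesis
      by (simp add: \<Gamma>_chris[OF c limg[OF t]] matrix_vector_mul_assoc[symmetric] bounded_bilinear.minus_left[OF bounded_bilinear_matrix_vector_mult])
  qed
  have gd: "((\<lambda>s. g c (l s) v w) has_vector_derivative
      (g c (l t) (\<Gamma> c (l t) (z - y) v) w + g c (l t) v (\<Gamma> c (l t) (z - y) w))) (at t within {0..1})"
    if t: "t \<in> {0..1}" for t v w
    using has_derivative_compose[OF lder g_has_derivative[OF c limg[OF t]]] bilinear_\<Gamma>[OF c limg[OF t]] g_bilinear[OF c limg[OF t]]
    by (simp add: has_vector_derivative_def bilinear_lmul bilinear_rmul distrib_left)
  have gd2: "((\<lambda>s. g c (l s) v (X s *v b)) has_vector_derivative g c (l t) (\<Gamma> c (l t) (z - y) v) (X t *v b)) (at t within {0..1})"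
    if t: "t \<in> {0..1}" for t v
  proof -
    have "((\<lambda>s. g c (l s) v (X s *v b)) has_vector_derivative
        (g c (l t) (\<Gamma> c (l t) (z - y) v) (X t *v b) + g c (l t) v (\<Gamma> c (l t) (z - y) (X t *v b)))
        + g c (l t) v (- \<Gamma> c (l t) (z - y) (X t *v b))) (at t within {0..1})"
      by (rule has_vector_derivative_linear_family[where L = "\<lambda>s. g c (l s) v", OF t _ _ gd[OF t] Xd[OF t]])
        (use gd[OF t] g_bilinear[OF c limg] in \<open>auto simp: bilinear_def\<close>)
    then show ?thesis using bilinear_rneg[OF g_bilinear[OF c limg[OF t]]] by simp
  qed
  have d0: "((\<lambda>s. g c (l s) (X s *v a) (X s *v b)) has_vector_derivative 0) (at t within {0..1})" if t: "t \<in> {0..1}" for t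
  proof -
    have "((\<lambda>s. g c (l s) (X s *v a) (X s *v b)) has_vector_derivative
        g c (l t) (\<Gamma> c (l t) (z - y) (X t *v a)) (X t *v b) + g c (l t) (- \<Gamma> c (l t) (z - y) (X t *v a)) (X t *v b)) (at t within {0..1})"
      by (rule has_vector_derivative_linear_family[where L = "\<lambda>s p. g c (l s) p (X s *v b)", OF t _ _ gd2[OF t] Xd[OF t]])
        (use gd2[OF t] g_bilinear[OF c limg] in \<open>auto simp: bilinear_def\<close>)
    then show ?thesis using bilinear_lneg[OF g_bilinear[OF c limg[OF t]]] by simp
  qed
  obtain k where k: "\<And>s. s \<in> {0..1} \<Longrightarrow> g c (l s) (X s *v a) (X s *v b) = k"
    using has_vector_derivative_zero_constant[of "{0..1}" "\<lambda>s. g c (l s) (X s *v a) (X s *v b)"] d0 by auto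
  show ?thesis using k[of 0] k[of 1] P by (simp add: l_def)
qed

text \<open>Gram-Schmidt orthogonalisation in complex dimension two.\<close>

lemma unitary_frame_exists:
  assumes n: "(UNIV :: 'n set) = {i, j}" "i \<noteq> j" and c: "c \<in> A" "x \<in> chart_img c"
  shows "unitary_frames c x \<noteq> {}"
proof -
  note b = g_bilinear[OF c]
  note gb = bilinear_ladd[OF b] bilinear_radd[OF b] bilinear_lsub[OF b] bilinear_rsub[OF b] bilinear_lmul[OF b] bilinear_rmul[OF b]
    bilinear_lneg[OF b] bilinear_rneg[OF b]
  have sum_real: "(\<Sum>k\<in>UNIV. h k) = h i + h j" for h :: "'n \<Rightarrow> real" unfolding n(1) using n(2) by simp
  have sum_complex: "(\<Sum>k\<in>UNIV. h k) = h i + h j" for h :: "'n \<Rightarrow> complex" unfolding n(1) using n(2) by simp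
  have ii: "\<i> *s (\<i> *s v) = - v" for v :: "complex ^ 'n" by (simp add: vec_eq_iff)
  have uI: "g c x u (\<i> *s u) = 0" for u
    using g_I[OF c, of u "\<i> *s u"] g_sym[OF c, of u "\<i> *s u"] by (simp add: ii gb)
  have normalize: "\<exists>r>0. g c x (r *\<^sub>R u) (r *\<^sub>R u) = 1" if "u \<noteq> 0" for u
    using g_pos[OF c that] by (intro exI[of _ "1 / sqrt (g c x u u)"]) (simp add: gb)
  have "axis i (1::complex) \<noteq> (0 :: complex ^ 'n)" by (simp add: axis_eq_0_iff)
  then obtain r where r: "r > 0" "g c x (r *\<^sub>R axis i 1) (r *\<^sub>R axis i 1) = 1" using normalize by blast
  define e where "e = r *\<^sub>R (axis i (1::complex) :: complex ^ 'n)"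
  have ee: "g c x e e = 1" using r by (simp add: e_def)
  define f0 where "f0 = axis j 1 - (g c x (axis j 1) e *\<^sub>R e + g c x (axis j 1) (\<i> *s e) *\<^sub>R (\<i> *s e))"
  have "f0 $ j = 1" using n(2) by (simp add: f0_def e_def axis_def)
  then have "f0 \<noteq> 0" by auto
  then obtain s where s: "s > 0" "g c x (s *\<^sub>R f0) (s *\<^sub>R f0) = 1" using normalize by blast
  define f where "f = s *\<^sub>R f0"
  have ff: "g c x f f = 1" using s by (simp add: f_def)
  have eIe: "g c x e (\<i> *s e) = 0" "g c x (\<i> *s e) e = 0" "g c x (\<i> *s e) (\<i> *s e) = 1"
    using uI[of e] g_sym[OF c, of e "\<i> *s e"] g_I[OF c, of e e] ee by simp_all
  have fe: "g c x f e = 0" "g c x f (\<i> *s e) = 0" by (simp_all add: f_def f0_def gb eIe ee)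
  have fe': "g c x (\<i> *s f) (\<i> *s e) = 0" "g c x (\<i> *s f) e = 0"
    using fe g_I[OF c, of f e] g_I[OF c, of f "\<i> *s e"] by (simp_all add: ii gb)
  have ef: "g c x e f = 0" "g c x e (\<i> *s f) = 0" "g c x (\<i> *s e) f = 0" "g c x (\<i> *s e) (\<i> *s f) = 0"
    using fe fe' g_sym[OF c] by simp_all
  have fIf: "g c x f (\<i> *s f) = 0" "g c x (\<i> *s f) f = 0" "g c x (\<i> *s f) (\<i> *s f) = 1"
    using uI[of f] g_sym[OF c, of f "\<i> *s f"] g_I[OF c, of f f] ff by simp_all
  define H where "H = (\<chi> k l. if l = i then e $ k else f $ k)"
  have H: "H *v v = Re (v $ i) *\<^sub>R e + Im (v $ i) *\<^sub>R (\<i> *s e) + Re (v $ j) *\<^sub>R f + Im (v $ j) *\<^sub>R (\<i> *s f)" for v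
    using n(2) by (simp add: H_def vec_eq_iff matrix_vector_mult_def sum_real sum_complex complex_eq_iff algebra_simps)
  have "g c x (H *v v) (H *v w) = v \<bullet> w" for v w
  proof -
    have "v \<bullet> w = Re (v $ i) * Re (w $ i) + Im (v $ i) * Im (w $ i) + Re (v $ j) * Re (w $ j) + Im (v $ j) * Im (w $ j)"
      by (simp add: inner_vec_def inner_complex_def sum_real)
    then show ?thesis unfolding H by (simp add: gb ee ff eIe fe fe' ef fIf)
  qed
  then show ?thesis unfolding unitary_frames_def by blast
qed

theorem unitary_frame_bundle:
  assumes n: "CARD('n) = 2"
  shows "frame_bundle A \<Gamma> unitary_frames"
proof unfold_locales
  show "invertible H" if "c \<in> A" "x \<in> chart_img c" "H \<in> unitary_frames c x" for c x H
    by (rule unitary_frame_invertible[OF that])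
  obtain i j where "(UNIV :: 'n set) = {i, j}" "i \<noteq> j" using n by (auto simp: card_2_iff)
  then show "unitary_frames c x \<noteq> {}" if "c \<in> A" "x \<in> chart_img c" for c x
    using unitary_frame_exists that by blast
  show "jacobian c d x ** H \<in> unitary_frames d (transition c d x)"
    if "c \<in> A" "d \<in> A" "x \<in> overlap c d" "H \<in> unitary_frames c x" for c d x H
    using that(4) g_chart[OF that(1-3)]
    by (simp add: unitary_frames_def matrix_vector_mul_assoc[symmetric] dtrans_jacobian[OF that(1-3), symmetric])
  show "X 1 ** H \<in> unitary_frames c z"
    if "c \<in> A" "segment_transport c y z X Y" "closed_segment y z \<subseteq> chart_img c" "H \<in> unitary_frames c y" for c y z X Y H
    using that(4) metric_constant_along_transport[OF that(1,3,2)]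
    by (simp add: unitary_frames_def matrix_vector_mul_assoc[symmetric])
  show "cmod (det H) = cmod (det H')"
    if c: "c \<in> A" "x \<in> chart_img c" and H: "H \<in> unitary_frames c x" "H' \<in> unitary_frames c x" for c x H H'
  proof -
    obtain G where G: "H' ** G = mat 1" "G ** H' = mat 1"
      using unitary_frame_invertible[OF c H(2)] unfolding invertible_def by blast
    have HG: "H' ** (G ** H) = H" using G by (simp add: matrix_mul_assoc)
    have "((G ** H) *v v) \<bullet> ((G ** H) *v w) = v \<bullet> w" for v w
    proof -
      have "((G ** H) *v v) \<bullet> ((G ** H) *v w) = g c x (H' *v ((G ** H) *v v)) (H' *v ((G ** H) *v w))"
        using H(2) by (simp add: unitary_frames_def)
      also have "\<dots> = g c x (H *v v) (H *v w)" by (simp only: matrix_vector_mul_assoc HG)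
      finally show ?thesis using H(1) by (simp add: unitary_frames_def)
    qed
    then have "cmod (det (G ** H)) = 1" by (rule det_unitary)
    moreover have "det H = det H' * det (G ** H)" using arg_cong[OF HG, of det] by (simp only: det_mul)
    ultimately show ?thesis by (simp add: norm_mult)
  qed
qed

lemma rtrace_Basis: "(\<Sum>b\<in>Basis. f b \<bullet> b) = rtrace f"
  by (simp add: sum_Basis_complex_vec rtrace_def inner_axis)

text \<open>By the contracted Bianchi identity \<open>2 \<rho>(u,\<i>u) = Ric(u,u) + Ric(\<i>u,\<i>u)\<close>, and the columns of a
  unitary frame together with their multiples by \<open>\<i>\<close> form an orthonormal basis.\<close>

lemma scalar_curvature_ricci_form:
  assumes c: "c \<in> A" "x \<in> chart_img c" and H: "H \<in> unitary_frames c x"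
  shows "scalar_curvature \<Gamma> g c x = 2 * (\<Sum>k\<in>UNIV. ricci_form \<Gamma> c x (H *v axis k 1) (\<i> *s (H *v axis k 1)))"
proof -
  interpret curvature_tensor "curv c x" by (rule curvature_tensor_curv[OF c])
  have ricci: "ricci_tensor \<Gamma> c x v w = ric v w" for v w
    by (simp add: ricci_tensor_def curvature_curv[OF c] rtrace_Basis ric_def)
  have ric_bil: "bilinear ric"
    unfolding bilinear_def
  proof (intro conjI allI)
    show "linear (ric v)" for v
      by (rule linearI) (simp_all add: ric_def rtrace_def matrix_vector_right_distrib sum_distrib_left
          linear_scale[OF linear_complex_matrix_vector_mult] sum.distrib[symmetric] algebra_simps)
    show "linear (\<lambda>v. ric v w)" for w
    proof -
      have swap: "curv c x e v *v w = - (curv c x v e *v w)" for e v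
        unfolding curv_antisym[of c x e v] by (rule bounded_bilinear.minus_left[OF bounded_bilinear_matrix_vector_mult])
      have alt: "ric v w = rtrace (\<lambda>e. - (curv c x v e *v w))" for v
        unfolding ric_def by (rule arg_cong[where f = rtrace], rule ext, rule swap)
      show ?thesis
        unfolding alt
        by (rule linearI) (simp_all add: rtrace_def linear_add[OF R_linear] linear_scale[OF R_linear]
          bounded_bilinear.scaleR_left[OF bounded_bilinear_matrix_vector_mult] bounded_bilinear.add_left[OF bounded_bilinear_matrix_vector_mult]
          sum_distrib_left sum.distrib[symmetric] algebra_simps)
    qed
  qed
  define q where "q = (\<lambda>v w. ric (H *v v) (H *v w))"
  have q: "bilinear q"
    unfolding q_def bilinear_def
  proof (intro conjI allI)
    show "linear (\<lambda>w. ric (H *v v) (H *v w))" for v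
      using linear_compose[OF linear_complex_matrix_vector_mult, of "ric (H *v v)" H] ric_bil by (simp add: bilinear_def o_def)
    show "linear (\<lambda>v. ric (H *v v) (H *v w))" for w
      using linear_compose[OF linear_complex_matrix_vector_mult, of "\<lambda>v. ric v (H *v w)" H] ric_bil by (simp add: bilinear_def o_def)
  qed
  obtain G where G: "H ** G = mat 1" "G ** H = mat 1"
    using unitary_frame_invertible[OF c H] unfolding invertible_def by blast
  have HG: "H *v (G *v v) = v" "G *v (H *v v) = v" for v by (simp_all add: matrix_vector_mul_assoc G)
  have iso: "g c x (H *v v) (H *v w) = v \<bullet> w" for v w using H by (simp add: unitary_frames_def)
  have iso': "(G *v v) \<bullet> (G *v w) = g c x v w" for v w using iso[of "G *v v" "G *v w"] by (simp add: HG)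
  have injG: "inj ((*v) G)" by (rule inj_on_inverseI[of _ "(*v) H"]) (simp add: HG)
  have injH: "inj ((*v) H)" by (rule inj_on_inverseI[of _ "(*v) G"]) (simp add: HG)
  have surjH: "range ((*v) H) = UNIV" and surjG: "range ((*v) G) = UNIV" using HG by (metis surjI)+
  have "orthonormal_basis_for (g c x) ((*v) H ` Basis)"
    unfolding orthonormal_basis_for_def
  proof (intro conjI ballI)
    show "span ((*v) H ` Basis) = UNIV"
      by (simp add: linear_span_image[OF linear_complex_matrix_vector_mult] surjH)
    fix u v assume "u \<in> (*v) H ` Basis" "v \<in> (*v) H ` Basis"
    then obtain b b' where b: "b \<in> Basis" "b' \<in> Basis" "u = H *v b" "v = H *v b'" by blast
    then show "g c x u v = (if u = v then 1 else 0)"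
      using injH by (auto simp: iso inner_Basis inj_eq)
  qed
  then have some: "orthonormal_basis_for (g c x) (SOME B. orthonormal_basis_for (g c x) B)" by (rule someI)
  define B where "B = (SOME B. orthonormal_basis_for (g c x) B)"
  note basis = some[folded B_def, unfolded orthonormal_basis_for_def]
  have B: "span B = UNIV" by (rule conjunct1[OF basis])
  have B_g: "g c x u v = (if u = v then 1 else 0)" if "u \<in> B" "v \<in> B" for u v
    by (rule bspec[OF bspec[OF conjunct2[OF basis] that(1)] that(2)])
  define B1 where "B1 = (*v) G ` B"
  have B1: "u \<bullet> v = (if u = v then 1 else 0)" if "u \<in> B1" "v \<in> B1" for u v
    using that B_g injG by (auto simp: B1_def iso' inj_eq)
  have norm1: "norm u = 1" if "u \<in> B1" for u using B1[OF that that] by (simp add: norm_eq_1)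
  have orth: "pairwise orthogonal B1" using B1 by (auto simp: pairwise_def orthogonal_def)
  have "independent B1" by (rule pairwise_orthogonal_independent[OF orth]) (use norm1 in force)
  then have fin: "finite B1" by (rule independent_imp_finite)
  have span1: "span B1 = UNIV"
    unfolding B1_def by (simp add: linear_span_image[OF linear_complex_matrix_vector_mult] B surjG)
  have "scalar_curvature \<Gamma> g c x = (\<Sum>e\<in>B. ric e e)"
    by (simp add: scalar_curvature_def B_def ricci)
  also have "\<dots> = (\<Sum>f\<in>B1. q f f)"
    unfolding B1_def q_def by (subst sum.reindex[OF inj_on_subset[OF injG subset_UNIV]]) (simp add: HG)
  also have "\<dots> = (\<Sum>b\<in>Basis. q b b)" by (rule sum_orthonormal_basis[OF q orth norm1 span1 fin])
  also have "\<dots> = (\<Sum>k\<in>UNIV. q (axis k 1) (axis k 1) + q (axis k \<i>) (axis k \<i>))" by (rule sum_Basis_complex_vec)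
  also have "\<dots> = (\<Sum>k\<in>UNIV. 2 * ricci_form \<Gamma> c x (H *v axis k 1) (\<i> *s (H *v axis k 1)))"
  proof (rule sum.cong[OF refl])
    fix k
    define u where "u = H *v axis k 1"
    have ii: "\<i> *s (\<i> *s u) = - u" by (simp add: vec_eq_iff)
    have "ric (\<i> *s u) (\<i> *s u) + ric u u = - 2 * Im (trace (curv c x u (\<i> *s u)))"
      using ric_I[of "\<i> *s u" u] by (simp add: ii ric_minus_right)
    moreover have "ricci_form \<Gamma> c x u (\<i> *s u) = - Im (trace (curv c x u (\<i> *s u)))"
      by (simp add: ricci_form_dtheta[OF c] trace_curv)
    ultimately show "q (axis k 1) (axis k 1) + q (axis k \<i>) (axis k \<i>) = 2 * ricci_form \<Gamma> c x (H *v axis k 1) (\<i> *s (H *v axis k 1))"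
      by (simp add: q_def axis_i u_def)
  qed
  finally show ?thesis by (simp add: sum_distrib_left)
qed

end

section \<open>Plurigenera of \<open>U\<^sup>*(2m)\<close>-manifolds\<close>

lemma zero_in_pluricanonical_sections: "(\<lambda>c x. 0) \<in> pluricanonical_sections A N" if "N \<ge> 1"
  unfolding pluricanonical_sections_def holomorphic_fun_def
  by (auto intro!: exI[of _ "\<lambda>v. 0"])

theorem proposition2:
  fixes A :: "('p::t2_space, 'm::finite + 'm) chart set"
    and \<Gamma> :: "('p, 'm + 'm) christoffel"
  assumes "compact (UNIV :: 'p set)"
    and "connected (UNIV :: 'p set)"
    and "U_star_manifold A \<Gamma>"
    and "\<not> (\<forall>c\<in>A. \<forall>x\<in>chart_img c. \<forall>u v. ricci_form \<Gamma> c x u v = 0)"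
  shows "\<forall>N::nat. N \<ge> 1 \<longrightarrow> pluricanonical_sections A N = {\<lambda>c x. 0}"
proof -
  have atlas: "complex_atlas A" and conn: "affine_connection A \<Gamma>"
    using assms(3) unfolding U_star_manifold_def by blast+
  have "\<exists>F. frame_bundle A \<Gamma> F \<and> (\<forall>c x H. c \<in> A \<longrightarrow> x \<in> chart_img c \<longrightarrow> H \<in> F c x \<longrightarrow>
       (\<Sum>k\<in>UNIV. ricci_form \<Gamma> c x (H *v axis k 1) (\<i> *s (H *v axis k 1))) = 0)"
  proof (cases "CARD('m) = 1")
    case True
    then obtain g where g: "kaehler_metric A g" "levi_civita A \<Gamma> g"
      "\<And>c x. c \<in> A \<Longrightarrow> x \<in> chart_img c \<Longrightarrow> scalar_curvature \<Gamma> g c x = 0"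
      using assms(3) unfolding U_star_manifold_def scalar_flat_kaehler_def by auto
    have tf: "torsion_free A \<Gamma>" using g(2) unfolding levi_civita_def by (rule conjunct1)
    have hm: "hermitian_metric A g" using g(1) unfolding kaehler_metric_def by (rule conjunct1)
    have par: "parallel_complex_structure A \<Gamma>"
      by (rule kaehler_parallel_complex_structure[OF atlas conn g(1,2)])
    interpret kaehler_connection A \<Gamma> g
      by unfold_locales (rule atlas conn tf par hm g(2))+
    have "CARD('m + 'm) = 2" using True by simp
    from unitary_frame_bundle[OF this] show ?thesis
      using scalar_curvature_ricci_form g(3) by (intro exI[of _ unitary_frames]) auto
  next
    case False
    then have m: "CARD('m) > 1" using zero_less_card_finite[where 'a = 'm] by linarith
    have "complex_connection A \<Gamma>" "holonomy_in_U_star A \<Gamma>"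
      using False assms(3) unfolding U_star_manifold_def
      by (auto simp: complex_connection_def complex_connection_axioms_def complex_manifold_def)
    from quaternionic_frame_bundle_exists[OF this(1) assms(2) this(2)]
    obtain F where F: "quaternionic_frame_bundle A \<Gamma> F" by blast
    then interpret quaternionic_frame_bundle A \<Gamma> F .
    show ?thesis using ricci_form_trace_zero[OF m] frame_bundle_axioms by blast
  qed
  then obtain F where F: "frame_bundle A \<Gamma> F" and tr: "\<And>c x H. c \<in> A \<Longrightarrow> x \<in> chart_img c \<Longrightarrow> H \<in> F c x \<Longrightarrow>
       (\<Sum>k\<in>UNIV. ricci_form \<Gamma> c x (H *v axis k 1) (\<i> *s (H *v axis k 1))) = 0" by blast
  show ?thesis
  proof (intro allI impI)
    fix N :: nat assume N: "N \<ge> 1"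
    have "s = (\<lambda>c x. 0)" if s: "s \<in> pluricanonical_sections A N" for s
      using frame_bundle.ricci_flat_if_pluricanonical_section[OF F assms(1,2) tr N s] assms(4) by blast
    then show "pluricanonical_sections A N = {\<lambda>c x. 0}"
      using zero_in_pluricanonical_sections[OF N] by blast
  qed
qed

end
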